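(* Let $n,p\ge1$ and $L\ge2$ be integers, let $\nu>0$, let $\mathbf{x}_1,\dots,\mathbf{x}_n\in\mathbb{R}^p$, let $y_1,\dots,y_n\in\{1,\dots,L\}$, let $\boldsymbol{\Sigma}$ be an $L\times L$ positive definite matrix, and let $\bar{\mathbf{X}}$ and $\boldsymbol{\Lambda}$ be built from them as in the context. Consider the model $$\boldsymbol{\beta}\sim\mathrm{N}_{p(L-1)}(\mathbf{0},\nu^2\mathbf{I}_{p(L-1)}),\qquad \bar{\mathbf{z}}_i\mid\boldsymbol{\beta}\overset{\rm ind}{\sim}\mathrm{N}_{L-1}(\bar{\mathbf{X}}_{[i]}\boldsymbol{\beta},\boldsymbol{\Lambda}_{[ii]}),\qquad \bar{\mathbf{y}}_i=\mathbf{1}[\bar{\mathbf{z}}_i>\mathbf{0}]\ \text{(component-wise)},\quad i=1,\dots,n,$$ write $\bar{\mathbf{z}}=(\bar{\mathbf{z}}_1^\top,\dots,\bar{\mathbf{z}}_n^\top)^\top\in\mathbb{R}^{n(L-1)}$, and let $p(\boldsymbol{\beta},\bar{\mathbf{z}}\mid\bar{\mathbf{y}},\bar{\mathbf{X}})$ be the joint posterior density of $(\boldsymbol{\beta},\bar{\mathbf{z}})$ when all observed $\bar{\mathbf{y}}_i$ equal $(1,\dots,1)^\top\in\mathbb{R}^{L-1}$. Let $$\mathcal{Q}=\Big\{q(\boldsymbol{\beta},\bar{\mathbf{z}})\ :\ q(\boldsymbol{\beta},\bar{\mathbf{z}})=q(\boldsymbol{\beta}\mid\bar{\mathbf{z}})\prod_{i=1}^n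 q(\bar{\mathbf{z}}_i)\Big\}$$ be the class of probability densities on $\mathbb{R}^{p(L-1)}\times\mathbb{R}^{n(L-1)}$ under which $\bar{\mathbf{z}}_1,\dots,\bar{\mathbf{z}}_n$ are independent. Set $$\mathbf{V}=(\nu^{-2}\mathbf{I}_{p(L-1)}+\bar{\mathbf{X}}^\top\boldsymbol{\Lambda}^{-1}\bar{\mathbf{X}})^{-1},\qquad \mathbf{H}=\boldsymbol{\Lambda}^{-1}\bar{\mathbf{X}}\mathbf{V}\bar{\mathbf{X}}^\top\boldsymbol{\Lambda}^{-1}.$$ If $q^*(\boldsymbol{\beta},\bar{\mathbf{z}})=q^*(\boldsymbol{\beta}\mid\bar{\mathbf{z}})\prod_{i=1}^n q^*(\bar{\mathbf{z}}_i)$ minimizes the Kullback–Leibler divergence $\mathrm{KL}[q(\boldsymbol{\beta},\bar{\mathbf{z}})\,\|\,p(\boldsymbol{\beta},\bar{\mathbf{z}}\mid\bar{\mathbf{y}},\bar{\mathbf{X}})]$ over $q\in\mathcal{Q}$, then (up to null sets): (i) $q^*(\boldsymbol{\beta}\mid\bar{\mathbf{z}})=p(\boldsymbol{\beta}\mid\bar{\mathbf{z}},\bar{\mathbf{y}},\bar{\mathbf{X}})=\phi_{p(L-1)}(\boldsymbol{\beta}-\mathbf{V}\bar{\mathbf{X}}^\top\boldsymbol{\Lambda}^{-1}\bar{\mathbf{z}};\mathbf{V})$; (ii) for each $i=1,\dots,n$, $q^*(\bar{\mathbf{z}}_i)$ is the density of the truncated normal distribution $\mathrm{TN}_{L-1}(\boldsymbol{\mu}_i^*,\boldsymbol{\Sigma}_i^*;[0,\infty)^{L-1})$,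 where $$\boldsymbol{\Sigma}_i^*=\big(\boldsymbol{\Lambda}_{[ii]}^{-1}-\mathbf{H}_{[i,i]}\big)^{-1},\qquad \boldsymbol{\mu}_i^*=\boldsymbol{\Sigma}_i^*\,\mathbf{H}_{[i,-i]}\,\mathbb{E}_{q^*(\bar{\mathbf{z}}_{-i})}[\bar{\mathbf{z}}_{-i}].$$
   Context: Notation: $\mathbf{I}_m$ is the $m\times m$ identity, $\otimes$ the Kronecker product, $\phi_m(\cdot;\mathbf{W})$ the density of $\mathrm{N}_m(\mathbf{0},\mathbf{W})$. $\mathrm{TN}_h(\mathbf{m},\mathbf{W};A)$ denotes the $h$-variate normal distribution with mean $\mathbf{m}$ and covariance matrix $\mathbf{W}$ truncated to the region $A$ (i.e. conditioned to lie in $A$); $\mathbf{m},\mathbf{W}$ are the parameters of the untruncated normal. $\mathrm{KL}[q\,\|\,p]=\mathbb{E}_q[\log(q/p)]$. Matrices $\bar{\mathbf{X}}$ and $\boldsymbol{\Lambda}$: for $\ell=1,\dots,L$ let $\mathbf{v}_\ell\in\mathbb{R}^L$ be the vector with $1$ in position $\ell$ and $0$ elsewhere; let $\mathbf{V}_{[-\ell]}$ be the $(L-1)\times L$ matrix whose rows are $(\mathbf{v}_k-\mathbf{v}_\ell)^\top$, $k\ne\ell$ (stacked in increasing order of $k$); let $\bar{\mathbf{V}}_{[-\ell]}$ be the $(L-1)\times(L-1)$ matrix obtained from $\mathbf{V}_{[-\ell]}$ by removing its $L$-th column; and let $\mathbf{X}_{i[-\ell]}=-\bar{\mathbf{V}}_{[-\ell]}\otimes\mathbf{x}_i^\top$,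 of size $(L-1)\times p(L-1)$. Then $\bar{\mathbf{X}}$ is the $n(L-1)\times p(L-1)$ matrix obtained by stacking the row blocks $\bar{\mathbf{X}}_{[i]}=\mathbf{X}_{i[-y_i]}$, $i=1,\dots,n$, and $\boldsymbol{\Lambda}$ is the $n(L-1)\times n(L-1)$ block-diagonal matrix with diagonal blocks $\boldsymbol{\Lambda}_{[ii]}=\mathbf{V}_{[-y_i]}\boldsymbol{\Sigma}\mathbf{V}_{[-y_i]}^\top$. (The matrix $\mathbf{V}$ without subscript in the claim is unrelated to the $\mathbf{V}_{[-\ell]}$.) Block notation: an $n(L-1)\times n(L-1)$ matrix $\mathbf{H}$ is partitioned into $(L-1)\times(L-1)$ blocks indexed by $(i,j)\in\{1,\dots,n\}^2$; $\mathbf{H}_{[i,i]}$ is the $(i,i)$ block and $\mathbf{H}_{[i,-i]}$ is the $(L-1)\times(n-1)(L-1)$ matrix formed by the blocks $(i,j)$, $j\neq i$, in increasing order of $j$. $\bar{\mathbf{z}}_{-i}$ is the vector obtained from $\bar{\mathbf{z}}$ by removing $\bar{\mathbf{z}}_i$, and $q^*(\bar{\mathbf{z}}_{-i})=\prod_{j\neq i}q^*(\bar{\mathbf{z}}_j)$. *)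

theory Defs
  imports "HOL-Probability.Probability" "Jordan_Normal_Form.Gauss_Jordan_Elimination"
    "Jordan_Normal_Form.Determinant"
begin

unbundle no vec_syntax and no inner_syntax

hide_const (open) Finite_Cartesian_Product.vec Finite_Cartesian_Product.row
  Finite_Cartesian_Product.rows Determinants.det Finite_Cartesian_Product.mat

text \<open>All indices start at 0: classes are \<open>0, ..., L - 1\<close>, observations \<open>0, ..., n - 1\<close>.
  The map \<^term>\<open>insert_index l\<close> enumerates the naturals other than \<open>l\<close> in increasing order.\<close>

text \<open>Unspecified if the matrix is singular.\<close>
definition minv :: "real mat \<Rightarrow> real mat" where
  "minv A = the (mat_inverse A)"

definition positive_definite :: "nat \<Rightarrow> real mat \<Rightarrow> bool" where
  "positive_definite k A \<longleftrightarrow> A \<in> carrier_mat k k \<and> A\<^sup>T = A \<and>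
     (\<forall>v \<in> carrier_vec k. v \<noteq> 0\<^sub>v k \<longrightarrow> v \<bullet> (A *\<^sub>v v) > 0)"

definition kronecker :: "real mat \<Rightarrow> real mat \<Rightarrow> real mat" where
  "kronecker A B = mat (dim_row A * dim_row B) (dim_col A * dim_col B)
     (\<lambda>(i, j). A $$ (i div dim_row B, j div dim_col B) * B $$ (i mod dim_row B, j mod dim_col B))"

definition row_block :: "nat \<Rightarrow> real mat \<Rightarrow> nat \<Rightarrow> real mat" where
  "row_block m X i = mat m (dim_col X) (\<lambda>(a, c). X $$ (i * m + a, c))"

definition block :: "nat \<Rightarrow> real mat \<Rightarrow> nat \<Rightarrow> nat \<Rightarrow> real mat" where
  "block m H i j = mat m m (\<lambda>(a, b). H $$ (i * m + a, j * m + b))"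

definition block_row_minus :: "nat \<Rightarrow> nat \<Rightarrow> real mat \<Rightarrow> nat \<Rightarrow> real mat" where
  "block_row_minus n m H i =
     mat m ((n - 1) * m) (\<lambda>(a, c). block m H i (insert_index i (c div m)) $$ (a, c mod m))"

definition V_minus :: "nat \<Rightarrow> nat \<Rightarrow> real mat" where
  "V_minus L l = mat (L - 1) L (\<lambda>(r, c). (unit_vec L (insert_index l r) - unit_vec L l) $ c)"

definition Vbar_minus :: "nat \<Rightarrow> nat \<Rightarrow> real mat" where
  "Vbar_minus L l = mat (L - 1) (L - 1) (\<lambda>(r, c). V_minus L l $$ (r, c))"

definition X_minus :: "nat \<Rightarrow> real vec \<Rightarrow> nat \<Rightarrow> real mat" where
  "X_minus L x l = kronecker (- Vbar_minus L l) (mat_of_rows (dim_vec x) [x])"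

definition Xbar :: "nat \<Rightarrow> nat \<Rightarrow> nat \<Rightarrow> (nat \<Rightarrow> real vec) \<Rightarrow> (nat \<Rightarrow> nat) \<Rightarrow> real mat" where
  "Xbar n p L x y = mat (n * (L - 1)) (p * (L - 1))
     (\<lambda>(r, c). X_minus L (x (r div (L - 1))) (y (r div (L - 1))) $$ (r mod (L - 1), c))"

definition Lambda :: "nat \<Rightarrow> nat \<Rightarrow> real mat \<Rightarrow> (nat \<Rightarrow> nat) \<Rightarrow> real mat" where
  "Lambda n L S y =
     diag_block_mat (map (\<lambda>i. V_minus L (y i) * S * (V_minus L (y i))\<^sup>T) [0..<n])"

text \<open>Euclidean space of dimension \<open>k\<close> with Lebesgue measure; its points are functions on
  \<open>{..<k}\<close>, turned into vectors by \<^term>\<open>vec k\<close>.\<close>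

abbreviation Rn :: "nat \<Rightarrow> (nat \<Rightarrow> real) measure" where
  "Rn k \<equiv> Pi\<^sub>M {..<k} (\<lambda>_. lborel)"

definition zblock :: "nat \<Rightarrow> nat \<Rightarrow> (nat \<Rightarrow> real) \<Rightarrow> (nat \<Rightarrow> real)" where
  "zblock m i z = (\<lambda>a \<in> {..<m}. z (i * m + a))"

definition prob_density :: "'a measure \<Rightarrow> ('a \<Rightarrow> real) \<Rightarrow> bool" where
  "prob_density M f \<longleftrightarrow> f \<in> borel_measurable M \<and> (\<forall>x \<in> space M. 0 \<le> f x) \<and>
     prob_space (density M (\<lambda>x. ennreal (f x)))"

definition normal_dens :: "real mat \<Rightarrow> real vec \<Rightarrow> real" where
  "normal_dens W u =
     exp (- (u \<bullet> (minv W *\<^sub>v u)) / 2) / sqrt ((2 * pi) ^ dim_vec u * det W)"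

definition truncated_normal_dens ::
    "nat \<Rightarrow> real vec \<Rightarrow> real mat \<Rightarrow> (nat \<Rightarrow> real) set \<Rightarrow> (nat \<Rightarrow> real) \<Rightarrow> real" where
  "truncated_normal_dens h mu W A w =
     indicator A w * normal_dens W (vec h w - mu)
       / (\<integral>w'. indicator A w' * normal_dens W (vec h w' - mu) \<partial>Rn h)"

text \<open>The library's divergence is a Bochner integral, hence 0 if the integral does not exist. The
  negative part of \<open>log (q / p)\<close> is always \<open>q\<close>-integrable, so failure of integrability means that
  the divergence is infinite, as it is without absolute continuity. Note the argument order:
  \<^const>\<open>KL_divergence\<close> takes the reference distribution first.\<close>

definition KL :: "'a measure \<Rightarrow> ('a \<Rightarrow> real) \<Rightarrow> ('a \<Rightarrow> real) \<Rightarrow> ereal" where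
  "KL M q p = (let Q = density M (\<lambda>x. ennreal (q x)); P = density M (\<lambda>x. ennreal (p x)) in
     if absolutely_continuous P Q \<and> integrable Q (entropy_density (exp 1) P Q)
     then ereal (KL_divergence (exp 1) P Q) else \<infinity>)"

text \<open>Here \<open>m\<close> is the dimension of each \<open>z_i\<close>, and \<open>d\<close> that of \<open>beta\<close>.\<close>

definition joint_dens ::
    "nat \<Rightarrow> nat \<Rightarrow> nat \<Rightarrow> real \<Rightarrow> real mat \<Rightarrow> real mat \<Rightarrow> (nat \<Rightarrow> real) \<times> (nat \<Rightarrow> real) \<Rightarrow> real" where
  "joint_dens n m d \<nu> X Lam = (\<lambda>(\<beta>, z).
     normal_dens (\<nu>\<^sup>2 \<cdot>\<^sub>m 1\<^sub>m d) (vec d \<beta>) *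
     (\<Prod>i<n. normal_dens (block m Lam i i) (vec m (zblock m i z) - row_block m X i *\<^sub>v vec d \<beta>)))"

definition response :: "nat \<Rightarrow> (nat \<Rightarrow> real) \<Rightarrow> nat vec" where
  "response m w = vec m (\<lambda>a. of_bool (w a > 0))"

definition posterior_dens ::
    "nat \<Rightarrow> nat \<Rightarrow> nat \<Rightarrow> real \<Rightarrow> real mat \<Rightarrow> real mat \<Rightarrow> (nat \<Rightarrow> nat vec) \<Rightarrow>
     (nat \<Rightarrow> real) \<times> (nat \<Rightarrow> real) \<Rightarrow> real" where
  "posterior_dens n m d \<nu> X Lam ybar = (let
     f = (\<lambda>(\<beta>, z). joint_dens n m d \<nu> X Lam (\<beta>, z) *
            of_bool (\<forall>i<n. response m (zblock m i z) = ybar i))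
     in (\<lambda>\<omega>. f \<omega> / (\<integral>\<omega>'. f \<omega>' \<partial>(Rn d \<Otimes>\<^sub>M Rn (n * m)))))"

definition cond_beta_dens ::
    "nat \<Rightarrow> ((nat \<Rightarrow> real) \<times> (nat \<Rightarrow> real) \<Rightarrow> real) \<Rightarrow> (nat \<Rightarrow> real) \<Rightarrow> (nat \<Rightarrow> real) \<Rightarrow> real" where
  "cond_beta_dens d q \<beta> z = q (\<beta>, z) / (\<integral>\<beta>'. q (\<beta>', z) \<partial>Rn d)"

definition factorizes ::
    "nat \<Rightarrow> nat \<Rightarrow> nat \<Rightarrow> ((nat \<Rightarrow> real) \<times> (nat \<Rightarrow> real) \<Rightarrow> real) \<Rightarrow>
     (nat \<Rightarrow> (nat \<Rightarrow> real) \<Rightarrow> real) \<Rightarrow> bool" where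
  "factorizes n m d q qz \<longleftrightarrow>
     prob_density (Rn d \<Otimes>\<^sub>M Rn (n * m)) q \<and>
     (\<forall>i<n. prob_density (Rn m) (qz i)) \<and>
     (AE (\<beta>, z) in Rn d \<Otimes>\<^sub>M Rn (n * m).
        q (\<beta>, z) = cond_beta_dens d q \<beta> z * (\<Prod>i<n. qz i (zblock m i z)))"

definition approx_class ::
    "nat \<Rightarrow> nat \<Rightarrow> nat \<Rightarrow> ((nat \<Rightarrow> real) \<times> (nat \<Rightarrow> real) \<Rightarrow> real) set" where
  "approx_class n m d = {q. \<exists>qz. factorizes n m d q qz}"

text \<open>The product density of all \<open>z_j\<close> with \<open>j \<noteq> i\<close>, on the space of dimension \<open>(n - 1) * m\<close>.\<close>
definition dens_minus ::
    "nat \<Rightarrow> nat \<Rightarrow> (nat \<Rightarrow> (nat \<Rightarrow> real) \<Rightarrow> real) \<Rightarrow> nat \<Rightarrow> (nat \<Rightarrow> real) \<Rightarrow> real" where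
  "dens_minus n m qz i u = (\<Prod>s<n - 1. qz (insert_index i s) (zblock m s u))"

definition mean_minus :: "nat \<Rightarrow> nat \<Rightarrow> (nat \<Rightarrow> (nat \<Rightarrow> real) \<Rightarrow> real) \<Rightarrow> nat \<Rightarrow> real vec" where
  "mean_minus n m qz i =
     vec ((n - 1) * m) (\<lambda>r. \<integral>u. u r * dens_minus n m qz i u \<partial>Rn ((n - 1) * m))"

end

theory Submission
  imports Defs
begin

text \<open>Completing the square writes the posterior as \<open>k(\<beta>, z) \<pi>(z)\<close>, with \<open>k\<close> the normal density of \<open>\<beta>\<close> given
  \<open>z\<close> and \<open>\<pi>\<close> the restriction of \<open>exp (- z\<^sup>T G z / 2)\<close> to the positive orthant, \<open>G = \<Lambda>\<^sup>-\<^sup>1 - H\<close>. Let \<open>q\<close> be a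
  minimizer with block densities \<open>q\<^sub>j\<close>, and let \<open>r = k \<tau>\<^sub>i \<Prod>\<^sub>j\<^sub>\<noteq>\<^sub>i q\<^sub>j\<close> with \<open>\<tau>\<^sub>i\<close> the claimed truncated normal.
  The function \<open>log (r / p)\<close> depends on \<open>z\<close> alone, and \<open>\<tau>\<^sub>i\<close> is such that its expectation does not change
  when \<open>q\<^sub>i\<close> is replaced by \<open>\<tau>\<^sub>i\<close>, so it has the same expectation under \<open>q\<close> and \<open>r\<close>. Hence
  \<open>KL(q, p) = KL(q, r) + KL(r, p)\<close>, and minimality gives \<open>KL(q, r) = 0\<close>, that is \<open>q = r\<close>, which contains both
  claims. All integrals converge: a minimizer has finite divergence, since the candidate with uniform blocks
  on the unit cube has, and \<open>a b \<le> a ln a - a + e\<^sup>b\<close> with \<open>a = q / p\<close> turns this into second moments and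
  entropies of the \<open>q\<^sub>j\<close>.\<close>


subsection \<open>Quadratic forms and Gaussian integrals\<close>

text \<open>The parameters of \<open>\<tau>\<^sub>i\<close> contain the means of the other blocks of
  the same minimizer, so the claim is a fixed-point property of a given optimum: one update is
  compared with q, and no stationarity equation has to be differentiated. The mean of
  \<open>\<tau>\<^sub>i\<close> solves G_ii \<mu> = - sum over j of G_ij E[z_j], and its precision
  is G_ii. The precision cancels the square term of z_i in log (r / p), and the mean leaves a linear
  term in z_i whose coefficients are centred under the other blocks. The obstacle is that nothing
  about q is known in advance. The means might fail to exist, in which case a Bochner integral
  silently becomes 0, and a difference of divergences might be undefined. Second moments give every
  product of coordinates an expectation; entropies are needed because log (r / p) contains the
  logarithms of the blocks that are kept. The divergence of q from r enters through the pointwise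
  nonnegative integrand q ln (q / r) - q + r, whose vanishing forces q = r almost
  everywhere.\<close>

definition quad :: "nat \<Rightarrow> real mat \<Rightarrow> (nat \<Rightarrow> real) \<Rightarrow> real" where
  "quad k A u = (\<Sum>r<k. \<Sum>c<k. A $$ (r, c) * u r * u c)"

lemma scalar_prod_mult_mat_vec:
  fixes A :: "real mat"
  assumes "A \<in> carrier_mat k l" "u \<in> carrier_vec k" "v \<in> carrier_vec l"
  shows "u \<bullet> (A *\<^sub>v v) = (\<Sum>r<k. \<Sum>c<l. A $$ (r, c) * u $ r * v $ c)"
  using assms by (auto simp: scalar_prod_def atLeast0LessThan sum_distrib_left intro!: sum.cong)

lemma quad_eq_scalar_prod:
  assumes "A \<in> carrier_mat k k" "v \<in> carrier_vec k"
  shows "v \<bullet> (A *\<^sub>v v) = quad k A (\<lambda>r. v $ r)"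
  unfolding quad_def by (rule scalar_prod_mult_mat_vec[OF assms(1,2,2)])

lemma positive_definite_nonneg:
  assumes "positive_definite k A" "v \<in> carrier_vec k"
  shows "0 \<le> v \<bullet> (A *\<^sub>v v)"
  using assms unfolding positive_definite_def by (cases "v = 0\<^sub>v k") (auto simp: less_imp_le)

lemma quad_cong: "(\<And>r. r < k \<Longrightarrow> u r = v r) \<Longrightarrow> quad k A u = quad k A v"
  unfolding quad_def by (intro sum.cong) auto

text \<open>Points of \<open>Rn k\<close> are functions, so the vector condition is restated through
  \<open>quad\<close>, which reads only the coordinates below k. In this form a vector can be
  altered in a single coordinate or extended from one block.\<close>

lemma positive_definite_iff_quad:
  "positive_definite k A \<longleftrightarrow> A \<in> carrier_mat k k \<and> (\<forall>r<k. \<forall>c<k. A $$ (r, c) = A $$ (c, r)) \<and>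
     (\<forall>u. (\<exists>r<k. u r \<noteq> 0) \<longrightarrow> 0 < quad k A u)"
proof -
  have sym: "A\<^sup>T = A \<longleftrightarrow> (\<forall>r<k. \<forall>c<k. A $$ (r, c) = A $$ (c, r))" if "A \<in> carrier_mat k k"
  proof
    assume "A\<^sup>T = A"
    then show "\<forall>r<k. \<forall>c<k. A $$ (r, c) = A $$ (c, r)"
      using that by (metis carrier_matD(1) carrier_matD(2) index_transpose_mat(1))
  next
    assume "\<forall>r<k. \<forall>c<k. A $$ (r, c) = A $$ (c, r)"
    then show "A\<^sup>T = A" using that by (intro eq_matI) auto
  qed
  have "(\<forall>v \<in> carrier_vec k. v \<noteq> 0\<^sub>v k \<longrightarrow> v \<bullet> (A *\<^sub>v v) > 0) \<longleftrightarrow>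
     (\<forall>u. (\<exists>r<k. u r \<noteq> 0) \<longrightarrow> 0 < quad k A u)" if A: "A \<in> carrier_mat k k"
  proof safe
    fix u :: "nat \<Rightarrow> real" and r
    assume *: "\<forall>v \<in> carrier_vec k. v \<noteq> 0\<^sub>v k \<longrightarrow> v \<bullet> (A *\<^sub>v v) > 0" and r: "r < k" "u r \<noteq> 0"
    have "vec k u \<noteq> 0\<^sub>v k" using r by (metis index_vec index_zero_vec(1))
    then have "0 < vec k u \<bullet> (A *\<^sub>v vec k u)" using * by simp
    also have "\<dots> = quad k A u"
      by (subst quad_eq_scalar_prod[OF A]) (auto intro: quad_cong)
    finally show "0 < quad k A u" .
  next
    fix v :: "real vec"
    assume *: "\<forall>u. (\<exists>r<k. u r \<noteq> 0) \<longrightarrow> 0 < quad k A u" and v: "v \<in> carrier_vec k" "v \<noteq> 0\<^sub>v k"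
    then have "\<exists>r<k. v $ r \<noteq> 0" by (metis carrier_vecD eq_vecI index_zero_vec)
    then show "0 < v \<bullet> (A *\<^sub>v v)" using * by (simp add: quad_eq_scalar_prod[OF A v(1)])
  qed
  with sym show ?thesis unfolding positive_definite_def by blast
qed

section \<open>Inverses of positive definite matrices\<close>

lemma positive_definite_inverse_exists:
  assumes "positive_definite k A"
  obtains B where "B \<in> carrier_mat k k" "A * B = 1\<^sub>m k" "B * A = 1\<^sub>m k"
proof -
  have A: "A \<in> carrier_mat k k" using assms by (simp add: positive_definite_def)
  have "det A \<noteq> 0"
  proof
    assume "det A = 0"
    then obtain v where v: "v \<in> carrier_vec k" "v \<noteq> 0\<^sub>v k" "A *\<^sub>v v = 0\<^sub>v k"
      using det_0_iff_vec_prod_zero_field[OF A] by auto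
    then have "v \<bullet> (A *\<^sub>v v) > 0" using assms unfolding positive_definite_def by blast
    with v show False by simp
  qed
  from det_non_zero_imp_unit[OF A this, of "()"] show ?thesis
    using that by (auto simp: Units_def ring_mat_def)
qed

text \<open>For square matrices a right inverse is two-sided and inverses are unique, so whatever
  Gauss-Jordan elimination returns must be \<open>B\<close>. The unspecified case of
  \<open>minv\<close> is excluded because A is a unit of the matrix ring.\<close>

lemma minv_eqI:
  assumes A: "A \<in> carrier_mat k k" and B: "B \<in> carrier_mat k k" and AB: "A * B = 1\<^sub>m k"
  shows "minv A = B"
proof -
  have BA: "B * A = 1\<^sub>m k" by (rule mat_mult_left_right_inverse[OF A B AB])
  have "A \<in> Units (ring_mat TYPE(real) k ())"
    using A B AB BA by (auto simp: Units_def ring_mat_def)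
  then obtain C where C: "mat_inverse A = Some C"
    using mat_inverse(1)[OF A, of "()"] by (cases "mat_inverse A") auto
  from mat_inverse(2)[OF A C] have "A * C = 1\<^sub>m k" "C \<in> carrier_mat k k" by auto
  then have "C = B" using A B BA
    by (metis assoc_mult_mat left_mult_one_mat right_mult_one_mat)
  then show ?thesis by (simp add: minv_def C)
qed

lemma minv_positive_definite:
  assumes "positive_definite k A"
  shows "minv A \<in> carrier_mat k k" "A * minv A = 1\<^sub>m k" "minv A * A = 1\<^sub>m k" "minv (minv A) = A"
    "det A * det (minv A) = 1"
proof -
  have A: "A \<in> carrier_mat k k" using assms by (simp add: positive_definite_def)
  obtain B where B: "B \<in> carrier_mat k k" "A * B = 1\<^sub>m k" "B * A = 1\<^sub>m k"
    using positive_definite_inverse_exists[OF assms] .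
  have eq: "minv A = B" by (rule minv_eqI[OF A B(1,2)])
  show "minv A \<in> carrier_mat k k" "A * minv A = 1\<^sub>m k" "minv A * A = 1\<^sub>m k" using B eq by auto
  show "minv (minv A) = A" unfolding eq by (rule minv_eqI[OF B(1) A B(3)])
  show "det A * det (minv A) = 1"
    unfolding eq by (metis A B(1,2) det_mult det_one)
qed

text \<open>Substituting v = A w turns the form of the inverse at v into the form of A at w.
  Symmetry holds because the transpose of the inverse is again a right inverse of the symmetric
  \<open>A\<close>.\<close>

lemma positive_definite_minv:
  assumes "positive_definite k A"
  shows "positive_definite k (minv A)"
proof -
  have A: "A \<in> carrier_mat k k" and sym: "A\<^sup>T = A"
    and pos: "\<And>v. v \<in> carrier_vec k \<Longrightarrow> v \<noteq> 0\<^sub>v k \<Longrightarrow> v \<bullet> (A *\<^sub>v v) > 0"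
    using assms by (auto simp: positive_definite_def)
  note B = minv_positive_definite[OF assms]
  have "A * (minv A)\<^sup>T = (minv A * A)\<^sup>T" using A B(1) sym by (simp add: transpose_mult)
  then have "minv A = (minv A)\<^sup>T" using B by (intro minv_eqI[OF A]) auto
  moreover have "v \<bullet> (minv A *\<^sub>v v) > 0" if v: "v \<in> carrier_vec k" "v \<noteq> 0\<^sub>v k" for v
  proof -
    define w where "w = minv A *\<^sub>v v"
    have w: "w \<in> carrier_vec k" and Aw: "A *\<^sub>v w = v"
      using B v A by (auto simp: w_def simp flip: assoc_mult_mat_vec)
    have "w \<noteq> 0\<^sub>v k" using Aw v A by auto
    then have "w \<bullet> (A *\<^sub>v w) > 0" using pos w by simp
    then show ?thesis using Aw w v by (simp add: w_def comm_scalar_prod)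
  qed
  ultimately show ?thesis using B(1) by (simp add: positive_definite_def)
qed

text \<open>The Cauchy--Schwarz inequality of the inner product \<open>A\<close>, applied to \<open>u\<close> and \<open>A\<^sup>-\<^sup>1 e\<^sub>r\<close>, gives
  \<open>u\<^sub>r\<^sup>2 \<le> (u\<^sup>T A u) (A\<^sup>-\<^sup>1)\<^sub>r\<^sub>r\<close>.\<close>
lemma positive_definite_lower_bound:
  assumes "positive_definite k A"
  obtains \<epsilon> where "\<epsilon> > 0" "\<And>u. \<epsilon> * (\<Sum>r<k. (u r)\<^sup>2) \<le> quad k A u"
proof -
  have A: "A \<in> carrier_mat k k" and sym: "A\<^sup>T = A"
    using assms by (auto simp: positive_definite_def)
  note nonneg = positive_definite_nonneg[OF assms]
  define B where "B = minv A"
  have B: "B \<in> carrier_mat k k" and AB: "A * B = 1\<^sub>m k"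
    using minv_positive_definite[OF assms] by (auto simp: B_def)
  have pB: "positive_definite k B" unfolding B_def by (rule positive_definite_minv[OF assms])
  have diag: "unit_vec k r \<bullet> (B *\<^sub>v unit_vec k r) = B $$ (r, r)" if "r < k" for r
    using that B by simp
  have dpos: "B $$ (r, r) > 0" if "r < k" for r
  proof -
    have "unit_vec k r \<bullet> (B *\<^sub>v unit_vec k r) > 0"
      using pB that unfolding positive_definite_def by (metis unit_vec_carrier unit_vec_nonzero)
    then show ?thesis using diag[OF that] by simp
  qed
  have key: "(u r)\<^sup>2 \<le> quad k A u * B $$ (r, r)" if r: "r < k" for u r
  proof -
    define v where "v = vec k u"
    have v: "v \<in> carrier_vec k" by (simp add: v_def)
    define w where "w = B *\<^sub>v unit_vec k r"
    have w: "w \<in> carrier_vec k" using B by (simp add: w_def)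
    have Aw: "A *\<^sub>v w = unit_vec k r"
      using A B AB by (simp add: w_def flip: assoc_mult_mat_vec)
    \<comment> \<open>The minimizer over t of the form of A at v - t w; the minimum is the form at u
      minus (u r)^2 / B_rr.\<close>
    define t where "t = u r / B $$ (r, r)"
    have vA: "w \<bullet> (A *\<^sub>v v) = u r"
    proof -
      have "w \<bullet> (A *\<^sub>v v) = (A\<^sup>T *\<^sub>v w) \<bullet> v"
        using A v w by (metis carrier_matD comm_scalar_prod mult_mat_vec_carrier
            transpose_carrier_mat transpose_vec_mult_scalar)
      then show ?thesis using r by (simp add: sym Aw v_def)
    qed
    have "0 \<le> (v - t \<cdot>\<^sub>v w) \<bullet> (A *\<^sub>v (v - t \<cdot>\<^sub>v w))"
      using v w by (intro nonneg) auto
    also have "A *\<^sub>v (v - t \<cdot>\<^sub>v w) = A *\<^sub>v v - t \<cdot>\<^sub>v unit_vec k r"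
      using A v w by (simp add: mult_minus_distrib_mat_vec mult_mat_vec Aw)
    also have "(v - t \<cdot>\<^sub>v w) \<bullet> (A *\<^sub>v v - t \<cdot>\<^sub>v unit_vec k r) =
       v \<bullet> (A *\<^sub>v v) - t * (w \<bullet> (A *\<^sub>v v)) - t * v $ r + t * t * w $ r"
      using A v w r
      by (simp add: minus_scalar_prod_distrib[where n = k] scalar_prod_minus_distrib[where n = k] algebra_simps)
    also have "v \<bullet> (A *\<^sub>v v) = quad k A u"
      by (subst quad_eq_scalar_prod[OF A v]) (auto simp: v_def intro: quad_cong)
    also have "w $ r = B $$ (r, r)" using diag[OF r] w r by (simp add: w_def)
    also have "v $ r = u r" using r by (simp add: v_def)
    also have "w \<bullet> (A *\<^sub>v v) = u r" by (rule vA)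
    finally show ?thesis using dpos[OF r] by (simp add: t_def field_simps power2_eq_square)
  qed
  \<comment> \<open>One plus the trace of the inverse: summing \<open>key\<close> over r produces
    the trace, and the 1 keeps T positive in dimension 0.\<close>
  define T where "T = 1 + (\<Sum>r<k. B $$ (r, r))"
  have "0 \<le> (\<Sum>r<k. B $$ (r, r))" by (intro sum_nonneg less_imp_le dpos) simp
  then have T: "T > 0" by (simp add: T_def)
  have "1 / T * (\<Sum>r<k. (u r)\<^sup>2) \<le> quad k A u" for u
  proof -
    have q: "quad k A u \<ge> 0"
      using nonneg[of "vec k u"] quad_eq_scalar_prod[OF A, of "vec k u"] quad_cong[of k "\<lambda>r. vec k u $ r" u A] by simp
    have "(\<Sum>r<k. (u r)\<^sup>2) \<le> (\<Sum>r<k. quad k A u * B $$ (r, r))"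
      by (intro sum_mono key) auto
    also have "\<dots> \<le> quad k A u * T" using q by (simp add: T_def sum_distrib_left[symmetric] algebra_simps)
    finally show ?thesis using T by (simp add: field_simps)
  qed
  with T that[of "1 / T"] show ?thesis by simp
qed

section \<open>Gaussian integrals in several dimensions\<close>

lemma nn_integral_gaussian_1d:
  assumes "a > 0"
  shows "(\<integral>\<^sup>+ t. ennreal (exp (- (a * (t - c)\<^sup>2) / 2)) \<partial>lborel) = ennreal (sqrt (2 * pi / a))"
proof -
  have s: "0 < 1 / sqrt a" using assms by simp
  have eq: "exp (- (a * (t - c)\<^sup>2) / 2) = sqrt (2 * pi / a) * normal_density c (1 / sqrt a) t" for t
    using assms by (simp add: normal_density_def power_divide real_sqrt_mult real_sqrt_divide field_simps)
  have "(\<integral>\<^sup>+ t. ennreal (normal_density c (1 / sqrt a) t) \<partial>lborel) = 1"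
    using integrable_normal_density[OF s, of c] integral_normal_density[OF s, of c]
    by (subst nn_integral_eq_integral) auto
  then have "(\<integral>\<^sup>+ t. ennreal (sqrt (2 * pi / a)) * ennreal (normal_density c (1 / sqrt a) t) \<partial>lborel) =
      ennreal (sqrt (2 * pi / a))"
    by (subst nn_integral_cmult) simp_all
  then show ?thesis
    using assms unfolding eq by (simp add: ennreal_mult)
qed

lemma quad_measurable[measurable]: "quad k A \<in> borel_measurable (Rn k)"
  unfolding quad_def by measurable

lemma quad_shift_measurable[measurable]:
  "(\<lambda>u. quad k A (\<lambda>r. u r - \<mu> r)) \<in> borel_measurable (Rn k)"
  unfolding quad_def by measurable

interpretation lborel_product: product_sigma_finite "\<lambda>_. lborel :: real measure"
  by standard

text \<open>What remains of the first k rows and columns after eliminating the pivot (k, k), which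
  is the last diagonal entry of a matrix of size \<open>Suc k\<close> since indices start at
  0.\<close>

definition schur_last :: "nat \<Rightarrow> real mat \<Rightarrow> real mat" where
  "schur_last k A = mat k k (\<lambda>(r, c). A $$ (r, c) - A $$ (r, k) * A $$ (k, c) / A $$ (k, k))"

text \<open>Completes the square in the last coordinate. The centre of the square depends on the
  other coordinates only, so it can be made to vanish by a choice of the last coordinate or be
  shifted away under an integral.\<close>

lemma quad_Suc_schur:
  assumes "\<And>r. r < k \<Longrightarrow> A $$ (r, k) = A $$ (k, r)" and a: "A $$ (k, k) \<noteq> 0"
  shows "quad (Suc k) A u =
    A $$ (k, k) * (u k + (\<Sum>r<k. A $$ (k, r) * u r) / A $$ (k, k))\<^sup>2 + quad k (schur_last k A) u"
proof -
  let ?a = "A $$ (k, k)"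
  define s where "s = (\<Sum>r<k. A $$ (k, r) * u r)"
  have s2: "(\<Sum>r<k. A $$ (r, k) * u r) = s" unfolding s_def using assms by (intro sum.cong) auto
  have "quad k (schur_last k A) u =
     (\<Sum>r<k. \<Sum>c<k. A $$ (r, c) * u r * u c - (A $$ (r, k) * u r) * (A $$ (k, c) * u c) / ?a)"
    unfolding quad_def schur_last_def by (intro sum.cong) (auto simp: algebra_simps)
  also have "\<dots> = quad k A u - s * s / ?a"
  proof -
    have "(\<Sum>r<k. \<Sum>c<k. (A $$ (r, k) * u r) * (A $$ (k, c) * u c)) = (\<Sum>r<k. A $$ (r, k) * u r) * s"
      by (simp add: s_def sum_product)
    then show ?thesis
      by (simp add: sum_subtractf quad_def s2 flip: sum_divide_distrib)
  qed
  finally have 1: "quad k (schur_last k A) u = quad k A u - s * s / ?a" .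
  have "quad (Suc k) A u = quad k A u + (\<Sum>r<k. A $$ (r, k) * u r) * u k + s * u k + ?a * u k * u k"
    by (simp add: quad_def sum.distrib sum_distrib_right sum_distrib_left s_def algebra_simps)
  also have "\<dots> = quad k A u + 2 * s * u k + ?a * u k * u k" by (simp add: s2)
  finally show ?thesis
    using a unfolding 1 s_def[symmetric] by (simp add: field_simps power2_eq_square)
qed

text \<open>Block elimination: A is the product of a unit upper triangular block matrix, whose
  corner is the last column divided by the pivot, and a lower triangular one whose diagonal blocks
  are the Schur complement and the pivot.\<close>

lemma det_schur_last:
  assumes A: "A \<in> carrier_mat (Suc k) (Suc k)" and a: "A $$ (k, k) \<noteq> (0 :: real)"
  shows "det A = A $$ (k, k) * det (schur_last k A)"
proof -
  define a where "a = A $$ (k, k)"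
  define b where "b = mat k 1 (\<lambda>(r, c). A $$ (r, k) / a)"
  define c where "c = mat 1 k (\<lambda>(r, c). A $$ (k, c))"
  define D where "D = mat 1 1 (\<lambda>_. a)"
  let ?S = "schur_last k A"
  have S: "?S \<in> carrier_mat k k" by (simp add: schur_last_def)
  have bcD: "b \<in> carrier_mat k 1" "c \<in> carrier_mat 1 k" "D \<in> carrier_mat 1 1"
    by (auto simp: b_def c_def D_def)
  have "A = four_block_mat (?S + b * c) (b * D) c D"
    using A a bcD S
    by (intro eq_matI)
       (auto simp: b_def c_def D_def schur_last_def scalar_prod_def a_def less_Suc_eq not_less)
  also have "\<dots> = four_block_mat (1\<^sub>m k) b (0\<^sub>m 1 k) (1\<^sub>m 1) * four_block_mat ?S (0\<^sub>m k 1) c D"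
    using bcD S by (subst mult_four_block_mat[where ?nr1.0 = k and ?n1.0 = k and ?n2.0 = 1 and ?nr2.0 = 1 and ?nc1.0 = k and ?nc2.0 = 1]) auto
  also have "det \<dots> = det (four_block_mat (1\<^sub>m k) b (0\<^sub>m 1 k) (1\<^sub>m 1)) * det (four_block_mat ?S (0\<^sub>m k 1) c D)"
    using bcD S by (intro det_mult[of _ "k + 1"]) auto
  also have "det (four_block_mat (1\<^sub>m k) b (0\<^sub>m 1 k) (1\<^sub>m 1)) = 1"
    using bcD by (subst det_four_block_mat_lower_left_zero[of _ k _ 1]) auto
  also have "det (four_block_mat ?S (0\<^sub>m k 1) c D) = det ?S * det D"
    using bcD S by (subst det_four_block_mat_upper_right_zero[of _ k _ 1]) auto
  also have "det D = a" by (subst det_single[OF bcD(3)]) (simp add: D_def)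
  finally show ?thesis by (simp add: a_def)
qed

text \<open>Integrating out the last coordinate replaces the precision matrix by its Schur complement.\<close>
lemma gaussian_integral_aux:
  assumes "positive_definite k A"
  shows "det A > 0 \<and> (\<forall>\<mu>. (\<integral>\<^sup>+ u. ennreal (exp (- quad k A (\<lambda>r. u r - \<mu> r) / 2)) \<partial>Rn k) =
           ennreal (sqrt ((2 * pi) ^ k / det A)))"
  using assms
proof (induction k arbitrary: A)
  case 0
  then have "A \<in> carrier_mat 0 0" by (simp add: positive_definite_def)
  then show ?case
    by (simp add: quad_def PiM_empty)
next
  case (Suc k)
  let ?a = "A $$ (k, k)" and ?S = "schur_last k A"
  have A: "A \<in> carrier_mat (Suc k) (Suc k)" and sym: "\<forall>r<Suc k. \<forall>c<Suc k. A $$ (r, c) = A $$ (c, r)"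
    and pos: "\<And>u r. r < Suc k \<Longrightarrow> u r \<noteq> 0 \<Longrightarrow> 0 < quad (Suc k) A u"
    using Suc.prems unfolding positive_definite_iff_quad by blast+
  have a: "?a > 0"
    using pos[of k "\<lambda>r. of_bool (r = k)"] by (simp add: quad_def of_bool_def if_distrib cong: if_cong)
  have schur: "quad (Suc k) A u =
      ?a * (u k + (\<Sum>r<k. A $$ (k, r) * u r) / ?a)\<^sup>2 + quad k ?S u" for u
    using sym a by (intro quad_Suc_schur) auto
  have "positive_definite k ?S"
    unfolding positive_definite_iff_quad
  proof (intro conjI allI impI)
    show "?S \<in> carrier_mat k k" by (simp add: schur_last_def)
    show "?S $$ (r, c) = ?S $$ (c, r)" if "r < k" "c < k" for r c
      using that sym by (simp add: schur_last_def)
    fix u :: "nat \<Rightarrow> real" assume "\<exists>r<k. u r \<noteq> 0"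
    then obtain r where r: "r < k" "u r \<noteq> 0" by blast
    \<comment> \<open>The last coordinate is chosen so that the completed square vanishes, leaving
      only the form of the complement.\<close>
    define u' where "u' = u(k := - (\<Sum>r<k. A $$ (k, r) * u r) / ?a)"
    have "0 < quad (Suc k) A u'" using r by (intro pos[of r]) (auto simp: u'_def)
    also have "\<dots> = quad k ?S u'"
      unfolding schur by (simp add: u'_def)
    also have "\<dots> = quad k ?S u" by (intro quad_cong) (auto simp: u'_def)
    finally show "0 < quad k ?S u" .
  qed
  note IH = Suc.IH[OF this]
  have det: "det A = ?a * det ?S" using a by (intro det_schur_last[OF A]) auto
  have "(\<integral>\<^sup>+ u. ennreal (exp (- quad (Suc k) A (\<lambda>r. u r - \<mu> r) / 2)) \<partial>Rn (Suc k)) =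
           ennreal (sqrt ((2 * pi) ^ Suc k / det A))" for \<mu>
  proof -
    have "(\<integral>\<^sup>+ u. ennreal (exp (- quad (Suc k) A (\<lambda>r. u r - \<mu> r) / 2)) \<partial>Rn (Suc k)) =
      (\<integral>\<^sup>+ u. \<integral>\<^sup>+ t. ennreal (exp (- quad (Suc k) A (\<lambda>r. (u(k := t)) r - \<mu> r) / 2)) \<partial>lborel \<partial>Rn k)"
      unfolding lessThan_Suc
      by (subst lborel_product.product_nn_integral_insert) (auto simp flip: lessThan_Suc)
    also have "\<dots> = (\<integral>\<^sup>+ u. ennreal (exp (- quad k ?S (\<lambda>r. u r - \<mu> r) / 2)) * ennreal (sqrt (2 * pi / ?a)) \<partial>Rn k)"
    proof (rule nn_integral_cong)
      fix u :: "nat \<Rightarrow> real"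
      \<comment> \<open>Given the first k coordinates, the last one is Gaussian with its mean
        shifted by s, so its integral is the same constant for every u.\<close>
      define s where "s = (\<Sum>r<k. A $$ (k, r) * (u r - \<mu> r)) / ?a"
      have "quad (Suc k) A (\<lambda>r. (u(k := t)) r - \<mu> r) = ?a * (t - (\<mu> k - s))\<^sup>2 + quad k ?S (\<lambda>r. u r - \<mu> r)" for t
        unfolding schur
        by (intro arg_cong2[where f = plus] quad_cong) (auto simp: s_def algebra_simps)
      then have "ennreal (exp (- quad (Suc k) A (\<lambda>r. (u(k := t)) r - \<mu> r) / 2)) =
         ennreal (exp (- quad k ?S (\<lambda>r. u r - \<mu> r) / 2)) * ennreal (exp (- (?a * (t - (\<mu> k - s))\<^sup>2) / 2))" for t
        by (simp add: ennreal_mult[symmetric] exp_add[symmetric] diff_divide_distrib)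
      then show "(\<integral>\<^sup>+ t. ennreal (exp (- quad (Suc k) A (\<lambda>r. (u(k := t)) r - \<mu> r) / 2)) \<partial>lborel) =
         ennreal (exp (- quad k ?S (\<lambda>r. u r - \<mu> r) / 2)) * ennreal (sqrt (2 * pi / ?a))"
        using nn_integral_gaussian_1d[OF a, of "\<mu> k - s"] by (simp only: nn_integral_cmult) (simp add: nn_integral_cmult)
    qed
    also have "\<dots> = ennreal (sqrt ((2 * pi) ^ k / det ?S)) * ennreal (sqrt (2 * pi / ?a))"
      using IH by (simp add: nn_integral_multc)
    also have "\<dots> = ennreal (sqrt ((2 * pi) ^ Suc k / det A))"
      using IH a by (simp add: ennreal_mult[symmetric] real_sqrt_mult[symmetric] det field_simps)
    finally show ?thesis .
  qed
  then show ?case using IH det a by simp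
qed

lemmas det_positive_definite_pos = gaussian_integral_aux[THEN conjunct1]
lemmas nn_integral_gaussian = gaussian_integral_aux[THEN conjunct2, rule_format]

lemma normal_dens_vec:
  assumes "minv W \<in> carrier_mat k k"
  shows "normal_dens W (vec k u) = exp (- quad k (minv W) u / 2) / sqrt ((2 * pi) ^ k * det W)"
proof -
  have "vec k u \<bullet> (minv W *\<^sub>v vec k u) = quad k (minv W) u"
    by (subst quad_eq_scalar_prod[OF assms]) (auto intro: quad_cong)
  then show ?thesis by (simp add: normal_dens_def)
qed

lemma normal_dens_eq_quad:
  assumes "minv W \<in> carrier_mat k k"
  shows "normal_dens W (vec k u - vec k \<mu>) =
    exp (- quad k (minv W) (\<lambda>r. u r - \<mu> r) / 2) / sqrt ((2 * pi) ^ k * det W)"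
proof -
  have "vec k u - vec k \<mu> = vec k (\<lambda>r. u r - \<mu> r)" by (intro eq_vecI) auto
  then show ?thesis by (simp only: normal_dens_vec[OF assms])
qed

lemma nn_integral_normal_dens:
  assumes "positive_definite k W" "\<mu> \<in> carrier_vec k"
  shows "(\<integral>\<^sup>+ u. ennreal (normal_dens W (vec k u - \<mu>)) \<partial>Rn k) = 1"
proof -
  note W = minv_positive_definite[OF assms(1)]
  have \<mu>: "\<mu> = vec k (\<lambda>r. \<mu> $ r)" using assms(2) by auto
  have d: "det W > 0" "det (minv W) > 0"
    using det_positive_definite_pos assms(1) positive_definite_minv by blast+
  have dW: "det (minv W) = 1 / det W" using W(5) d by (simp add: field_simps)
  have "(\<integral>\<^sup>+ u. ennreal (normal_dens W (vec k u - \<mu>)) \<partial>Rn k) =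
    (\<integral>\<^sup>+ u. ennreal (1 / sqrt ((2 * pi) ^ k * det W)) * ennreal (exp (- quad k (minv W) (\<lambda>r. u r - \<mu> $ r) / 2)) \<partial>Rn k)"
    using d by (subst \<mu>, subst normal_dens_eq_quad[OF W(1)]) (simp add: ennreal_mult[symmetric])
  also have "\<dots> = ennreal (1 / sqrt ((2 * pi) ^ k * det W)) * ennreal (sqrt ((2 * pi) ^ k * det W))"
    using nn_integral_gaussian[OF positive_definite_minv[OF assms(1)], of "\<lambda>r. \<mu> $ r"]
    by (subst nn_integral_cmult) (simp_all add: dW)
  also have "\<dots> = 1" using d by (simp add: ennreal_mult[symmetric] flip: real_sqrt_mult)
  finally show ?thesis .
qed

subsection \<open>Blocks of coordinates\<close>

lemma sigma_finite_Rn: "sigma_finite_measure (Rn k)"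
  by (rule lborel_product.sigma_finite) simp

interpretation Rn_product: product_sigma_finite "\<lambda>_. Rn m" for m
  by (simp add: product_sigma_finite_def sigma_finite_Rn)

text \<open>Together with \<open>blocks\<close>, an isomorphism between the flat space
  \<open>Rn (n * m)\<close> and a product of n copies of \<open>Rn m\<close>. On the product side
  independence becomes a product measure, and one block can be integrated out by Fubini's
  theorem.\<close>

definition flatten :: "nat \<Rightarrow> nat \<Rightarrow> (nat \<Rightarrow> nat \<Rightarrow> real) \<Rightarrow> nat \<Rightarrow> real" where
  "flatten n m w = (\<lambda>k\<in>{..<n * m}. w (k div m) (k mod m))"

abbreviation Rblocks :: "nat \<Rightarrow> nat \<Rightarrow> (nat \<Rightarrow> nat \<Rightarrow> real) measure" where
  "Rblocks n m \<equiv> Pi\<^sub>M {..<n} (\<lambda>_. Rn m)"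

definition blocks :: "nat \<Rightarrow> nat \<Rightarrow> (nat \<Rightarrow> real) \<Rightarrow> nat \<Rightarrow> nat \<Rightarrow> real" where
  "blocks n m z = (\<lambda>i\<in>{..<n}. zblock m i z)"

lemma block_index_less: "i < n \<Longrightarrow> a < m \<Longrightarrow> i * m + a < n * (m::nat)"
  by (metis add.commute add_less_cancel_right less_le_trans mult.commute mult_Suc_right mult_le_mono2 not_less_eq_eq nat_less_le leD leI)

lemma block_index_div_mod: "k < n * m \<Longrightarrow> k div m < n \<and> k mod m < (m::nat)"
  by (metis less_mult_imp_div_less mod_less_divisor mult_0_right not_gr_zero not_less_zero)

lemma measurable_zblock[measurable]:
  assumes "i < n" shows "zblock m i \<in> Rn (n * m) \<rightarrow>\<^sub>M Rn m"
  unfolding zblock_def by (intro measurable_restrict measurable_component_singleton) (auto simp: block_index_less assms)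

lemma measurable_blocks[measurable]: "blocks n m \<in> Rn (n * m) \<rightarrow>\<^sub>M Rblocks n m"
  unfolding blocks_def by (intro measurable_restrict measurable_zblock) auto

lemma measurable_flatten[measurable]: "flatten n m \<in> Rblocks n m \<rightarrow>\<^sub>M Rn (n * m)"
  unfolding flatten_def
proof (rule measurable_restrict)
  fix k assume "k \<in> {..<n * m}"
  then have "k div m < n" "k mod m < m" using block_index_div_mod by auto
  then show "(\<lambda>w. w (k div m) (k mod m)) \<in> Rblocks n m \<rightarrow>\<^sub>M lborel"
    by (intro measurable_compose[OF measurable_component_singleton[of "k div m"] measurable_component_singleton[of "k mod m"]]) auto
qed

lemma blocks_flatten:
  assumes "w \<in> space (Rblocks n m)"
  shows "blocks n m (flatten n m w) = w"
proof (rule extensionalityI[of _ "{..<n}"])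
  show "w \<in> extensional {..<n}" using assms by (auto simp: space_PiM PiE_def)
  show "blocks n m (flatten n m w) i = w i" if "i \<in> {..<n}" for i
  proof (rule extensionalityI[of _ "{..<m}"])
    show "w i \<in> extensional {..<m}" using assms that by (auto simp: space_PiM PiE_def Pi_def)
    show "blocks n m (flatten n m w) i \<in> extensional {..<m}" using that by (simp add: blocks_def zblock_def)
    show "blocks n m (flatten n m w) i a = w i a" if "a \<in> {..<m}" for a
      using that \<open>i \<in> {..<n}\<close> by (simp add: blocks_def zblock_def flatten_def block_index_less)
  qed
qed (simp add: blocks_def)

lemma flatten_blocks:
  assumes "z \<in> space (Rn (n * m))"
  shows "flatten n m (blocks n m z) = z"
proof (rule extensionalityI[of _ "{..<n * m}"])
  show "z \<in> extensional {..<n * m}" using assms by (auto simp: space_PiM PiE_def)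
  show "flatten n m (blocks n m z) k = z k" if "k \<in> {..<n * m}" for k
    using that block_index_div_mod[of k n m] by (simp add: blocks_def zblock_def flatten_def)
qed (simp add: flatten_def)

text \<open>A product measure is determined by boxes. A box pulls back to a product of boxes, one
  per block, and both measures are the same product over the sides, grouped by block.\<close>

lemma distr_flatten: "distr (Rblocks n m) (Rn (n * m)) (flatten n m) = Rn (n * m)"
proof (rule lborel_product.PiM_eqI)
  fix A :: "nat \<Rightarrow> real set"
  assume A: "\<And>k. k \<in> {..<n * m} \<Longrightarrow> A k \<in> sets lborel"
  have set: "Pi\<^sub>E {..<n * m} A \<in> sets (Rn (n * m))" using A by (intro sets_PiM_I_finite) auto
  have blk: "Pi\<^sub>E {..<m} (\<lambda>a. A (i * m + a)) \<in> sets (Rn m)" if "i < n" for i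
    using A that by (intro sets_PiM_I_finite) (auto simp: block_index_less)
  have eq: "flatten n m -` Pi\<^sub>E {..<n * m} A \<inter> space (Rblocks n m) =
      Pi\<^sub>E {..<n} (\<lambda>i. Pi\<^sub>E {..<m} (\<lambda>a. A (i * m + a)))" (is "?L = ?R")
  proof (intro subset_antisym subsetI)
    fix w assume "w \<in> ?L"
    then have w: "flatten n m w \<in> Pi\<^sub>E {..<n * m} A" "w \<in> space (Rblocks n m)" by auto
    have "w i a \<in> A (i * m + a)" if "i < n" "a < m" for i a
    proof -
      have "flatten n m w (i * m + a) \<in> A (i * m + a)"
        using w(1) block_index_less[OF that] by blast
      then show ?thesis using that by (simp add: flatten_def block_index_less)
    qed
    then show "w \<in> ?R" using w(2) by (auto simp: space_PiM PiE_def Pi_def)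
  next
    fix w assume w: "w \<in> ?R"
    have "w \<in> space (Rblocks n m)" using w by (auto simp: space_PiM PiE_def Pi_def)
    moreover have "w (k div m) (k mod m) \<in> A k" if "k < n * m" for k
    proof -
      have "w (k div m) \<in> Pi\<^sub>E {..<m} (\<lambda>a. A ((k div m) * m + a))" "k mod m < m"
        using w block_index_div_mod[OF that] by (auto simp: PiE_def Pi_def)
      then have "w (k div m) (k mod m) \<in> A ((k div m) * m + k mod m)" by blast
      then show ?thesis by simp
    qed
    ultimately show "w \<in> ?L" by (auto simp: flatten_def)
  qed
  have "emeasure (distr (Rblocks n m) (Rn (n * m)) (flatten n m)) (Pi\<^sub>E {..<n * m} A) =
     emeasure (Rblocks n m) (Pi\<^sub>E {..<n} (\<lambda>i. Pi\<^sub>E {..<m} (\<lambda>a. A (i * m + a))))"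
    using set by (subst emeasure_distr) (auto simp: eq)
  also have "\<dots> = (\<Prod>i<n. emeasure (Rn m) (Pi\<^sub>E {..<m} (\<lambda>a. A (i * m + a))))"
    using blk by (intro Rn_product.emeasure_PiM) auto
  also have "\<dots> = (\<Prod>i<n. \<Prod>a<m. emeasure lborel (A (i * m + a)))"
    using A by (intro prod.cong refl lborel_product.emeasure_PiM) (auto simp: block_index_less)
  also have "\<dots> = (\<Prod>i<n. \<Prod>k\<in>{i * m..<i * m + m}. emeasure lborel (A k))"
  proof (rule prod.cong[OF refl])
    show "(\<Prod>a<m. emeasure lborel (A (i * m + a))) = (\<Prod>k\<in>{i * m..<i * m + m}. emeasure lborel (A k))" for i
      by (rule prod.reindex_bij_witness[of _ "\<lambda>k. k - i * m" "\<lambda>a. i * m + a"]) auto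
  qed
  also have "\<dots> = (\<Prod>k<n * m. emeasure lborel (A k))" by (rule prod.nat_group)
  finally show "emeasure (distr (Rblocks n m) (Rn (n * m)) (flatten n m)) (Pi\<^sub>E {..<n * m} A) =
     (\<Prod>k<n * m. emeasure lborel (A k))" .
qed simp_all

lemma distr_blocks: "distr (Rn (n * m)) (Rblocks n m) (blocks n m) = Rblocks n m"
proof -
  have "distr (Rn (n * m)) (Rblocks n m) (blocks n m) =
    distr (Rblocks n m) (Rblocks n m) (blocks n m \<circ> flatten n m)"
    by (subst distr_flatten[symmetric], subst distr_distr) simp_all
  also have "\<dots> = Rblocks n m"
    by (subst distr_cong[OF refl refl, of _ _ "\<lambda>w. w"]) (simp_all add: blocks_flatten distr_id)
  finally show ?thesis .
qed

lemma nn_integral_blocks: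
  assumes [measurable]: "f \<in> borel_measurable (Rblocks n m)"
  shows "(\<integral>\<^sup>+ z. f (blocks n m z) \<partial>Rn (n * m)) = (\<integral>\<^sup>+ w. f w \<partial>Rblocks n m)"
proof -
  have "(\<integral>\<^sup>+ w. f w \<partial>Rblocks n m) =
    (\<integral>\<^sup>+ w. f w \<partial>distr (Rn (n * m)) (Rblocks n m) (blocks n m))"
    by (simp only: distr_blocks)
  then show ?thesis by (subst (asm) nn_integral_distr) simp_all
qed

text \<open>Both sides agree on boxes, where the integral of a product of one-variable functions
  factorizes. This turns a product of block densities into the law of independent blocks.\<close>

lemma PiM_density_eq:
  assumes "product_sigma_finite M" "product_sigma_finite (\<lambda>i. density (M i) (f i))" "finite I"
    and [measurable]: "\<And>i. i \<in> I \<Longrightarrow> f i \<in> borel_measurable (M i)"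
  shows "Pi\<^sub>M I (\<lambda>i. density (M i) (f i)) = density (Pi\<^sub>M I M) (\<lambda>w. \<Prod>i\<in>I. f i (w i))"
proof -
  interpret M: product_sigma_finite M by fact
  interpret D: product_sigma_finite "\<lambda>i. density (M i) (f i)" by fact
  have [measurable]: "(\<lambda>w. \<Prod>i\<in>I. f i (w i)) \<in> borel_measurable (Pi\<^sub>M I M)"
    by (intro borel_measurable_prod_ennreal measurable_compose[OF measurable_component_singleton]) auto
  show ?thesis
  proof (rule D.PiM_eqI[symmetric])
    show "sets (density (Pi\<^sub>M I M) (\<lambda>w. \<Prod>i\<in>I. f i (w i))) = sets (Pi\<^sub>M I (\<lambda>i. density (M i) (f i)))"
      by (simp cong: sets_PiM_cong)
    fix A assume A: "\<And>i. i \<in> I \<Longrightarrow> A i \<in> sets (density (M i) (f i))"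
    then have A': "A i \<in> sets (M i)" if "i \<in> I" for i using that by simp
    then have [measurable]: "Pi\<^sub>E I A \<in> sets (Pi\<^sub>M I M)" using assms(3) by (intro sets_PiM_I_finite) auto
    have "emeasure (density (Pi\<^sub>M I M) (\<lambda>w. \<Prod>i\<in>I. f i (w i))) (Pi\<^sub>E I A) =
       (\<integral>\<^sup>+ w. (\<Prod>i\<in>I. f i (w i)) * indicator (Pi\<^sub>E I A) w \<partial>Pi\<^sub>M I M)"
      by (simp add: emeasure_density)
    also have "\<dots> = (\<integral>\<^sup>+ w. (\<Prod>i\<in>I. f i (w i) * indicator (A i) (w i)) \<partial>Pi\<^sub>M I M)"
    proof (rule nn_integral_cong)
      fix w assume "w \<in> space (Pi\<^sub>M I M)"
      then have "w \<in> extensional I" by (auto simp: space_PiM PiE_def)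
      then have "indicator (Pi\<^sub>E I A) w = (\<Prod>i\<in>I. indicator (A i) (w i) :: ennreal)"
        using assms(3) by (auto simp: indicator_def PiE_def Pi_def prod_zero_iff)
      then show "(\<Prod>i\<in>I. f i (w i)) * indicator (Pi\<^sub>E I A) w = (\<Prod>i\<in>I. f i (w i) * indicator (A i) (w i))"
        by (simp add: prod.distrib)
    qed
    also have "\<dots> = (\<Prod>i\<in>I. \<integral>\<^sup>+ x. f i x * indicator (A i) x \<partial>M i)"
      using A' assms(3) by (intro M.product_nn_integral_prod) auto
    also have "\<dots> = (\<Prod>i\<in>I. emeasure (density (M i) (f i)) (A i))"
      using A' by (intro prod.cong refl emeasure_density[symmetric]) auto
    finally show "emeasure (density (Pi\<^sub>M I M) (\<lambda>w. \<Prod>i\<in>I. f i (w i))) (Pi\<^sub>E I A) =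
       (\<Prod>i\<in>I. emeasure (density (M i) (f i)) (A i))" .
  qed fact
qed

subsection \<open>Densities and divergence\<close>

lemma prob_densityD:
  assumes "prob_density M f"
  shows "f \<in> borel_measurable M" "x \<in> space M \<Longrightarrow> 0 \<le> f x" "prob_space (density M f)"
    "(\<integral>\<^sup>+ x. ennreal (f x) \<partial>M) = 1" "integrable M f"
proof -
  show 1: "f \<in> borel_measurable M" "x \<in> space M \<Longrightarrow> 0 \<le> f x" "prob_space (density M f)" for x
    using assms by (auto simp: prob_density_def)
  then interpret prob_space "density M f" by simp
  show 2: "(\<integral>\<^sup>+ x. ennreal (f x) \<partial>M) = 1"
    using emeasure_space_1 1(1) by (simp add: emeasure_density cong: nn_integral_cong)
  show "integrable M f" using 1 2 by (intro integrableI_nonneg) auto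
qed

lemma prob_densityI:
  assumes "f \<in> borel_measurable M" "\<And>x. x \<in> space M \<Longrightarrow> 0 \<le> f x" "(\<integral>\<^sup>+ x. ennreal (f x) \<partial>M) = 1"
  shows "prob_density M f"
  using assms unfolding prob_density_def
  by (auto intro!: prob_spaceI simp: emeasure_density cong: nn_integral_cong)

text \<open>Under absolute continuity q / p is the Radon-Nikodym derivative; where p is 0 the
  quotient by zero is harmless, because q is almost everywhere 0 there. Base e turns
  \<open>log\<close> into \<open>ln\<close>. Every later divergence is computed through this
  integral over the base measure.\<close>

lemma KL_eq_integral:
  assumes M: "sigma_finite_measure M" and q: "prob_density M q" and p: "prob_density M p"
  shows "KL M q p = (if (AE x in M. p x = 0 \<longrightarrow> q x = 0) \<and> integrable M (\<lambda>x. q x * ln (q x / p x))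
     then ereal (\<integral>x. q x * ln (q x / p x) \<partial>M) else \<infinity>)"
proof -
  interpret sigma_finite_measure M by fact
  let ?Q = "density M (\<lambda>x. ennreal (q x))" and ?P = "density M (\<lambda>x. ennreal (p x))"
  interpret P: prob_space ?P using p by (rule prob_densityD)
  note [measurable] = prob_densityD(1)[OF q] prob_densityD(1)[OF p]
  note nn = prob_densityD(2)[OF q] prob_densityD(2)[OF p]
  have AEnn: "AE x in M. 0 \<le> q x" "AE x in M. 0 \<le> p x" using nn by auto
  have log: "log (exp 1) t = ln t" for t :: real by (simp add: log_def)
  have ac: "absolutely_continuous ?P ?Q \<longleftrightarrow> (AE x in M. p x = 0 \<longrightarrow> q x = 0)"
  proof
    assume "absolutely_continuous ?P ?Q"
    moreover have "{x \<in> space M. p x = 0} \<in> null_sets ?P"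
      by (subst null_sets_density_iff) auto
    ultimately have "{x \<in> space M. p x = 0} \<in> null_sets ?Q" by (auto simp: absolutely_continuous_def)
    then have "AE x in M. x \<in> {x \<in> space M. p x = 0} \<longrightarrow> ennreal (q x) = 0"
      by (subst (asm) null_sets_density_iff) auto
    then show "AE x in M. p x = 0 \<longrightarrow> q x = 0"
      by (rule AE_mp) (rule AE_I2, use nn in \<open>auto simp: ennreal_eq_0_iff intro: antisym\<close>)
  next
    assume *: "AE x in M. p x = 0 \<longrightarrow> q x = 0"
    show "absolutely_continuous ?P ?Q"
      unfolding absolutely_continuous_def
    proof
      fix A assume "A \<in> null_sets ?P"
      then have A: "A \<in> sets M" "AE x in M. x \<in> A \<longrightarrow> ennreal (p x) = 0"
        by (subst (asm) null_sets_density_iff; simp)+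
      from A(2) * have "AE x in M. x \<in> A \<longrightarrow> ennreal (q x) = 0"
        using AEnn(2) by eventually_elim (auto simp: ennreal_eq_0_iff)
      then show "A \<in> null_sets ?Q" using A(1) by (subst null_sets_density_iff) auto
    qed
  qed
  show ?thesis
  proof (cases "AE x in M. p x = 0 \<longrightarrow> q x = 0")
    case True
    have "density ?P (\<lambda>x. ennreal (q x / p x)) = ?Q"
      using AEnn True by (intro density_density_divide) auto
    then have "AE x in ?P. ennreal (q x / p x) = RN_deriv ?P ?Q x"
      by (intro P.RN_deriv_unique) auto
    \<comment> \<open>Uniqueness of the derivative holds almost everywhere under the reference
      measure; absolute continuity carries it over to \<open>?Q\<close>, under which the entropy
      density is integrated.\<close>
    then have "AE x in ?Q. ennreal (q x / p x) = RN_deriv ?P ?Q x"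
      using True ac by (intro absolutely_continuous_AE[of ?Q ?P]) auto
    moreover have "AE x in ?Q. x \<in> space M" by (auto simp: AE_density)
    ultimately have eq: "AE x in ?Q. entropy_density (exp 1) ?P ?Q x = ln (q x / p x)"
      by eventually_elim (metis (no_types, lifting) comp_apply divide_nonneg_nonneg enn2real_ennreal entropy_density_def log nn)
    have "integrable ?Q (entropy_density (exp 1) ?P ?Q) \<longleftrightarrow> integrable ?Q (\<lambda>x. ln (q x / p x))"
      by (intro integrable_cong_AE eq) (auto simp: entropy_density_def)
    also have "\<dots> \<longleftrightarrow> integrable M (\<lambda>x. q x * ln (q x / p x))"
      using AEnn by (subst integrable_real_density) auto
    finally show ?thesis
      using KL_density_density[of "exp 1" p q] AEnn True
      by (simp add: KL_def Let_def ac log)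
  next
    case False then show ?thesis by (simp add: KL_def Let_def ac)
  qed
qed

text \<open>Young's inequality for the convex function a ln a - a and its conjugate exp: it is 1 + t
  \<le> exp t at t = b - ln a, multiplied by a. At a = 0 only the positivity of exp remains.\<close>

lemma Gibbs_Young:
  fixes a b :: real assumes "a \<ge> 0"
  shows "a * b \<le> a * ln a - a + exp b"
proof (cases "a = 0")
  case False
  then have a: "a > 0" using assms by simp
  have "1 + (b - ln a) \<le> exp (b - ln a)" by (rule exp_ge_add_one_self)
  then have "a * (1 + (b - ln a)) \<le> a * exp (b - ln a)" using a by simp
  also have "\<dots> = exp b" using a by (simp add: exp_diff)
  finally show ?thesis by (simp add: algebra_simps)
qed simp

text \<open>Pointwise version of the nonnegativity of the divergence, with its equality case: ln x =
  x - 1 only at x = 1. The terms - a + b integrate to 0 when a and b are two densities, so they do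
  not change the divergence.\<close>

lemma entropy_gap_nonneg:
  fixes a b :: real assumes "a \<ge> 0" "b > 0"
  shows "a * ln (a / b) - a + b \<ge> 0" "a * ln (a / b) - a + b = 0 \<Longrightarrow> a = b"
proof -
  show "a * ln (a / b) - a + b \<ge> 0"
    using Gibbs_Young[OF assms(1), of "ln b"] assms by (cases "a = 0") (auto simp: ln_div algebra_simps)
  assume *: "a * ln (a / b) - a + b = 0"
  then have a: "a > 0" using assms by (cases "a = 0") auto
  have "ln (b / a) = b / a - 1"
    using * a assms by (simp add: ln_div field_simps)
  then have "b / a = 1" using a assms ln_eq_minus_one by (metis divide_pos_pos)
  then show "a = b" using a by simp
qed

lemma sum_blocks: "(\<Sum>k<n * m. f k) = (\<Sum>i<n. \<Sum>a<(m::nat). f (i * m + a))"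
proof -
  have "(\<Sum>k\<in>{i * m..<i * m + m}. f k) = (\<Sum>a<m. f (i * m + a))" for i
    by (rule sum.reindex_bij_witness[of _ "\<lambda>a. i * m + a" "\<lambda>k. k - i * m"]) auto
  then show ?thesis by (simp flip: sum.nat_group)
qed

lemma quad_flatten:
  "quad (n * m) G (flatten n m w) =
     (\<Sum>i<n. \<Sum>j<n. \<Sum>a<m. \<Sum>b<m. G $$ (i * m + a, j * m + b) * w i a * w j b)"
proof -
  have "quad (n * m) G (flatten n m w) =
    (\<Sum>i<n. \<Sum>a<m. \<Sum>j<n. \<Sum>b<m. G $$ (i * m + a, j * m + b) * w i a * w j b)"
    unfolding quad_def sum_blocks by (intro sum.cong refl) (auto simp: flatten_def block_index_less)
  also have "\<dots> = (\<Sum>i<n. \<Sum>j<n. \<Sum>a<m. \<Sum>b<m. G $$ (i * m + a, j * m + b) * w i a * w j b)"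
    by (intro sum.cong refl sum.swap)
  finally show ?thesis .
qed

text \<open>P need not be measurable, so the exceptional set is enclosed in a measurable null set,
  for which the two almost-everywhere quantifiers can be exchanged.\<close>

lemma AE_pair_swap:
  assumes "sigma_finite_measure M1" "sigma_finite_measure M2" "AE \<omega> in M1 \<Otimes>\<^sub>M M2. P \<omega>"
  shows "AE y in M2. AE x in M1. P (x, y)"
proof -
  interpret pair_sigma_finite M1 M2 using assms by (simp add: pair_sigma_finite_def)
  obtain A where A: "{\<omega> \<in> space (M1 \<Otimes>\<^sub>M M2). \<not> P \<omega>} \<subseteq> A" "A \<in> null_sets (M1 \<Otimes>\<^sub>M M2)"
    using assms(3) by (auto elim: AE_E simp: null_sets_def)
  have [measurable]: "A \<in> sets (M1 \<Otimes>\<^sub>M M2)" using A by auto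
  have "AE \<omega> in M1 \<Otimes>\<^sub>M M2. \<omega> \<notin> A" using A(2) by (rule AE_not_in)
  then have "AE x in M1. AE y in M2. (x, y) \<notin> A" by (rule AE_pair)
  then have "AE y in M2. AE x in M1. (x, y) \<notin> A" by (subst (asm) AE_commute) simp_all
  moreover have "AE y in M2. y \<in> space M2" by simp
  ultimately show ?thesis
  proof eventually_elim
    case (elim y)
    have "AE x in M1. x \<in> space M1" by simp
    with elim(1) show ?case
      by eventually_elim (use A(1) elim(2) in \<open>auto simp: space_pair_measure\<close>)
  qed
qed

lemma sigma_finite_pair_Rn: "sigma_finite_measure (Rn d \<Otimes>\<^sub>M Rn k)"
proof -
  interpret pair_sigma_finite "Rn d" "Rn k" by (simp add: pair_sigma_finite_def sigma_finite_Rn)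
  show ?thesis by (rule sigma_finite_measure_axioms)
qed

interpretation Rn_pair: pair_sigma_finite "Rn d" "Rn k" for d k
  by (simp add: pair_sigma_finite_def sigma_finite_Rn)

subsection \<open>Densities with independent blocks\<close>

text \<open>A density is asked for at every index, since \<open>product_sigma_finite\<close>
  quantifies over all of them; the products themselves run over j below n.\<close>

abbreviation law :: "nat \<Rightarrow> (nat \<Rightarrow> (nat \<Rightarrow> real) \<Rightarrow> real) \<Rightarrow> nat \<Rightarrow> (nat \<Rightarrow> real) measure" where
  "law m t \<equiv> \<lambda>j. density (Rn m) (\<lambda>w. ennreal (t j w))"

lemma prod_dens_measurable:
  assumes "\<And>i. i < n \<Longrightarrow> t i \<in> borel_measurable (Rn m)"
  shows "(\<lambda>z. \<Prod>i<n. t i (zblock m i z) :: real) \<in> borel_measurable (Rn (n * m))"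
  using assms by (intro borel_measurable_prod measurable_compose[OF measurable_zblock]) auto

lemma PiM_law:
  assumes t: "\<And>j. prob_density (Rn m) (t j)"
  shows "Pi\<^sub>M {..<n} (law m t) = density (Rblocks n m) (\<lambda>w. ennreal (\<Prod>i<n. t i (w i)))"
proof -
  have ps: "prob_space (law m t j)" for j by (rule prob_densityD(3)[OF t])
  have "product_sigma_finite (law m t)"
    using ps by (simp add: product_sigma_finite_def prob_space_imp_sigma_finite)
  moreover have [measurable]: "t i \<in> borel_measurable (Rn m)" for i by (rule prob_densityD(1)[OF t])
  ultimately have "Pi\<^sub>M {..<n} (law m t) =
      density (Rblocks n m) (\<lambda>w. \<Prod>i<n. ennreal (t i (w i)))"
    by (intro PiM_density_eq Rn_product.product_sigma_finite_axioms) auto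
  also have "\<dots> = density (Rblocks n m) (\<lambda>w. ennreal (\<Prod>i<n. t i (w i)))"
    using prob_densityD(2)[OF t]
    by (intro density_cong AE_I2 prod_ennreal borel_measurable_prod_ennreal
        measurable_compose[OF borel_measurable_prod measurable_ennreal] measurable_compose[OF measurable_component_singleton])
       (auto simp: space_PiM)
  finally show ?thesis .
qed

lemma nn_integral_prod_dens:
  assumes t: "\<And>j. prob_density (Rn m) (t j)" and [measurable]: "f \<in> borel_measurable (Rblocks n m)"
  shows "(\<integral>\<^sup>+ z. ennreal (\<Prod>i<n. t i (zblock m i z)) * f (blocks n m z) \<partial>Rn (n * m)) =
    (\<integral>\<^sup>+ w. f w \<partial>Pi\<^sub>M {..<n} (law m t))"
proof -
  have [measurable]: "t i \<in> borel_measurable (Rn m)" for i by (rule prob_densityD(1)[OF t])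
  have [measurable]: "(\<lambda>w. \<Prod>i<n. t i (w i)) \<in> borel_measurable (Rblocks n m)"
    by (intro borel_measurable_prod measurable_compose[OF measurable_component_singleton]) auto
  have "(\<integral>\<^sup>+ z. ennreal (\<Prod>i<n. t i (zblock m i z)) * f (blocks n m z) \<partial>Rn (n * m)) =
    (\<integral>\<^sup>+ z. (\<lambda>w. ennreal (\<Prod>i<n. t i (w i)) * f w) (blocks n m z) \<partial>Rn (n * m))"
    by (intro nn_integral_cong) (simp add: blocks_def)
  also have "\<dots> = (\<integral>\<^sup>+ w. ennreal (\<Prod>i<n. t i (w i)) * f w \<partial>Rblocks n m)"
    by (intro nn_integral_blocks) simp
  also have "\<dots> = (\<integral>\<^sup>+ w. f w \<partial>Pi\<^sub>M {..<n} (law m t))"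
    by (simp add: PiM_law[OF t] nn_integral_density)
  finally show ?thesis .
qed

lemma prob_density_prod_dens:
  assumes t: "\<And>j. prob_density (Rn m) (t j)"
  shows "prob_density (Rn (n * m)) (\<lambda>z. \<Prod>i<n. t i (zblock m i z))"
proof (rule prob_densityI)
  interpret prob_space "Pi\<^sub>M {..<n} (law m t)"
    by (intro prob_space_PiM prob_densityD(3)[OF t])
  show "(\<integral>\<^sup>+ z. ennreal (\<Prod>i<n. t i (zblock m i z)) \<partial>Rn (n * m)) = 1"
    using nn_integral_prod_dens[OF t, of "\<lambda>_. 1" n] emeasure_space_1 by simp
  show "0 \<le> (\<Prod>i<n. t i (zblock m i z))" if "z \<in> space (Rn (n * m))" for z
    using prob_densityD(2)[OF t] measurable_space[OF measurable_zblock that]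
    by (intro prod_nonneg) auto
qed (intro prod_dens_measurable prob_densityD(1)[OF t])

text \<open>The factorization speaks of a conditional density, a quotient whose denominator c may be
  0, so the marginal s of z has to be recovered. Integrating the factorization over \<beta> gives s
  = s T / c, where T is the product of the block densities. Hence s = T if c is not 0, and s = 0
  otherwise; in both cases s \<le> T. Both have total mass 1, so they agree almost
  everywhere.\<close>

lemma factorizes_marginal:
  assumes fac: "factorizes n m d q t" and t: "\<And>j. prob_density (Rn m) (t j)"
  shows "AE z in Rn (n * m). (\<integral>\<^sup>+ \<beta>. ennreal (q (\<beta>, z)) \<partial>Rn d) = ennreal (\<Prod>i<n. t i (zblock m i z))"
proof -
  define s where "s = (\<lambda>z. \<integral>\<^sup>+ \<beta>. ennreal (q (\<beta>, z)) \<partial>Rn d)"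
  define T where "T = (\<lambda>z. \<Prod>i<n. t i (zblock m i z))"
  have T: "prob_density (Rn (n * m)) T" unfolding T_def by (rule prob_density_prod_dens[OF t])
  have q: "prob_density (Rn d \<Otimes>\<^sub>M Rn (n * m)) q" using fac by (simp add: factorizes_def)
  note [measurable] = prob_densityD(1)[OF q] prob_densityD(1)[OF T]
  interpret beta: sigma_finite_measure "Rn d" by (rule sigma_finite_Rn)
  have [measurable]: "s \<in> borel_measurable (Rn (n * m))"
    unfolding s_def by measurable
  have s1: "(\<integral>\<^sup>+ z. s z \<partial>Rn (n * m)) = 1"
    unfolding s_def using prob_densityD(4)[OF q] by (subst Rn_pair.nn_integral_snd) auto
  have T1: "(\<integral>\<^sup>+ z. ennreal (T z) \<partial>Rn (n * m)) = 1" by (rule prob_densityD(4)[OF T])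
  have "AE z in Rn (n * m). AE \<beta> in Rn d. q (\<beta>, z) = cond_beta_dens d q \<beta> z * T z"
    using fac AE_pair_swap[OF sigma_finite_Rn sigma_finite_Rn,
        of "\<lambda>(\<beta>, z). q (\<beta>, z) = cond_beta_dens d q \<beta> z * T z" d "n * m"]
    by (simp add: factorizes_def T_def)
  moreover have "AE z in Rn (n * m). s z \<noteq> \<infinity>"
    by (rule nn_integral_noteq_infinite) (simp_all add: s1)
  moreover have "AE z in Rn (n * m). z \<in> space (Rn (n * m))" by simp
  ultimately have le: "AE z in Rn (n * m). s z \<le> ennreal (T z)"
  proof eventually_elim
    case (elim z)
    have [measurable]: "(\<lambda>\<beta>. q (\<beta>, z)) \<in> borel_measurable (Rn d)"
      using elim(3) by measurable
    have nn: "0 \<le> q (\<beta>, z)" if "\<beta> \<in> space (Rn d)" for \<beta>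
      using prob_densityD(2)[OF q] that elim(3) by (simp add: space_pair_measure)
    have "integrable (Rn d) (\<lambda>\<beta>. q (\<beta>, z))"
      using elim(2) nn by (intro integrableI_nonneg) (auto simp: s_def less_top)
    then have s: "s z = ennreal (\<integral>\<beta>. q (\<beta>, z) \<partial>Rn d)"
      unfolding s_def using nn by (intro nn_integral_eq_integral) auto
    define c where "c = (\<integral>\<beta>. q (\<beta>, z) \<partial>Rn d)"
    have c: "c \<ge> 0" unfolding c_def using nn by (intro integral_nonneg_AE) auto
    have Tz: "T z \<ge> 0" by (rule prob_densityD(2)[OF T elim(3)])
    have "s z = (\<integral>\<^sup>+ \<beta>. ennreal (q (\<beta>, z)) * ennreal (T z / c) \<partial>Rn d)"
      unfolding s_def
    proof (rule nn_integral_cong_AE)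
      have "AE \<beta> in Rn d. \<beta> \<in> space (Rn d)" by simp
      with elim(1) show "AE \<beta> in Rn d. ennreal (q (\<beta>, z)) = ennreal (q (\<beta>, z)) * ennreal (T z / c)"
      proof eventually_elim
        case (elim \<beta>)
        then have "q (\<beta>, z) = q (\<beta>, z) * (T z / c)" by (simp add: cond_beta_dens_def c_def)
        then show ?case using nn[OF elim(2)] c Tz by (metis divide_nonneg_nonneg ennreal_mult)
      qed
    qed
    also have "\<dots> = s z * ennreal (T z / c)" unfolding s_def by (intro nn_integral_multc) simp
    also have "\<dots> = ennreal (c * (T z / c))"
      unfolding s c_def[symmetric] by (rule ennreal_mult[symmetric]) (use c Tz in auto)
    also have "\<dots> \<le> ennreal (T z)" using Tz by (cases "c = 0") (auto intro: ennreal_leI)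
    finally show ?case .
  qed
  have "(\<integral>\<^sup>+ z. ennreal (T z) - s z \<partial>Rn (n * m)) = 0"
    using le s1 T1 by (subst nn_integral_diff) auto
  then have "AE z in Rn (n * m). ennreal (T z) - s z = 0"
    by (subst (asm) nn_integral_0_iff_AE) auto
  with le have "AE z in Rn (n * m). s z = ennreal (T z)"
    by eventually_elim (auto simp: diff_eq_0_iff_ennreal intro: antisym)
  then show ?thesis unfolding s_def T_def .
qed

text \<open>Integrating out \<beta> leaves the product density of
  \<open>factorizes_marginal\<close>, so under q the blocks of z are independent. Expectations under
  q of functions of z pass through this identity.\<close>

lemma distr_factorizes:
  assumes fac: "factorizes n m d q t" and t: "\<And>j. prob_density (Rn m) (t j)"
  shows "distr (density (Rn d \<Otimes>\<^sub>M Rn (n * m)) (\<lambda>\<omega>. ennreal (q \<omega>))) (Rblocks n m)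
      (\<lambda>\<omega>. blocks n m (snd \<omega>)) = Pi\<^sub>M {..<n} (law m t)" (is "?D = ?P")
proof (rule measure_eqI)
  show sets: "sets ?D = sets ?P" by (simp cong: sets_PiM_cong)
  fix A assume "A \<in> sets ?D"
  then have [measurable]: "A \<in> sets (Rblocks n m)" by simp
  have q: "prob_density (Rn d \<Otimes>\<^sub>M Rn (n * m)) q" using fac by (simp add: factorizes_def)
  note [measurable] = prob_densityD(1)[OF q]
  have "emeasure ?D A = (\<integral>\<^sup>+ \<omega>. indicator A \<omega> \<partial>?D)" by simp
  also have "\<dots> = (\<integral>\<^sup>+ \<omega>. ennreal (q \<omega>) * indicator A (blocks n m (snd \<omega>)) \<partial>(Rn d \<Otimes>\<^sub>M Rn (n * m)))"
    by (subst nn_integral_distr) (simp_all add: nn_integral_density)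
  also have "\<dots> = (\<integral>\<^sup>+ z. \<integral>\<^sup>+ \<beta>. ennreal (q (\<beta>, z)) * indicator A (blocks n m z) \<partial>Rn d \<partial>Rn (n * m))"
    by (subst Rn_pair.nn_integral_snd[symmetric]) simp_all
  also have "\<dots> = (\<integral>\<^sup>+ z. (\<integral>\<^sup>+ \<beta>. ennreal (q (\<beta>, z)) \<partial>Rn d) * indicator A (blocks n m z) \<partial>Rn (n * m))"
    by (intro nn_integral_cong nn_integral_multc) measurable
  also have "\<dots> = (\<integral>\<^sup>+ z. ennreal (\<Prod>i<n. t i (zblock m i z)) * indicator A (blocks n m z) \<partial>Rn (n * m))"
    using factorizes_marginal[OF fac t] by (intro nn_integral_cong_AE) auto
  also have "\<dots> = (\<integral>\<^sup>+ w. indicator A w \<partial>?P)" by (intro nn_integral_prod_dens[OF t]) simp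
  also have "\<dots> = emeasure ?P A" using \<open>A \<in> sets ?D\<close> sets by (intro nn_integral_indicator) simp
  finally show "emeasure ?D A = emeasure ?P A" .
qed

lemma integrable_PiM_component:
  fixes f :: "'b \<Rightarrow> real"
  assumes "\<And>i. i \<in> I \<Longrightarrow> prob_space (N i)" "j \<in> I" "f \<in> borel_measurable (N j)"
  shows "integrable (Pi\<^sub>M I N) (\<lambda>w. f (w j)) \<longleftrightarrow> integrable (N j) f"
    and "(\<integral>w. f (w j) \<partial>Pi\<^sub>M I N) = (\<integral>x. f x \<partial>N j)"
proof -
  have meas: "(\<lambda>w. w j) \<in> Pi\<^sub>M I N \<rightarrow>\<^sub>M N j" using assms(2) by (rule measurable_component_singleton)
  have eq: "distr (Pi\<^sub>M I N) (N j) (\<lambda>w. w j) = N j" using assms(1,2) by (rule distr_PiM_component)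
  show "integrable (Pi\<^sub>M I N) (\<lambda>w. f (w j)) \<longleftrightarrow> integrable (N j) f"
    using integrable_distr_eq[OF meas assms(3)] by (simp only: eq)
  show "(\<integral>w. f (w j) \<partial>Pi\<^sub>M I N) = (\<integral>x. f x \<partial>N j)"
    using integral_distr[OF meas assms(3)] by (simp only: eq)
qed

lemma AE_PiM_componentD:
  assumes "\<And>i. i \<in> I \<Longrightarrow> prob_space (N i)" "j \<in> I" "AE w in Pi\<^sub>M I N. P (w j)"
    and "{x \<in> space (N j). P x} \<in> sets (N j)"
  shows "AE x in N j. P x"
proof -
  have meas: "(\<lambda>w. w j) \<in> Pi\<^sub>M I N \<rightarrow>\<^sub>M N j" using assms(2) by (rule measurable_component_singleton)
  have eq: "distr (Pi\<^sub>M I N) (N j) (\<lambda>w. w j) = N j" using assms(1,2) by (rule distr_PiM_component)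
  show ?thesis using AE_distr_iff[OF meas assms(4)] assms(3) by (simp only: eq)
qed

subsection \<open>Truncated normal densities\<close>

lemma coordinate_measurable: "a < m \<Longrightarrow> (\<lambda>w. w a) \<in> borel_measurable (Rn m)"
  using measurable_component_singleton[of a "{..<m}" "\<lambda>_. lborel :: real measure"] by simp

lemma nn_integral_exp_neg_sq_finite:
  assumes "e > 0"
  shows "(\<integral>\<^sup>+ u. ennreal (exp (- e * (\<Sum>r<k. (u r - \<mu> r)\<^sup>2))) \<partial>Rn k) < \<infinity>"
proof -
  have "(\<integral>\<^sup>+ u. ennreal (exp (- e * (\<Sum>r<k. (u r - \<mu> r)\<^sup>2))) \<partial>Rn k) =
      (\<integral>\<^sup>+ u. (\<Prod>r<k. ennreal (exp (- (2 * e * (u r - \<mu> r)\<^sup>2) / 2))) \<partial>Rn k)"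
    by (intro nn_integral_cong) (simp add: prod_ennreal exp_sum sum_distrib_left sum_negf[symmetric])
  also have "\<dots> = (\<Prod>r<k. \<integral>\<^sup>+ x. ennreal (exp (- (2 * e * (x - \<mu> r)\<^sup>2) / 2)) \<partial>lborel)"
    by (intro lborel_product.product_nn_integral_prod) auto
  also have "\<dots> = (\<Prod>r<k. ennreal (sqrt (2 * pi / (2 * e))))"
    using assms by (intro prod.cong refl nn_integral_gaussian_1d) simp
  also have "\<dots> < \<infinity>" using assms by (simp add: ennreal_power)
  finally show ?thesis .
qed

lemma integrable_exp_neg_sq:
  assumes "e > 0"
  shows "integrable (Rn k) (\<lambda>u. exp (- e * (\<Sum>r<k. (u r - \<mu> r)\<^sup>2)))"
  using nn_integral_exp_neg_sq_finite[OF assms, of k \<mu>] by (intro integrableI_nonneg) auto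

lemma sq_le_exp:
  assumes "e > (0::real)" shows "x\<^sup>2 \<le> exp (e * x\<^sup>2) / e"
proof -
  have "e * x\<^sup>2 \<le> exp (e * x\<^sup>2)" using exp_ge_add_one_self[of "e * x\<^sup>2"] by linarith
  then show ?thesis using assms by (simp add: field_simps)
qed

lemma abs_mult_le_sum_sq: "\<bar>x * y\<bar> \<le> x\<^sup>2 + (y\<^sup>2 :: real)"
proof -
  have "0 \<le> (\<bar>x\<bar> - \<bar>y\<bar>)\<^sup>2" by simp
  then have "2 * (\<bar>x\<bar> * \<bar>y\<bar>) \<le> x\<^sup>2 + y\<^sup>2" by (simp add: power2_diff)
  moreover have "0 \<le> \<bar>x\<bar> * \<bar>y\<bar>" by simp
  ultimately show ?thesis unfolding abs_mult by linarith
qed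

lemma integrable_mult_if_sq:
  fixes f g :: "'a \<Rightarrow> real"
  assumes "integrable M (\<lambda>x. (f x)\<^sup>2)" "integrable M (\<lambda>x. (g x)\<^sup>2)"
    and [measurable]: "f \<in> borel_measurable M" "g \<in> borel_measurable M"
  shows "integrable M (\<lambda>x. f x * g x)"
  by (rule Bochner_Integration.integrable_bound[OF Bochner_Integration.integrable_add[OF assms(1,2)]])
     (auto simp: abs_mult_le_sum_sq)

lemma (in prob_space) integrable_if_sq:
  fixes f :: "'a \<Rightarrow> real"
  assumes "integrable M (\<lambda>x. (f x)\<^sup>2)" and [measurable]: "f \<in> borel_measurable M"
  shows "integrable M f"
  using integrable_mult_if_sq[of M f "\<lambda>_. 1"] assms by simp

text \<open>A set of volume 1 inside the open positive orthant, so that its indicator is a density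
  with logarithm 0 on its support. It provides the competitor of finite divergence, the positivity
  of normalizing constants, and filler densities for indices from n on.\<close>

definition positive_cube :: "nat \<Rightarrow> (nat \<Rightarrow> real) \<Rightarrow> bool" where
  "positive_cube m w \<longleftrightarrow> (\<forall>a<m. 0 < w a \<and> w a < 1)"

lemma prob_density_cube: "prob_density (Rn m) (\<lambda>w. of_bool (positive_cube m w))"
proof (rule prob_densityI)
  have [measurable]: "Measurable.pred (Rn m) (positive_cube m)" unfolding positive_cube_def by measurable
  show "(\<lambda>w. of_bool (positive_cube m w)) \<in> borel_measurable (Rn m)" by measurable
  have "(\<integral>\<^sup>+ w. ennreal (of_bool (positive_cube m w)) \<partial>Rn m) = (\<integral>\<^sup>+ w. (\<Prod>a<m. indicator {0<..<1} (w a)) \<partial>Rn m)"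
    by (intro nn_integral_cong) (auto simp: positive_cube_def indicator_def prod_zero_iff)
  also have "\<dots> = (\<Prod>a<m. \<integral>\<^sup>+ x. indicator {0<..<1::real} x \<partial>lborel)"
    by (rule lborel_product.product_nn_integral_prod[where f = "\<lambda>_. indicator {0<..<1}"]) auto
  also have "\<dots> = 1" by simp
  finally show "(\<integral>\<^sup>+ w. ennreal (of_bool (positive_cube m w)) \<partial>Rn m) = 1" .
qed simp

text \<open>Coordinate hyperplanes are null sets. This reconciles the truncation to the closed
  orthant with the posterior, which lives on the open one.\<close>

lemma AE_Rn_coordinate_nonzero: "AE w in Rn m. \<forall>a<m. w a \<noteq> 0"
proof -
  have "AE w in Rn m. w a \<noteq> 0" if "a < m" for a
  proof -
    note [measurable] = coordinate_measurable[OF that]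
    have "(\<integral>\<^sup>+ w. indicator {w \<in> space (Rn m). w a = 0} w \<partial>Rn m) =
        (\<integral>\<^sup>+ w. (\<Prod>b<m. if b = a then indicator {0} (w b) else 1) \<partial>Rn m)"
      using that by (intro nn_integral_cong) (auto simp: indicator_def)
    also have "\<dots> = (\<Prod>b<m. \<integral>\<^sup>+ x. (if b = a then indicator {0::real} x else 1) \<partial>lborel)"
      by (rule lborel_product.product_nn_integral_prod[where f = "\<lambda>b x. if b = a then indicator {0} x else 1"]) auto
    also have "\<dots> = 0" using that by (intro prod_zero bexI[of _ a]) auto
    finally have "emeasure (Rn m) {w \<in> space (Rn m). w a = 0} = 0" by (subst (asm) nn_integral_indicator) auto
    then show ?thesis by (subst AE_iff_measurable[OF _ refl]) auto
  qed
  then show ?thesis by (auto simp: AE_all_countable)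
qed

lemma integrable_gaussian_moment:
  assumes P: "positive_definite m P" and a: "a < m"
  shows "integrable (Rn m) (\<lambda>w. (w a)\<^sup>2 * exp (- quad m P (\<lambda>r. w r - \<mu> r) / 2))"
proof -
  obtain c where c: "c > 0" "\<And>u. c * (\<Sum>r<m. (u r)\<^sup>2) \<le> quad m P u"
    using positive_definite_lower_bound[OF P] by blast
  \<comment> \<open>With e = c / 4 the exponent is at most - 2 e times the squared distance to
    \<mu>. Half of this absorbs the factor (w a)^2, the other half stays integrable.\<close>
  define e where "e = c / 4"
  have e: "e > 0" using c by (simp add: e_def)
  let ?s = "\<lambda>w. \<Sum>r<m. (w r - \<mu> r)\<^sup>2"
  have "integrable (Rn m) (\<lambda>w. (2 / e + 2 * (\<mu> a)\<^sup>2) * exp (- e * ?s w))"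
    by (intro integrable_mult_right integrable_exp_neg_sq e)
  then show ?thesis
  proof (rule Bochner_Integration.integrable_bound)
    show "(\<lambda>w. (w a)\<^sup>2 * exp (- quad m P (\<lambda>r. w r - \<mu> r) / 2)) \<in> borel_measurable (Rn m)"
    proof -
      note [measurable] = coordinate_measurable[OF a]
      show ?thesis by measurable
    qed
    have "(w a)\<^sup>2 * exp (- quad m P (\<lambda>r. w r - \<mu> r) / 2) \<le> (2 / e + 2 * (\<mu> a)\<^sup>2) * exp (- e * ?s w)" for w
    proof -
      have s: "(w a - \<mu> a)\<^sup>2 \<le> ?s w" using a by (intro member_le_sum) auto
      have "0 \<le> (w a - 2 * \<mu> a)\<^sup>2" by simp
      then have "(w a)\<^sup>2 \<le> 2 * (w a - \<mu> a)\<^sup>2 + 2 * (\<mu> a)\<^sup>2" by (simp add: power2_eq_square algebra_simps)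
      also have "\<dots> \<le> 2 * (exp (e * (w a - \<mu> a)\<^sup>2) / e) + 2 * (\<mu> a)\<^sup>2"
        using sq_le_exp[OF e, of "w a - \<mu> a"] by simp
      also have "\<dots> \<le> 2 * (exp (e * ?s w) / e) + 2 * (\<mu> a)\<^sup>2 * exp (e * ?s w)"
      proof -
        have "1 \<le> exp (e * ?s w)" using e by (simp add: sum_nonneg)
        then have "2 * (\<mu> a)\<^sup>2 * 1 \<le> 2 * (\<mu> a)\<^sup>2 * exp (e * ?s w)" by (intro mult_left_mono) auto
        moreover have "exp (e * (w a - \<mu> a)\<^sup>2) / e \<le> exp (e * ?s w) / e"
          using s e by (intro divide_right_mono) auto
        ultimately show ?thesis by simp
      qed
      also have "\<dots> = (2 / e + 2 * (\<mu> a)\<^sup>2) * exp (e * ?s w)" by (simp add: algebra_simps)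
      finally have 1: "(w a)\<^sup>2 \<le> (2 / e + 2 * (\<mu> a)\<^sup>2) * exp (e * ?s w)" .
      have 2: "exp (- quad m P (\<lambda>r. w r - \<mu> r) / 2) \<le> exp (- 2 * e * ?s w)"
        using c(2)[of "\<lambda>r. w r - \<mu> r"] by (simp add: e_def)
      have "(w a)\<^sup>2 * exp (- quad m P (\<lambda>r. w r - \<mu> r) / 2) \<le>
          ((2 / e + 2 * (\<mu> a)\<^sup>2) * exp (e * ?s w)) * exp (- 2 * e * ?s w)"
        using 1 2 e by (intro mult_mono) auto
      also have "\<dots> = (2 / e + 2 * (\<mu> a)\<^sup>2) * (exp (e * ?s w) * exp (- 2 * e * ?s w))" by simp
      also have "exp (e * ?s w) * exp (- 2 * e * ?s w) = exp (- e * ?s w)"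
        by (simp flip: exp_add)
      finally show ?thesis .
    qed
    then show "AE w in Rn m. norm ((w a)\<^sup>2 * exp (- quad m P (\<lambda>r. w r - \<mu> r) / 2))
        \<le> norm ((2 / e + 2 * (\<mu> a)\<^sup>2) * exp (- e * ?s w))"
      using e by (auto simp: abs_mult)
  qed
qed

lemma quad_diff:
  assumes sym: "\<And>r c. r < m \<Longrightarrow> c < m \<Longrightarrow> P $$ (r, c) = P $$ (c, r)"
  shows "quad m P (\<lambda>r. w r - \<mu> r) =
    quad m P w - 2 * (\<Sum>r<m. w r * (\<Sum>c<m. P $$ (r, c) * \<mu> c)) + quad m P \<mu>"
proof -
  let ?s = "\<Sum>r<m. w r * (\<Sum>c<m. P $$ (r, c) * \<mu> c)"
  have 1: "(\<Sum>r<m. \<Sum>c<m. P $$ (r, c) * w r * \<mu> c) = ?s"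
    by (simp add: sum_distrib_left algebra_simps)
  have "(\<Sum>r<m. \<Sum>c<m. P $$ (r, c) * \<mu> r * w c) = (\<Sum>c<m. \<Sum>r<m. P $$ (r, c) * \<mu> r * w c)"
    by (rule sum.swap)
  also have "\<dots> = (\<Sum>r<m. \<Sum>c<m. P $$ (r, c) * w r * \<mu> c)"
    using sym by (intro sum.cong refl) auto
  also have "\<dots> = ?s" by (rule 1)
  finally have 2: "(\<Sum>r<m. \<Sum>c<m. P $$ (r, c) * \<mu> r * w c) = ?s" .
  have "quad m P (\<lambda>r. w r - \<mu> r) = (\<Sum>r<m. \<Sum>c<m. P $$ (r, c) * w r * w c - P $$ (r, c) * w r * \<mu> c -
      P $$ (r, c) * \<mu> r * w c + P $$ (r, c) * \<mu> r * \<mu> c)"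
    unfolding quad_def by (intro sum.cong refl) (simp add: algebra_simps)
  also have "\<dots> = quad m P w - ?s - ?s + quad m P \<mu>"
    by (simp only: sum.distrib sum_subtractf 1 2) (simp add: quad_def)
  finally show ?thesis by simp
qed

text \<open>The facts about \<open>\<tau>\<close> that the optimality argument uses. On the closed
  orthant its logarithm is a polynomial of degree two, whose constant c collects the normalizations.
  Positivity on the whole closed orthant ensures that \<open>\<tau>\<close> dominates every density
  supported there.\<close>

lemma truncated_normal:
  assumes W: "positive_definite m W" and P: "P = minv W" and \<mu>: "\<mu> \<in> carrier_vec m"
    and A: "A = {w. \<forall>a<m. 0 \<le> w a}"
  defines "\<tau> \<equiv> truncated_normal_dens m \<mu> W A"
  shows "prob_density (Rn m) \<tau>"
    and "\<And>w a. \<tau> w \<noteq> 0 \<Longrightarrow> a < m \<Longrightarrow> 0 \<le> w a"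
    and "\<exists>c. \<forall>w. (\<forall>a<m. 0 \<le> w a) \<longrightarrow> \<tau> w > 0 \<and>
      ln (\<tau> w) = c - quad m P w / 2 + (\<Sum>r<m. w r * (\<Sum>b<m. P $$ (r, b) * \<mu> $ b))"
    and "\<And>a. a < m \<Longrightarrow> integrable (density (Rn m) (\<lambda>w. ennreal (\<tau> w))) (\<lambda>w. (w a)\<^sup>2)"
proof -
  note W' = minv_positive_definite[OF W, folded P]
  have Ppd: "positive_definite m P" unfolding P by (rule positive_definite_minv[OF W])
  have sym: "P $$ (r, c) = P $$ (c, r)" if "r < m" "c < m" for r c
    using Ppd that unfolding positive_definite_iff_quad by blast
  define \<mu>' where "\<mu>' = (\<lambda>r. \<mu> $ r)"
  have \<mu>': "\<mu> = vec m \<mu>'" using \<mu> by (auto simp: \<mu>'_def)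
  define D where "D = sqrt ((2 * pi) ^ m * det W)"
  have D: "D > 0" using det_positive_definite_pos[OF W] by (simp add: D_def)
  define \<phi> where "\<phi> = (\<lambda>w. normal_dens W (vec m w - \<mu>))"
  have \<phi>: "\<phi> w = exp (- quad m P (\<lambda>r. w r - \<mu>' r) / 2) / D" for w
    unfolding \<phi>_def D_def \<mu>' P by (rule normal_dens_eq_quad) (use W' P in simp)
  have \<phi>pos: "\<phi> w > 0" for w using D by (simp add: \<phi>)
  have [measurable]: "\<phi> \<in> borel_measurable (Rn m)" unfolding \<phi> by measurable
  have [measurable]: "Measurable.pred (Rn m) (\<lambda>w. w \<in> A)"
    unfolding A mem_Collect_eq by measurable
  then have [measurable]: "(\<lambda>w. indicator A w :: real) \<in> borel_measurable (Rn m)"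
    unfolding indicator_def by measurable
  have "(\<integral>\<^sup>+ w. ennreal (\<phi> w) \<partial>Rn m) = 1" unfolding \<phi>_def by (rule nn_integral_normal_dens[OF W \<mu>])
  then have int\<phi>: "integrable (Rn m) \<phi>" using \<phi>pos by (intro integrableI_nonneg) (auto simp: less_imp_le)
  have int: "integrable (Rn m) (\<lambda>w. indicator A w * \<phi> w)"
    by (rule Bochner_Integration.integrable_bound[OF int\<phi>]) (auto simp: indicator_def)
  define Z where "Z = (\<integral>w. indicator A w * \<phi> w \<partial>Rn m)"
  have Z0: "Z \<ge> 0" unfolding Z_def using \<phi>pos by (intro integral_nonneg_AE) (auto simp: less_imp_le)
  \<comment> \<open>The truncation region contains the positive cube, of volume 1, on which the
    integrand is positive.\<close>
  have "Z \<noteq> 0"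
  proof
    assume "Z = 0"
    then have "AE w in Rn m. indicator A w * \<phi> w = 0"
      using int \<phi>pos unfolding Z_def by (subst (asm) integral_nonneg_eq_0_iff_AE) (auto simp: less_imp_le)
    then have "AE w in Rn m. ennreal (of_bool (positive_cube m w)) = 0"
      by eventually_elim (use \<phi>pos in \<open>auto simp: A positive_cube_def indicator_def less_imp_le less_le\<close>)
    then have "(\<integral>\<^sup>+ w. ennreal (of_bool (positive_cube m w)) \<partial>Rn m) = 0"
      by (subst nn_integral_0_iff_AE) (use prob_densityD(1)[OF prob_density_cube] in auto)
    then show False using prob_densityD(4)[OF prob_density_cube, of m] by simp
  qed
  with Z0 have Z: "Z > 0" by simp
  have \<tau>: "\<tau> w = indicator A w * \<phi> w / Z" for w
    by (simp add: \<tau>_def truncated_normal_dens_def \<phi>_def Z_def)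
  have [measurable]: "\<tau> \<in> borel_measurable (Rn m)" unfolding \<tau> by measurable
  show pd: "prob_density (Rn m) \<tau>"
  proof (rule prob_densityI)
    show nn: "0 \<le> \<tau> w" for w using \<phi>pos Z by (simp add: \<tau> less_imp_le)
    have "integrable (Rn m) \<tau>" unfolding \<tau> using int by simp
    then have "(\<integral>\<^sup>+ w. ennreal (\<tau> w) \<partial>Rn m) = ennreal (\<integral>w. \<tau> w \<partial>Rn m)"
      using nn by (intro nn_integral_eq_integral) auto
    also have "(\<integral>w. \<tau> w \<partial>Rn m) = 1" unfolding \<tau> using Z by (simp add: Z_def)
    finally show "(\<integral>\<^sup>+ w. ennreal (\<tau> w) \<partial>Rn m) = 1" by simp
  qed measurable
  show "0 \<le> w a" if "\<tau> w \<noteq> 0" "a < m" for w a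
    using that by (auto simp: \<tau> A indicator_def split: if_splits)
  show "\<exists>c. \<forall>w. (\<forall>a<m. 0 \<le> w a) \<longrightarrow> \<tau> w > 0 \<and>
      ln (\<tau> w) = c - quad m P w / 2 + (\<Sum>r<m. w r * (\<Sum>b<m. P $$ (r, b) * \<mu> $ b))"
  proof (intro exI[of _ "- ln D - ln Z - quad m P \<mu>' / 2"] allI impI)
    fix w :: "nat \<Rightarrow> real" assume w: "\<forall>a<m. 0 \<le> w a"
    then have eq: "\<tau> w = exp (- quad m P (\<lambda>r. w r - \<mu>' r) / 2) / D / Z" by (simp add: \<tau> A \<phi>)
    have "ln (\<tau> w) = - quad m P (\<lambda>r. w r - \<mu>' r) / 2 - ln D - ln Z"
      unfolding eq using D Z by (simp add: ln_div ln_mult)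
    also have "\<dots> = - ln D - ln Z - quad m P \<mu>' / 2 - quad m P w / 2 + (\<Sum>r<m. w r * (\<Sum>b<m. P $$ (r, b) * \<mu> $ b))"
      by (subst quad_diff[OF sym]) (auto simp: \<mu>'_def field_simps)
    finally show "0 < \<tau> w \<and> ln (\<tau> w) = - ln D - ln Z - quad m P \<mu>' / 2 - quad m P w / 2 +
        (\<Sum>r<m. w r * (\<Sum>b<m. P $$ (r, b) * \<mu> $ b))"
      using D Z by (simp add: eq)
  qed
  show "integrable (density (Rn m) (\<lambda>w. ennreal (\<tau> w))) (\<lambda>w. (w a)\<^sup>2)" if a: "a < m" for a
  proof -
    have "integrable (Rn m) (\<lambda>w. (w a)\<^sup>2 * exp (- quad m P (\<lambda>r. w r - \<mu>' r) / 2) / (D * Z))"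
      by (intro integrable_divide integrable_gaussian_moment Ppd a)
    then have "integrable (Rn m) (\<lambda>w. \<tau> w * (w a)\<^sup>2)"
      by (rule Bochner_Integration.integrable_bound)
         (use a D Z in \<open>auto simp: \<tau> \<phi> indicator_def abs_mult mult.commute\<close>)
    then show ?thesis
      using prob_densityD(2)[OF pd] a by (subst integrable_real_density) auto
  qed
qed

subsection \<open>Optimality of a single block\<close>

text \<open>Second moments bound mixed products by |x y| \<le> x^2 + y^2, which covers j = k as well
  as distinct blocks.\<close>

lemma integrable_PiM_pair:
  fixes N :: "nat \<Rightarrow> (nat \<Rightarrow> real) measure"
  assumes ps: "\<And>j. j \<in> I \<Longrightarrow> prob_space (N j)" and sets: "\<And>j. j \<in> I \<Longrightarrow> sets (N j) = sets (Rn m)"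
    and sq: "\<And>j a. j \<in> I \<Longrightarrow> a < m \<Longrightarrow> integrable (N j) (\<lambda>w. (w a)\<^sup>2)"
    and "j \<in> I" "k \<in> I" "a < m" "b < m"
  shows "integrable (Pi\<^sub>M I N) (\<lambda>w. w j a * w k b)"
proof -
  have coord: "(\<lambda>w. w a) \<in> borel_measurable (N j)" if "j \<in> I" "a < m" for j a
    using coordinate_measurable[OF that(2)] by (simp add: measurable_cong_sets[OF sets[OF that(1)] refl])
  have comp: "(\<lambda>w. w j a) \<in> borel_measurable (Pi\<^sub>M I N)" if "j \<in> I" "a < m" for j a
    by (rule measurable_compose[where f = "\<lambda>w. w j" and g = "\<lambda>v. v a",
          OF measurable_component_singleton[where M = N, OF that(1)] coord[OF that]])
  have "integrable (Pi\<^sub>M I N) (\<lambda>w. (w j a)\<^sup>2)" if "j \<in> I" "a < m" for j a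
    using integrable_PiM_component(1)[of I N j "\<lambda>w. (w a)\<^sup>2", OF ps] coord[OF that] sq[OF that] that by simp
  then show ?thesis using assms(4-7) comp by (intro integrable_mult_if_sq) auto
qed

text \<open>Conditionally on the blocks \<open>j \<noteq> i\<close>, the expectation of \<open>\<Phi>\<close> over block \<open>i\<close> depends on the law of
  that block only through its mean, which multiplies the centred blocks \<open>j \<noteq> i\<close>. Hence the
  expectation of \<open>\<Phi>\<close> does not depend on the law of block \<open>i\<close> at all.\<close>
lemma expectation_independent_of_block:
  fixes m n :: nat and N N' :: "nat \<Rightarrow> (nat \<Rightarrow> real) measure" and g :: "nat \<Rightarrow> nat \<Rightarrow> nat \<Rightarrow> nat \<Rightarrow> real"
  defines "B \<equiv> \<lambda>w j k. \<Sum>a<m. \<Sum>b<m. g j a k b * w j a * w k b"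
  assumes i: "i < n"
    and ps: "\<And>j. prob_space (N j)" "\<And>j. prob_space (N' j)"
    and sets: "\<And>j. sets (N j) = sets (Rn m)" "\<And>j. sets (N' j) = sets (Rn m)"
    and sq: "\<And>j a. j < n \<Longrightarrow> a < m \<Longrightarrow> integrable (N j) (\<lambda>w. (w a)\<^sup>2)"
      "\<And>j a. j < n \<Longrightarrow> a < m \<Longrightarrow> integrable (N' j) (\<lambda>w. (w a)\<^sup>2)"
    and same: "\<And>j. j \<noteq> i \<Longrightarrow> N' j = N j"
    and sym: "\<And>j k a b. j < n \<Longrightarrow> k < n \<Longrightarrow> a < m \<Longrightarrow> b < m \<Longrightarrow> g j a k b = g k b j a"
    and lq: "\<And>j. j < n \<Longrightarrow> j \<noteq> i \<Longrightarrow> integrable (N j) (lq j)"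
    and \<Phi>: "\<Phi> = (\<lambda>w. (\<Sum>j\<in>{..<n} - {i}. lq j (w j)) +
      (c - (\<Sum>a<m. \<Sum>b<m. g i a i b * w i a * w i b) / 2
        - (\<Sum>a<m. w i a * (\<Sum>j\<in>{..<n} - {i}. \<Sum>b<m. g i a j b * (\<integral>v. v b \<partial>N j)))) +
      (\<Sum>j<n. \<Sum>k<n. B w j k) / 2)"
  shows "integrable (Pi\<^sub>M {..<n} N) \<Phi>" "integrable (Pi\<^sub>M {..<n} N') \<Phi>"
    "(\<integral>w. \<Phi> w \<partial>Pi\<^sub>M {..<n} N) = (\<integral>w. \<Phi> w \<partial>Pi\<^sub>M {..<n} N')"
proof -
  let ?I = "{..<n} - {i}"
  define e where "e = (\<lambda>j b. \<integral>v. v b \<partial>N j)"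
  \<comment> \<open>\<open>\<Psi>\<close> collects the terms free of block i. Block i enters only
    through the products of w i a with \<open>X w a\<close>, which is linear in the other blocks and
    centred at their means.\<close>
  define \<Psi> where "\<Psi> = (\<lambda>w. (\<Sum>j\<in>?I. lq j (w j)) + c + (\<Sum>j\<in>?I. \<Sum>k\<in>?I. B w j k) / 2)"
  define X where "X = (\<lambda>w a. \<Sum>j\<in>?I. \<Sum>b<m. g i a j b * (w j b - e j b))"
  have \<Phi>_eq: "\<Phi> w = \<Psi> w + (\<Sum>a<m. w i a * X w a)" for w
  proof -
    have split: "(\<Sum>j<n. f j) = f i + (\<Sum>j\<in>?I. f j)" for f :: "nat \<Rightarrow> real"
      using i by (simp add: sum.remove)
    have swap: "B w j i = B w i j" if "j \<in> ?I" for j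
    proof -
      have "B w j i = (\<Sum>b<m. \<Sum>a<m. g j a i b * w j a * w i b)"
        unfolding B_def by (rule sum.swap)
      also have "\<dots> = B w i j"
        unfolding B_def using that i by (intro sum.cong refl) (simp add: sym[of j i])
      finally show ?thesis .
    qed
    have "(\<Sum>j<n. \<Sum>k<n. B w j k) = (\<Sum>k<n. B w i k) + (\<Sum>j\<in>?I. \<Sum>k<n. B w j k)"
      by (rule split)
    also have "(\<Sum>k<n. B w i k) = B w i i + (\<Sum>j\<in>?I. B w i j)" by (rule split)
    also have "(\<Sum>j\<in>?I. \<Sum>k<n. B w j k) = (\<Sum>j\<in>?I. B w i j) + (\<Sum>j\<in>?I. \<Sum>k\<in>?I. B w j k)"
    proof -
      have "(\<Sum>j\<in>?I. \<Sum>k<n. B w j k) = (\<Sum>j\<in>?I. B w i j + (\<Sum>k\<in>?I. B w j k))"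
      proof (rule sum.cong[OF refl])
        fix j assume "j \<in> ?I"
        then show "(\<Sum>k<n. B w j k) = B w i j + (\<Sum>k\<in>?I. B w j k)" using split[of "B w j"] swap by simp
      qed
      then show ?thesis by (simp only: sum.distrib)
    qed
    \<comment> \<open>Halved, B w i i cancels the quadratic term of the truncated normal's
      logarithm, and the doubled cross terms become single ones.\<close>
    finally have BB: "(\<Sum>j<n. \<Sum>k<n. B w j k) =
        B w i i + 2 * (\<Sum>j\<in>?I. B w i j) + (\<Sum>j\<in>?I. \<Sum>k\<in>?I. B w j k)" by simp
    have "(\<Sum>a<m. w i a * X w a) = (\<Sum>a<m. w i a * (\<Sum>j\<in>?I. \<Sum>b<m. g i a j b * w j b)) -
      (\<Sum>a<m. w i a * (\<Sum>j\<in>?I. \<Sum>b<m. g i a j b * e j b))"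
      by (simp only: X_def right_diff_distrib sum_subtractf)
    also have "(\<Sum>a<m. w i a * (\<Sum>j\<in>?I. \<Sum>b<m. g i a j b * w j b)) =
      (\<Sum>a<m. \<Sum>j\<in>?I. \<Sum>b<m. g i a j b * w i a * w j b)"
      by (simp only: sum_distrib_left mult.assoc mult.left_commute)
    also have "\<dots> = (\<Sum>j\<in>?I. B w i j)"
      unfolding B_def by (rule sum.swap)
    finally show ?thesis
      unfolding \<Phi> \<Psi>_def BB by (simp add: B_def e_def add_divide_distrib)
  qed
  \<comment> \<open>Proved once for a family Q that agrees with N away from i. The value on the
    right does not mention Q i, so N and N' give the same one.\<close>
  have both: "integrable (Pi\<^sub>M {..<n} Q) \<Phi> \<and> (\<integral>w. \<Phi> w \<partial>Pi\<^sub>M {..<n} Q) = (\<integral>x. \<Psi> x \<partial>Pi\<^sub>M ?I N)"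
    if Q: "\<And>j. prob_space (Q j)" and Qs: "\<And>j. sets (Q j) = sets (Rn m)"
      and Qsq: "\<And>j a. j < n \<Longrightarrow> a < m \<Longrightarrow> integrable (Q j) (\<lambda>w. (w a)\<^sup>2)"
      and QN: "\<And>j. j \<noteq> i \<Longrightarrow> Q j = N j" for Q
  proof -
    interpret Q: product_sigma_finite Q
      using Q by (simp add: product_sigma_finite_def prob_space_imp_sigma_finite)
    have PQ: "Pi\<^sub>M ?I Q = Pi\<^sub>M ?I N" using QN by (intro PiM_cong) auto
    have coord: "(\<lambda>w. w a) \<in> borel_measurable (Q j)" if "a < m" for j a
      using coordinate_measurable[OF that] by (simp add: measurable_cong_sets[OF Qs refl])
    have lin: "integrable (Q j) (\<lambda>w. w a)" if "j < n" "a < m" for j a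
      using prob_space.integrable_if_sq[OF Q Qsq coord] that by blast
    have lqQ: "integrable (Q j) (lq j)" if "j \<in> ?I" for j using lq QN that by auto
    have int1: "integrable (Pi\<^sub>M J Q) (\<lambda>w. lq j (w j))" if "j \<in> J" "j \<in> ?I" for j J
      using integrable_PiM_component(1)[of J Q j "lq j"] Q lqQ that by auto
    have int2: "integrable (Pi\<^sub>M J Q) (\<lambda>w. w j a)" if "j \<in> J" "j < n" "a < m" for j J a
      using integrable_PiM_component(1)[of J Q j "\<lambda>w. w a"] Q lin coord that by auto
    have int3: "integrable (Pi\<^sub>M J Q) (\<lambda>w. w j a * w k b)"
      if "J \<subseteq> {..<n}" "j \<in> J" "k \<in> J" "a < m" "b < m" for j k J a b
      using that by (intro integrable_PiM_pair[where m = m] Q Qs Qsq) auto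
    have J_prob: "prob_space (Pi\<^sub>M J Q)" for J by (intro prob_space_PiM Q)
    then have fin: "finite_measure (Pi\<^sub>M J Q)" for J by (simp add: prob_space.finite_measure)
    have cst: "integrable (Pi\<^sub>M J Q) (\<lambda>_. r)" for J and r :: real
      using finite_measure.integrable_const[OF fin] .
    have int\<Psi>: "integrable (Pi\<^sub>M J Q) \<Psi>" if "J \<subseteq> {..<n}" "?I \<subseteq> J" for J
      unfolding \<Psi>_def B_def mult.assoc using that
      by (intro Bochner_Integration.integrable_add Bochner_Integration.integrable_sum integrable_divide
          integrable_mult_right int1 int3 cst) auto
    have intc: "integrable (Pi\<^sub>M {..<n} Q) (\<lambda>w. w i a * X w a)" if "a < m" for a
    proof -
      have "(\<lambda>w. w i a * X w a) = (\<lambda>w. \<Sum>j\<in>?I. \<Sum>b<m. g i a j b * (w i a * w j b) - (g i a j b * e j b) * w i a)"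
        by (simp only: X_def sum_distrib_left right_diff_distrib mult.assoc mult.left_commute mult.commute)
      then show ?thesis using i that
        by (simp only:) (intro Bochner_Integration.integrable_sum Bochner_Integration.integrable_diff
            integrable_mult_right int2 int3; simp)
    qed
    have int\<Phi>: "integrable (Pi\<^sub>M {..<n} Q) \<Phi>"
      unfolding \<Phi>_eq using intc
      by (intro Bochner_Integration.integrable_add Bochner_Integration.integrable_sum int\<Psi>) auto
    have ins: "{..<n} = insert i ?I" using i by auto
    \<comment> \<open>The inner integral of Fubini's theorem: \<open>\<Psi>\<close> and
      \<open>X\<close> ignore block i, so only its first moments survive.\<close>
    have inner: "(\<integral>y. \<Phi> (x(i := y)) \<partial>Q i) = \<Psi> x + (\<Sum>a<m. (\<integral>y. y a \<partial>Q i) * X x a)" for x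
    proof -
      interpret Qi: prob_space "Q i" by (rule Q)
      have "\<Psi> (x(i := y)) = \<Psi> x" for y
        unfolding \<Psi>_def B_def by (intro arg_cong2[where f = plus] arg_cong2[where f = divide] sum.cong refl) auto
      moreover have "X (x(i := y)) a = X x a" for y a
        unfolding X_def by (intro sum.cong refl) auto
      ultimately have "\<Phi> (x(i := y)) = \<Psi> x + (\<Sum>a<m. y a * X x a)" for y
        by (simp add: \<Phi>_eq)
      then have "(\<integral>y. \<Phi> (x(i := y)) \<partial>Q i) = (\<integral>y. \<Psi> x + (\<Sum>a<m. y a * X x a) \<partial>Q i)"
        by (simp only:)
      also have "\<dots> = (\<integral>y. \<Psi> x \<partial>Q i) + (\<integral>y. (\<Sum>a<m. y a * X x a) \<partial>Q i)"
        using lin[OF i]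
        by (intro Bochner_Integration.integral_add Bochner_Integration.integrable_sum integrable_mult_left) auto
      also have "(\<integral>y. (\<Sum>a<m. y a * X x a) \<partial>Q i) = (\<Sum>a<m. \<integral>y. y a * X x a \<partial>Q i)"
        using lin[OF i] by (intro Bochner_Integration.integral_sum integrable_mult_left) auto
      finally show ?thesis by (simp add: Qi.prob_space del: fun_upd_apply)
    qed
    \<comment> \<open>Away from i the laws are those of N, whose means are e, so every summand of X
      is centred.\<close>
    have X0: "integrable (Pi\<^sub>M ?I Q) (\<lambda>x. X x a) \<and> (\<integral>x. X x a \<partial>Pi\<^sub>M ?I Q) = 0" if "a < m" for a
    proof -
      have int: "integrable (Pi\<^sub>M ?I Q) (\<lambda>x. g i a j b * (x j b - e j b))" if "j \<in> ?I" "b < m" for j b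
        using that by (intro integrable_mult_right Bochner_Integration.integrable_diff int2 cst) auto
      have zero: "(\<integral>x. g i a j b * (x j b - e j b) \<partial>Pi\<^sub>M ?I Q) = 0" if "j \<in> ?I" "b < m" for j b
      proof -
        have "(\<integral>x. x j b \<partial>Pi\<^sub>M ?I Q) = e j b"
          using integrable_PiM_component(2)[of ?I Q j "\<lambda>w. w b", OF Q that(1) coord[OF that(2)]] that(1) QN
          unfolding e_def by (metis Diff_iff singletonI)
        then have "(\<integral>x. x j b - e j b \<partial>Pi\<^sub>M ?I Q) = 0"
          using int2[of j ?I b] that cst prob_space.prob_space[OF J_prob]
          by (subst Bochner_Integration.integral_diff) auto
        then show ?thesis by simp
      qed
      have int': "integrable (Pi\<^sub>M ?I Q) (\<lambda>x. \<Sum>b<m. g i a j b * (x j b - e j b))" if "j \<in> ?I" for j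
        using that by (intro Bochner_Integration.integrable_sum int) auto
      have zero': "(\<integral>x. (\<Sum>b<m. g i a j b * (x j b - e j b)) \<partial>Pi\<^sub>M ?I Q) = 0" if "j \<in> ?I" for j
      proof -
        have "(\<integral>x. (\<Sum>b<m. g i a j b * (x j b - e j b)) \<partial>Pi\<^sub>M ?I Q) =
            (\<Sum>b<m. \<integral>x. g i a j b * (x j b - e j b) \<partial>Pi\<^sub>M ?I Q)"
          by (rule Bochner_Integration.integral_sum) (rule int[OF that], simp)
        also have "\<dots> = 0" by (intro sum.neutral ballI zero[OF that]) simp
        finally show ?thesis .
      qed
      have "integrable (Pi\<^sub>M ?I Q) (\<lambda>x. X x a)"
        unfolding X_def by (intro Bochner_Integration.integrable_sum int')
      moreover have "(\<integral>x. X x a \<partial>Pi\<^sub>M ?I Q) = 0"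
      proof -
        have "(\<integral>x. X x a \<partial>Pi\<^sub>M ?I Q) = (\<Sum>j\<in>?I. \<integral>x. (\<Sum>b<m. g i a j b * (x j b - e j b)) \<partial>Pi\<^sub>M ?I Q)"
          unfolding X_def by (rule Bochner_Integration.integral_sum) (rule int')
        also have "\<dots> = 0" by (intro sum.neutral ballI zero')
        finally show ?thesis .
      qed
      ultimately show ?thesis by blast
    qed
    have "integrable (Pi\<^sub>M (insert i ?I) Q) \<Phi>" by (subst ins[symmetric]) (rule int\<Phi>)
    then have "(\<integral>w. \<Phi> w \<partial>Pi\<^sub>M (insert i ?I) Q) = (\<integral>x. \<integral>y. \<Phi> (x(i := y)) \<partial>Q i \<partial>Pi\<^sub>M ?I Q)"
      by (intro Q.product_integral_insert) auto
    then have "(\<integral>w. \<Phi> w \<partial>Pi\<^sub>M {..<n} Q) = (\<integral>x. \<integral>y. \<Phi> (x(i := y)) \<partial>Q i \<partial>Pi\<^sub>M ?I Q)"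
      by (subst (asm) ins[symmetric])
    also have "\<dots> = (\<integral>x. \<Psi> x \<partial>Pi\<^sub>M ?I Q) + (\<Sum>a<m. (\<integral>y. y a \<partial>Q i) * (\<integral>x. X x a \<partial>Pi\<^sub>M ?I Q))"
      unfolding inner using X0 int\<Psi>[of ?I]
      by (subst Bochner_Integration.integral_add) (auto intro!: Bochner_Integration.integrable_sum)
    also have "\<dots> = (\<integral>x. \<Psi> x \<partial>Pi\<^sub>M ?I N)" using X0 by (simp add: PQ)
    finally show ?thesis using int\<Phi> by simp
  qed
  show "integrable (Pi\<^sub>M {..<n} N) \<Phi>" "integrable (Pi\<^sub>M {..<n} N') \<Phi>"
    "(\<integral>w. \<Phi> w \<partial>Pi\<^sub>M {..<n} N) = (\<integral>w. \<Phi> w \<partial>Pi\<^sub>M {..<n} N')"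
    using both[OF ps(1) sets(1) sq(1)] both[OF ps(2) sets(2) sq(2) same] by simp_all
qed

text \<open>A density is almost surely positive under its own law, so t j > 0 and P j hold almost
  surely in each independent block. The law of the blocks under q carries this back to the points
  where q is not 0.\<close>

lemma AE_factorizes:
  assumes fac: "factorizes n m d q t" and t: "\<And>j. prob_density (Rn m) (t j)"
    and P: "\<And>j. j < n \<Longrightarrow> AE w in Rn m. t j w > 0 \<longrightarrow> P j w"
  shows "AE x in Rn d \<Otimes>\<^sub>M Rn (n * m). q x \<noteq> 0 \<longrightarrow>
    (\<forall>j<n. 0 < t j (zblock m j (snd x)) \<and> P j (zblock m j (snd x)))"
proof -
  have q: "prob_density (Rn d \<Otimes>\<^sub>M Rn (n * m)) q" using fac by (simp add: factorizes_def)
  note [measurable] = prob_densityD(1)[OF q] prob_densityD(1)[OF t]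
  have comp: "AE w in law m t j. 0 < t j w \<and> P j w" if "j < n" for j
    using P[OF that] by (subst AE_density) auto
  have "AE w in Pi\<^sub>M {..<n} (law m t). 0 < t j (w j) \<and> P j (w j)" if "j < n" for j
  proof (rule AE_PiM_component[where I = "{..<n}" and M = "law m t" and i = j and P = "\<lambda>w. 0 < t j w \<and> P j w"])
    show "prob_space (law m t i)" for i by (rule prob_densityD(3)[OF t])
    show "AE w in law m t j. 0 < t j w \<and> P j w" by (rule comp[OF that])
  qed (use that in simp)
  then have "AE w in Pi\<^sub>M {..<n} (law m t). \<forall>j\<in>{..<n}. 0 < t j (w j) \<and> P j (w j)"
    by (subst AE_finite_all) auto
  then have *: "AE w in distr (density (Rn d \<Otimes>\<^sub>M Rn (n * m)) (\<lambda>x. ennreal (q x))) (Rblocks n m)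
      (\<lambda>x. blocks n m (snd x)). \<forall>j\<in>{..<n}. 0 < t j (w j) \<and> P j (w j)"
    by (simp only: distr_factorizes[OF fac t])
  have "AE x in density (Rn d \<Otimes>\<^sub>M Rn (n * m)) (\<lambda>x. ennreal (q x)).
      \<forall>j\<in>{..<n}. 0 < t j (blocks n m (snd x) j) \<and> P j (blocks n m (snd x) j)"
    by (rule AE_distrD[OF _ *]) simp
  then have "AE x in Rn d \<Otimes>\<^sub>M Rn (n * m). 0 < ennreal (q x) \<longrightarrow>
      (\<forall>j\<in>{..<n}. 0 < t j (blocks n m (snd x) j) \<and> P j (blocks n m (snd x) j))"
    by (subst (asm) AE_density) auto
  moreover have "AE x in Rn d \<Otimes>\<^sub>M Rn (n * m). 0 \<le> q x" using prob_densityD(2)[OF q] by auto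
  ultimately show ?thesis
    by eventually_elim (auto simp: blocks_def less_le)
qed

lemma integral_factorizes:
  fixes f :: "(nat \<Rightarrow> nat \<Rightarrow> real) \<Rightarrow> real"
  assumes fac: "factorizes n m d q t" and t: "\<And>j. prob_density (Rn m) (t j)"
    and f: "f \<in> borel_measurable (Rblocks n m)"
  shows "integrable (Rn d \<Otimes>\<^sub>M Rn (n * m)) (\<lambda>x. q x * f (blocks n m (snd x))) \<longleftrightarrow>
      integrable (Pi\<^sub>M {..<n} (law m t)) f" (is ?int)
    and "(\<integral>x. q x * f (blocks n m (snd x)) \<partial>(Rn d \<Otimes>\<^sub>M Rn (n * m))) = (\<integral>w. f w \<partial>Pi\<^sub>M {..<n} (law m t))" (is ?eq)
proof -
  let ?M = "Rn d \<Otimes>\<^sub>M Rn (n * m)" and ?E = "Rblocks n m"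
  have q: "prob_density ?M q" using fac by (simp add: factorizes_def)
  note [measurable] = prob_densityD(1)[OF q] f
  have nn: "AE x in ?M. 0 \<le> q x" using prob_densityD(2)[OF q] by auto
  have meas: "(\<lambda>x. blocks n m (snd x)) \<in> density ?M (\<lambda>x. ennreal (q x)) \<rightarrow>\<^sub>M ?E" by simp
  show ?int
    unfolding distr_factorizes[OF fac t, symmetric] integrable_distr_eq[OF meas f]
    using nn by (subst integrable_real_density) auto
  show ?eq
    unfolding distr_factorizes[OF fac t, symmetric] integral_distr[OF meas f]
    using nn by (subst integral_real_density) auto
qed

lemma integrable_factorizes_block:
  fixes f :: "(nat \<Rightarrow> real) \<Rightarrow> real"
  assumes fac: "factorizes n m d q t" and t: "\<And>j. prob_density (Rn m) (t j)"
    and j: "j < n" and f: "f \<in> borel_measurable (Rn m)"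
  shows "integrable (Rn d \<Otimes>\<^sub>M Rn (n * m)) (\<lambda>x. q x * f (zblock m j (snd x))) \<longleftrightarrow> integrable (law m t j) f"
proof -
  have "(\<lambda>w. f (w j)) \<in> borel_measurable (Rblocks n m)"
    using j by (intro measurable_compose[OF measurable_component_singleton[where M = "\<lambda>_. Rn m"] f]) auto
  from integral_factorizes(1)[OF fac t this]
  have "integrable (Rn d \<Otimes>\<^sub>M Rn (n * m)) (\<lambda>x. q x * f (zblock m j (snd x))) \<longleftrightarrow>
      integrable (Pi\<^sub>M {..<n} (law m t)) (\<lambda>w. f (w j))"
    using j by (simp add: blocks_def)
  also have "\<dots> \<longleftrightarrow> integrable (law m t j) f"
    by (rule integrable_PiM_component(1)) (use j f prob_densityD(3)[OF t] in auto)
  finally show ?thesis .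
qed

text \<open>Here \<open>k\<close> is the conditional density of \<open>\<beta>\<close> given \<open>z\<close>, and \<open>G\<close> the precision matrix of the
  untruncated marginal of \<open>z\<close>.\<close>
locale gaussian_posterior =
  fixes n m d :: nat and k :: "(nat \<Rightarrow> real) \<times> (nat \<Rightarrow> real) \<Rightarrow> real" and G :: "real mat" and K :: real
    and post :: "(nat \<Rightarrow> real) \<times> (nat \<Rightarrow> real) \<Rightarrow> real"
  assumes k_measurable[measurable]: "k \<in> borel_measurable (Rn d \<Otimes>\<^sub>M Rn (n * m))"
    and k_pos: "0 < k x"
    and k_integral: "z \<in> space (Rn (n * m)) \<Longrightarrow> (\<integral>\<^sup>+ \<beta>. ennreal (k (\<beta>, z)) \<partial>Rn d) = 1"
    and G: "positive_definite (n * m) G"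
    and K: "K > 0"
    and post_eq: "post = (\<lambda>(\<beta>, z). k (\<beta>, z) *
      (K * of_bool (\<forall>r<n * m. 0 < z r) * exp (- quad (n * m) G z / 2)))"
    and prob_density_post: "prob_density (Rn d \<Otimes>\<^sub>M Rn (n * m)) post"
begin

abbreviation M where "M \<equiv> Rn d \<Otimes>\<^sub>M Rn (n * m)"

text \<open>Using the posterior's own conditional density \<open>k\<close> of \<beta> makes the
  ratio to \<open>post\<close> a function of z alone.\<close>

definition cand :: "(nat \<Rightarrow> (nat \<Rightarrow> real) \<Rightarrow> real) \<Rightarrow> (nat \<Rightarrow> real) \<times> (nat \<Rightarrow> real) \<Rightarrow> real" where
  "cand t = (\<lambda>(\<beta>, z). k (\<beta>, z) * (\<Prod>i<n. t i (zblock m i z)))"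

text \<open>\<open>lt j\<close> stands for the logarithm of block density j but is a separate
  argument: it may be a formula on all of space that agrees with the logarithm only where the
  density is positive, such as the polynomial of a truncated normal.\<close>

definition log_ratio :: "(nat \<Rightarrow> (nat \<Rightarrow> real) \<Rightarrow> real) \<Rightarrow> (nat \<Rightarrow> nat \<Rightarrow> real) \<Rightarrow> real" where
  "log_ratio lt w = (\<Sum>j<n. lt j (w j)) - ln K + quad (n * m) G (flatten n m w) / 2"

lemma G_sym: "r < n * m \<Longrightarrow> c < n * m \<Longrightarrow> G $$ (r, c) = G $$ (c, r)"
  using G unfolding positive_definite_iff_quad by blast

lemma sigma_finite_M: "sigma_finite_measure M"
  by (rule sigma_finite_pair_Rn)

lemma post_pos_iff: "0 < post x \<longleftrightarrow> (\<forall>r<n * m. 0 < snd x r)"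
  using k_pos K by (cases x) (auto simp: post_eq zero_less_mult_iff)

lemma post_nonneg: "0 \<le> post x"
  using k_pos K by (cases x) (auto simp: post_eq less_imp_le)

lemma post_measurable[measurable]: "post \<in> borel_measurable M"
  by (rule prob_densityD(1)[OF prob_density_post])

lemma nn_integral_k:
  assumes [measurable]: "f \<in> borel_measurable (Rn (n * m))"
  shows "(\<integral>\<^sup>+ x. ennreal (k x) * f (snd x) \<partial>M) = (\<integral>\<^sup>+ z. f z \<partial>Rn (n * m))"
proof -
  have "(\<integral>\<^sup>+ x. ennreal (k x) * f (snd x) \<partial>M) = (\<integral>\<^sup>+ z. \<integral>\<^sup>+ \<beta>. ennreal (k (\<beta>, z)) * f z \<partial>Rn d \<partial>Rn (n * m))"
    by (subst Rn_pair.nn_integral_snd[symmetric]) simp_all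
  also have "\<dots> = (\<integral>\<^sup>+ z. f z \<partial>Rn (n * m))"
    by (intro nn_integral_cong) (subst nn_integral_multc, simp_all add: k_integral)
  finally show ?thesis .
qed

lemma prod_block_nonneg:
  assumes "\<And>j. prob_density (Rn m) (t j)" "z \<in> space (Rn (n * m))"
  shows "0 \<le> (\<Prod>i<n. t i (zblock m i z))"
  using prob_densityD(2)[OF prob_density_prod_dens[OF assms(1)] assms(2)] .

lemma prob_density_cand:
  assumes t: "\<And>j. prob_density (Rn m) (t j)"
  shows "prob_density M (cand t)"
proof -
  let ?T = "\<lambda>z. \<Prod>i<n. t i (zblock m i z)"
  note T = prob_density_prod_dens[OF t, of n]
  note [measurable] = prob_densityD(1)[OF T]
  have eq: "cand t = (\<lambda>x. k x * ?T (snd x))" by (auto simp: cand_def)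
  show ?thesis
  proof (rule prob_densityI)
    show "cand t \<in> borel_measurable M" unfolding eq by measurable
    show "0 \<le> cand t x" if "x \<in> space M" for x
      unfolding eq using that k_pos[of x]
      by (intro mult_nonneg_nonneg prod_block_nonneg[OF t]) (auto simp: space_pair_measure less_imp_le)
    have "(\<integral>\<^sup>+ x. ennreal (cand t x) \<partial>M) = (\<integral>\<^sup>+ x. ennreal (k x) * ennreal (?T (snd x)) \<partial>M)"
      unfolding eq using k_pos
      by (intro nn_integral_cong ennreal_mult prod_block_nonneg[OF t]) (auto simp: space_pair_measure less_imp_le)
    also have "\<dots> = (\<integral>\<^sup>+ z. ennreal (?T z) \<partial>Rn (n * m))" by (rule nn_integral_k) simp
    also have "\<dots> = 1" by (rule prob_densityD(4)[OF T])
    finally show "(\<integral>\<^sup>+ x. ennreal (cand t x) \<partial>M) = 1" .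
  qed
qed

lemma integral_k: "z \<in> space (Rn (n * m)) \<Longrightarrow> (\<integral>\<beta>. k (\<beta>, z) \<partial>Rn d) = 1"
  using k_integral[of z] k_pos by (subst integral_eq_nn_integral) (auto simp: less_imp_le)

lemma factorizes_cand:
  assumes t: "\<And>j. prob_density (Rn m) (t j)"
  shows "factorizes n m d (cand t) t"
  unfolding factorizes_def
proof (intro conjI allI impI)
  show "prob_density M (cand t)" by (rule prob_density_cand[OF t])
  show "AE (\<beta>, z) in M. cand t (\<beta>, z) = cond_beta_dens d (cand t) \<beta> z * (\<Prod>i<n. t i (zblock m i z))"
  proof (rule AE_I2, clarify)
    fix \<beta> z assume "(\<beta>, z) \<in> space M"
    then have z: "z \<in> space (Rn (n * m))" by (simp add: space_pair_measure)
    show "cand t (\<beta>, z) = cond_beta_dens d (cand t) \<beta> z * (\<Prod>i<n. t i (zblock m i z))"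
      by (simp add: cond_beta_dens_def cand_def integral_k[OF z])
  qed
qed (rule t)

text \<open>The factor \<open>k\<close> cancels in the ratio, leaving the block densities over K
  times the Gaussian factor of z.\<close>

lemma log_ratio_cand:
  assumes "x \<in> space M"
    and "\<forall>j<n. 0 < t j (zblock m j (snd x)) \<and> ((\<forall>a<m. 0 < zblock m j (snd x) a) \<and>
      ln (t j (zblock m j (snd x))) = lt j (zblock m j (snd x)))"
  shows "0 < post x" "0 < cand t x" "ln (cand t x / post x) = log_ratio lt (blocks n m (snd x))"
proof -
  obtain \<beta> z where x: "x = (\<beta>, z)" by (cases x)
  have z: "z \<in> space (Rn (n * m))" using assms(1) by (simp add: x space_pair_measure)
  have zpos: "0 < z r" if "r < n * m" for r
  proof -
    have "r div m < n" "r mod m < m" using block_index_div_mod[OF that] by auto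
    then have "0 < zblock m (r div m) z (r mod m)" using assms(2) by (simp add: x)
    then show ?thesis using \<open>r mod m < m\<close> by (simp add: zblock_def)
  qed
  then show "0 < post x" by (simp add: post_pos_iff x)
  have T: "0 < (\<Prod>j<n. t j (zblock m j z))" using assms(2) by (intro prod_pos) (auto simp: x)
  then show "0 < cand t x" using k_pos[of x] by (simp add: cand_def x)
  have "cand t x / post x = (\<Prod>j<n. t j (zblock m j z)) / (K * exp (- quad (n * m) G z / 2))"
    using zpos k_pos[of x] by (simp add: cand_def post_eq x)
  also have "ln \<dots> = ln (\<Prod>j<n. t j (zblock m j z)) - (ln K - quad (n * m) G z / 2)"
    using T K by (subst ln_div) (auto simp: ln_mult simp del: prod_zero_iff)
  also have "ln (\<Prod>j<n. t j (zblock m j z)) = (\<Sum>j<n. ln (t j (zblock m j z)))"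
    using assms(2) by (intro ln_prod) (auto simp: x)
  also have "\<dots> = (\<Sum>j<n. lt j (blocks n m z j))"
    using assms(2) by (intro sum.cong refl) (auto simp: x blocks_def)
  finally show "ln (cand t x / post x) = log_ratio lt (blocks n m (snd x))"
    by (simp add: log_ratio_def x flatten_blocks[OF z])
qed

lemma log_ratio_measurable:
  assumes "\<And>j. j < n \<Longrightarrow> lt j \<in> borel_measurable (Rn m)"
  shows "log_ratio lt \<in> borel_measurable (Rblocks n m)"
proof -
  have [measurable]: "(\<lambda>w. lt j (w j)) \<in> borel_measurable (Rblocks n m)" if "j \<in> {..<n}" for j
    using that assms by (intro measurable_compose[OF measurable_component_singleton]) auto
  show ?thesis unfolding log_ratio_def by measurable
qed

lemma KL_factorizing:
  assumes "factorizes n m d q t"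
  shows "KL M q post = (if (AE x in M. post x = 0 \<longrightarrow> q x = 0) \<and> integrable M (\<lambda>x. q x * ln (q x / post x))
     then ereal (\<integral>x. q x * ln (q x / post x) \<partial>M) else \<infinity>)"
  using assms by (intro KL_eq_integral sigma_finite_M prob_density_post) (simp add: factorizes_def)

text \<open>Only points where the candidate is positive contribute, and there the logarithm of the
  ratio is \<open>log_ratio\<close>. The integral over (\<beta>, z) thus becomes an expectation
  under independent blocks.\<close>

lemma KL_cand:
  assumes t: "\<And>j. prob_density (Rn m) (t j)"
    and supp: "\<And>j. j < n \<Longrightarrow> AE w in Rn m. 0 < t j w \<longrightarrow> (\<forall>a<m. 0 < w a) \<and> ln (t j w) = lt j w"
    and meas: "\<And>j. j < n \<Longrightarrow> lt j \<in> borel_measurable (Rn m)"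
    and int: "integrable (Pi\<^sub>M {..<n} (law m t)) (log_ratio lt)"
  shows "KL M (cand t) post = ereal (\<integral>w. log_ratio lt w \<partial>Pi\<^sub>M {..<n} (law m t))"
proof -
  note fac = factorizes_cand[OF t]
  have F: "log_ratio lt \<in> borel_measurable (Rblocks n m)" by (rule log_ratio_measurable[OF meas])
  note [measurable] = F prob_densityD(1)[OF prob_density_cand[OF t]]
  have AEw: "AE x in M. x \<in> space M" by simp
  have supp': "AE x in M. cand t x \<noteq> 0 \<longrightarrow> (\<forall>j<n. 0 < t j (zblock m j (snd x)) \<and>
      ((\<forall>a<m. 0 < zblock m j (snd x) a) \<and> ln (t j (zblock m j (snd x))) = lt j (zblock m j (snd x))))"
    by (rule AE_factorizes[where P = "\<lambda>j w. (\<forall>a<m. 0 < w a) \<and> ln (t j w) = lt j w"]) (rule fac t supp; assumption?)+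
  have 1: "AE x in M. post x = 0 \<longrightarrow> cand t x = 0"
    using supp' AEw
  proof eventually_elim
    case (elim x)
    show ?case
    proof (cases "cand t x = 0")
      case False
      with elim(1) have *: "\<forall>j<n. 0 < t j (zblock m j (snd x)) \<and> ((\<forall>a<m. 0 < zblock m j (snd x) a) \<and>
          ln (t j (zblock m j (snd x))) = lt j (zblock m j (snd x)))" by (rule mp)
      show ?thesis using log_ratio_cand(1)[where t = t and lt = lt, OF elim(2) *] by simp
    qed simp
  qed
  have 2: "AE x in M. cand t x * ln (cand t x / post x) = cand t x * log_ratio lt (blocks n m (snd x))"
    using supp' AEw
  proof eventually_elim
    case (elim x)
    show ?case
    proof (cases "cand t x = 0")
      case False
      with elim(1) have *: "\<forall>j<n. 0 < t j (zblock m j (snd x)) \<and> ((\<forall>a<m. 0 < zblock m j (snd x) a) \<and>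
          ln (t j (zblock m j (snd x))) = lt j (zblock m j (snd x)))" by (rule mp)
      show ?thesis by (simp only: log_ratio_cand(3)[where t = t and lt = lt, OF elim(2) *])
    qed simp
  qed
  have "integrable M (\<lambda>x. cand t x * ln (cand t x / post x)) \<longleftrightarrow>
      integrable M (\<lambda>x. cand t x * log_ratio lt (blocks n m (snd x)))"
    using 2 by (intro integrable_cong_AE) auto
  then have 3: "integrable M (\<lambda>x. cand t x * ln (cand t x / post x))"
    using int integral_factorizes(1)[OF fac t F] by simp
  have "(\<integral>x. cand t x * ln (cand t x / post x) \<partial>M) = (\<integral>x. cand t x * log_ratio lt (blocks n m (snd x)) \<partial>M)"
    using 2 by (intro integral_cong_AE) auto
  then show ?thesis
    using 1 3 integral_factorizes(2)[OF fac t F] by (simp add: KL_factorizing[OF fac])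
qed

end

text \<open>Tests the form of G on vectors that vanish outside block i.\<close>

lemma positive_definite_block:
  assumes G: "positive_definite (n * m) G" and i: "i < n"
  shows "positive_definite m (block m G i i)"
  unfolding positive_definite_iff_quad
proof (intro conjI allI impI)
  show "block m G i i \<in> carrier_mat m m" by (simp add: block_def)
  show "block m G i i $$ (r, c) = block m G i i $$ (c, r)" if "r < m" "c < m" for r c
    using G that block_index_less[OF i] unfolding positive_definite_iff_quad by (simp add: block_def)
  fix u :: "nat \<Rightarrow> real" assume "\<exists>r<m. u r \<noteq> 0"
  then obtain r where r: "r < m" "u r \<noteq> 0" by blast
  define w where "w = (\<lambda>j. if j = i then u else (\<lambda>_. 0))"
  have "flatten n m w (i * m + r) \<noteq> 0" using r i by (simp add: flatten_def w_def block_index_less)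
  then have "0 < quad (n * m) G (flatten n m w)"
    using G block_index_less[OF i r(1)] unfolding positive_definite_iff_quad by blast
  also have "quad (n * m) G (flatten n m w) = (\<Sum>a<m. \<Sum>b<m. G $$ (i * m + a, i * m + b) * u a * u b)"
  proof -
    have "quad (n * m) G (flatten n m w) = (\<Sum>j<n. \<Sum>k<n. if j = i then if k = i then
        \<Sum>a<m. \<Sum>b<m. G $$ (i * m + a, i * m + b) * u a * u b else 0 else 0)"
      unfolding quad_flatten by (intro sum.cong refl) (auto simp: w_def)
    also have "\<dots> = (\<Sum>j<n. if j = i then \<Sum>k<n. if k = i then
        \<Sum>a<m. \<Sum>b<m. G $$ (i * m + a, i * m + b) * u a * u b else 0 else 0)"
      by (intro sum.cong refl) auto
    also have "\<dots> = (\<Sum>a<m. \<Sum>b<m. G $$ (i * m + a, i * m + b) * u a * u b)"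
      using i by (simp add: sum.delta)
    finally show ?thesis .
  qed
  also have "\<dots> = quad m (block m G i i) u" by (simp add: quad_def block_def)
  finally show "0 < quad m (block m G i i) u" .
qed

lemma sum_sq_blocks: "(\<Sum>r<n * m. (z r)\<^sup>2) = (\<Sum>i<n. \<Sum>a<m. (zblock m i z a)\<^sup>2)"
  unfolding sum_blocks by (simp add: zblock_def)

section \<open>Integrability forced by a finite divergence\<close>

context gaussian_posterior
begin

text \<open>\<open>k\<close> integrates to 1 in \<beta> and the Gaussian factor splits over the
  blocks, so the integral is a finite product in which factor j carries f.\<close>

lemma integrable_k_exp:
  assumes "e > 0" and j: "j < n" and [measurable]: "f \<in> borel_measurable (Rn m)" and nn: "\<And>w. w \<in> space (Rn m) \<Longrightarrow> 0 \<le> f w"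
    and int: "integrable (Rn m) (\<lambda>w. exp (- e * (\<Sum>a<m. (w a)\<^sup>2)) * f w)"
  shows "integrable M (\<lambda>x. k x * (exp (- e * (\<Sum>r<n * m. (snd x r)\<^sup>2)) * f (zblock m j (snd x))))"
proof (rule integrableI_nonneg)
  let ?g = "\<lambda>z. exp (- e * (\<Sum>r<n * m. (z r)\<^sup>2)) * f (zblock m j z)"
  let ?e = "\<lambda>i w. exp (- e * (\<Sum>a<m. (w a)\<^sup>2)) * (if i = j then f w else 1)"
  note [measurable] = measurable_zblock[OF j]
  have e_int: "integrable (Rn m) (?e i)" for i
    using int integrable_exp_neg_sq[OF assms(1), of m "\<lambda>_. 0"] by (cases "i = j") auto
  have e_nn: "0 \<le> ?e i w" if "w \<in> space (Rn m)" for i w using nn[OF that] by auto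
  show "(\<lambda>x. k x * ?g (snd x)) \<in> borel_measurable M"
    by measurable
  show "AE x in M. 0 \<le> k x * ?g (snd x)"
    using k_pos measurable_space[OF measurable_zblock[OF j, of m]] nn
    by (intro AE_I2 mult_nonneg_nonneg) (auto simp: space_pair_measure less_imp_le)
  have "(\<integral>\<^sup>+ x. ennreal (k x * ?g (snd x)) \<partial>M) =
     (\<integral>\<^sup>+ x. ennreal (k x) * ennreal (?g (snd x)) \<partial>M)"
    using k_pos measurable_space[OF measurable_zblock[OF j, of m]] nn
    by (intro nn_integral_cong ennreal_mult mult_nonneg_nonneg) (auto simp: space_pair_measure less_imp_le)
  also have "\<dots> = (\<integral>\<^sup>+ z. ennreal (?g z) \<partial>Rn (n * m))"
    by (rule nn_integral_k) simp
  also have "\<dots> = (\<integral>\<^sup>+ z. (\<lambda>w. \<Prod>i<n. ennreal (?e i (w i))) (blocks n m z) \<partial>Rn (n * m))"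
  proof (rule nn_integral_cong)
    fix z assume z: "z \<in> space (Rn (n * m))"
    have zb: "zblock m i z \<in> space (Rn m)" if "i < n" for i using measurable_space[OF measurable_zblock[OF that] z] .
    have *: "?g z = (\<Prod>i<n. ?e i (zblock m i z))"
      unfolding prod.distrib sum_sq_blocks
      using j by (simp add: exp_sum sum_distrib_left flip: sum_negf)
    show "ennreal (?g z) =
        (\<lambda>w. \<Prod>i<n. ennreal (?e i (w i))) (blocks n m z)"
    proof -
      have "(\<Prod>i<n. ennreal (?e i (blocks n m z i))) = (\<Prod>i<n. ennreal (?e i (zblock m i z)))"
        by (intro prod.cong refl) (simp add: blocks_def)
      also have "\<dots> = ennreal (\<Prod>i<n. ?e i (zblock m i z))"
        using e_nn[OF zb] by (intro prod_ennreal) auto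
      finally show ?thesis using * by simp
    qed
  qed
  also have "\<dots> = (\<integral>\<^sup>+ w. (\<Prod>i<n. ennreal (?e i (w i))) \<partial>Rblocks n m)"
    by (rule nn_integral_blocks)
       (intro borel_measurable_prod_ennreal measurable_compose[OF measurable_component_singleton[where M = "\<lambda>_. Rn m"]]; simp)
  also have "\<dots> = (\<Prod>i<n. \<integral>\<^sup>+ w. ennreal (?e i w) \<partial>Rn m)"
    by (rule Rn_product.product_nn_integral_prod) (simp, simp)
  also have "\<dots> = (\<Prod>i<n. ennreal (\<integral>w. ?e i w \<partial>Rn m))"
    using e_int e_nn by (intro prod.cong refl nn_integral_eq_integral) auto
  also have "\<dots> = ennreal (\<Prod>i<n. \<integral>w. ?e i w \<partial>Rn m)"
    using e_nn by (intro prod_ennreal integral_nonneg_AE) auto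
  also have "\<dots> < \<infinity>" by simp
  finally show "(\<integral>\<^sup>+ x. ennreal (k x * ?g (snd x)) \<partial>M) < \<infinity>" .
qed

text \<open>\<open>Gibbs_Young\<close> with a = q / post, multiplied by post: the finite divergence
  and the exponential moment of b under the posterior together bound q b. Where post is 0, q is 0
  too.\<close>

lemma integrable_by_Young:
  assumes q: "prob_density M q" and ac: "AE x in M. post x = 0 \<longrightarrow> q x = 0"
    and int: "integrable M (\<lambda>x. q x * ln (q x / post x))"
    and [measurable]: "b \<in> borel_measurable M" and nn: "\<And>x. x \<in> space M \<Longrightarrow> 0 \<le> b x"
    and exp: "integrable M (\<lambda>x. post x * exp (b x))"
  shows "integrable M (\<lambda>x. q x * b x)"
proof -
  note [measurable] = prob_densityD(1)[OF q]
  have "integrable M (\<lambda>x. \<bar>q x * ln (q x / post x)\<bar> + post x * exp (b x))"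
    using int exp by simp
  then show ?thesis
  proof (rule Bochner_Integration.integrable_bound)
    have "AE x in M. x \<in> space M" by simp
    with ac show "AE x in M. norm (q x * b x) \<le> norm (\<bar>q x * ln (q x / post x)\<bar> + post x * exp (b x))"
    proof eventually_elim
      case (elim x)
      have q0: "0 \<le> q x" by (rule prob_densityD(2)[OF q elim(2)])
      have "q x * b x \<le> \<bar>q x * ln (q x / post x)\<bar> + post x * exp (b x)"
      proof (cases "post x = 0")
        case False
        then have p: "0 < post x" using post_nonneg[of x] by simp
        have "post x * (q x / post x * b x) \<le>
            post x * (q x / post x * ln (q x / post x) - q x / post x + exp (b x))"
          using p q0 by (intro mult_left_mono Gibbs_Young) auto
        then have "q x * b x \<le> q x * ln (q x / post x) - q x + post x * exp (b x)"
          using p by (simp add: algebra_simps)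
        then show ?thesis using q0 by linarith
      qed (use elim in simp)
      moreover have "0 \<le> q x * b x" using q0 nn[OF elim(2)] by simp
      ultimately show ?case by simp
    qed
  qed measurable
qed

text \<open>The posterior vanishes outside the open orthant, absolute continuity passes this on to
  q, and what is almost sure for block j under q is almost sure under the law of that block.\<close>

lemma finite_KL_support:
  assumes fac: "factorizes n m d q t" and t: "\<And>j. prob_density (Rn m) (t j)"
    and ac: "AE x in M. post x = 0 \<longrightarrow> q x = 0" and j: "j < n"
  shows "AE w in Rn m. 0 < t j w \<longrightarrow> (\<forall>a<m. 0 < w a)"
proof -
  have q: "prob_density M q" using fac by (simp add: factorizes_def)
  note [measurable] = prob_densityD(1)[OF q] prob_densityD(1)[OF t] coordinate_measurable
  let ?P = "\<lambda>w. \<forall>a\<in>{..<m}. 0 < w a"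
  have P[measurable]: "Measurable.pred (Rn m) ?P" by measurable
  have meas: "(\<lambda>x. blocks n m (snd x)) \<in> density M (\<lambda>x. ennreal (q x)) \<rightarrow>\<^sub>M Rblocks n m" by simp
  have comp: "(\<lambda>w. w j) \<in> Rblocks n m \<rightarrow>\<^sub>M Rn m"
    using j by (intro measurable_component_singleton) simp
  have "AE x in density M (\<lambda>x. ennreal (q x)). ?P (blocks n m (snd x) j)"
  proof (subst AE_density)
    show "AE x in M. 0 < ennreal (q x) \<longrightarrow> ?P (blocks n m (snd x) j)"
      using ac
    proof eventually_elim
      case (elim x)
      show ?case
      proof
        assume "0 < ennreal (q x)"
        then have "0 < post x" using elim post_nonneg[of x] by (cases "post x = 0") auto
        then show "?P (blocks n m (snd x) j)"
          using j by (simp add: post_pos_iff blocks_def zblock_def block_index_less)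
      qed
    qed
  qed simp
  then have "AE w in Pi\<^sub>M {..<n} (law m t). ?P (w j)"
    unfolding distr_factorizes[OF fac t, symmetric]
    by (subst AE_distr_iff[OF meas]) (use measurable_compose[OF comp P] in \<open>simp_all add: pred_def\<close>)
  then have "AE w in law m t j. ?P w"
    by (rule AE_PiM_componentD[OF prob_densityD(3)[OF t], rotated]) (use j P in \<open>auto simp: pred_def\<close>)
  then show ?thesis by (subst (asm) AE_density) auto
qed

text \<open>Two choices of b in \<open>integrable_by_Young\<close>: a small multiple of a squared
  coordinate gives second moments, and the positive part of ln (t j), whose exponential is at most 1
  + t j, gives the upper half of the entropy. The lower half follows from the second moments by
  comparing t j with a Gaussian.\<close>

lemma finite_KL_moments:
  assumes fac: "factorizes n m d q t" and t: "\<And>j. prob_density (Rn m) (t j)"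
    and ac: "AE x in M. post x = 0 \<longrightarrow> q x = 0"
    and int: "integrable M (\<lambda>x. q x * ln (q x / post x))" and j: "j < n"
  shows "a < m \<Longrightarrow> integrable (law m t j) (\<lambda>w. (w a)\<^sup>2)"
    and "integrable (law m t j) (\<lambda>w. ln (t j w))"
proof -
  let ?S = "\<lambda>x :: (nat \<Rightarrow> real) \<times> (nat \<Rightarrow> real). \<Sum>r<n * m. (snd x r)\<^sup>2" and ?z = "\<lambda>x :: (nat \<Rightarrow> real) \<times> (nat \<Rightarrow> real). zblock m j (snd x)"
  have q: "prob_density M q" using fac by (simp add: factorizes_def)
  note [measurable] = prob_densityD(1)[OF q] prob_densityD(1)[OF t] measurable_zblock[OF j]
  obtain c where c: "c > 0" "\<And>u. c * (\<Sum>r<n * m. (u r)\<^sup>2) \<le> quad (n * m) G u"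
    using positive_definite_lower_bound[OF G] by blast
  \<comment> \<open>The posterior is then bounded by a multiple of k exp (- 2 e |z|^2), so a factor
    exp (e |z|^2) can be spent while exp (- e |z|^2) is left.\<close>
  define e where "e = c / 4"
  have e: "e > 0" "2 * e > 0" using c by (auto simp: e_def)
  have post_le: "post x \<le> K * (k x * exp (- (2 * e) * ?S x))" for x
  proof -
    have "exp (- quad (n * m) G (snd x) / 2) \<le> exp (- (2 * e) * ?S x)"
      using c(2)[of "snd x"] by (simp add: e_def)
    then have "k x * K * exp (- quad (n * m) G (snd x) / 2) \<le>
        k x * K * exp (- (2 * e) * ?S x)"
      using k_pos[of x] K by (intro mult_left_mono) auto
    moreover have "post x \<le> k x * K * exp (- quad (n * m) G (snd x) / 2)"
      using k_pos[of x] K by (cases x) (auto simp: post_eq)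
    ultimately show ?thesis by (simp add: algebra_simps)
  qed
  have nn_t: "0 \<le> t j w" if "w \<in> space (Rn m)" for w by (rule prob_densityD(2)[OF t that])
  have zb: "?z x \<in> space (Rn m)" if "x \<in> space M" for x
    using measurable_space[OF measurable_zblock[OF j, of m]] that by (auto simp: space_pair_measure)
  show sq: "integrable (law m t j) (\<lambda>w. (w a)\<^sup>2)" if a: "a < m" for a
  proof -
    note [measurable] = coordinate_measurable[OF a]
    have [measurable]: "(\<lambda>w. e * (w a)\<^sup>2) \<in> borel_measurable (Rn m)" by measurable
    have [measurable]: "(\<lambda>x. e * (?z x a)\<^sup>2) \<in> borel_measurable M"
      by (rule measurable_compose[of "\<lambda>x. ?z x" _ "Rn m" "\<lambda>w. e * (w a)\<^sup>2"]) measurable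
    have "integrable M (\<lambda>x. K * (k x * (exp (- e * ?S x) * 1)))"
      using integrable_k_exp[OF e(1) j, of "\<lambda>_. 1"] integrable_exp_neg_sq[OF e(1), of m "\<lambda>_. 0"] by simp
    then have exp: "integrable M (\<lambda>x. post x * exp (e * (?z x a)\<^sup>2))"
    proof (rule Bochner_Integration.integrable_bound)
      have "post x * exp (e * (?z x a)\<^sup>2) \<le> K * (k x * (exp (- e * ?S x) * 1))" for x
      proof -
        let ?s = "?S x"
        have "(snd x (j * m + a))\<^sup>2 \<le> ?s" using block_index_less[OF j a] by (intro member_le_sum) auto
        then have "(?z x a)\<^sup>2 \<le> ?s" using a by (simp add: zblock_def)
        then have "post x * exp (e * (?z x a)\<^sup>2) \<le> K * (k x * exp (- (2 * e) * ?s)) * exp (e * ?s)"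
          using e k_pos[of x] K by (intro mult_mono post_le) auto
        also have "\<dots> = K * (k x * (exp (- (2 * e) * ?s) * exp (e * ?s)))" by simp
        also have "exp (- (2 * e) * ?s) * exp (e * ?s) = exp (- e * ?s)" by (simp flip: exp_add)
        finally show ?thesis by simp
      qed
      then show "AE x in M. norm (post x * exp (e * (?z x a)\<^sup>2)) \<le>
          norm (K * (k x * (exp (- e * ?S x) * 1)))"
        using post_nonneg k_pos K by (auto simp: abs_mult less_imp_le)
    qed measurable
    have "integrable M (\<lambda>x. q x * (e * (?z x a)\<^sup>2))"
      by (rule integrable_by_Young[OF q ac int _ _ exp]) (use e in auto)
    then have "integrable (law m t j) (\<lambda>w. e * (w a)\<^sup>2)"
      by (subst (asm) integrable_factorizes_block[OF fac t j]) auto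
    then show ?thesis using e by simp
  qed
  have [measurable]: "(\<lambda>w. max 0 (ln (t j w))) \<in> borel_measurable (Rn m)" by measurable
  \<comment> \<open>For the summand t j the Gaussian factor is bounded by 1 and t j itself is
    integrable.\<close>
  have "integrable (Rn m) (\<lambda>w. exp (- (2 * e) * (\<Sum>a<m. (w a)\<^sup>2)) * (1 + t j w))"
  proof -
    have "integrable (Rn m) (\<lambda>w. exp (- (2 * e) * (\<Sum>a<m. (w a)\<^sup>2)) * t j w)"
      by (rule Bochner_Integration.integrable_bound[OF prob_densityD(5)[OF t[of j]]])
         (use e in \<open>auto simp: abs_mult sum_nonneg intro!: mult_left_le_one_le\<close>)
    then show ?thesis
      using integrable_exp_neg_sq[OF e(2), of m "\<lambda>_. 0"] by (simp add: distrib_left)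
  qed
  then have "integrable M (\<lambda>x. K * (k x * (exp (- (2 * e) * ?S x) * (1 + t j (?z x)))))"
    using integrable_k_exp[OF e(2) j, of "\<lambda>w. 1 + t j w"] nn_t by simp
  then have exp: "integrable M (\<lambda>x. post x * exp (max 0 (ln (t j (?z x)))))"
  proof (rule Bochner_Integration.integrable_bound)
    have le: "post x * exp (max 0 (ln (t j (?z x)))) \<le>
        K * (k x * (exp (- (2 * e) * ?S x) * (1 + t j (?z x))))" if "x \<in> space M" for x
    proof -
      let ?s = "?S x" and ?t = "t j (?z x)"
      have t0: "0 \<le> ?t" by (rule nn_t[OF zb[OF that]])
      have "exp (max 0 (ln ?t)) \<le> 1 + ?t" using t0 by (cases "?t = 0") (auto simp: max_def)
      then have "post x * exp (max 0 (ln ?t)) \<le> K * (k x * exp (- (2 * e) * ?s)) * (1 + ?t)"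
        using e k_pos[of x] K by (intro mult_mono post_le) auto
      then show ?thesis by (simp add: algebra_simps)
    qed
    show "AE x in M. norm (post x * exp (max 0 (ln (t j (?z x))))) \<le>
        norm (K * (k x * (exp (- (2 * e) * ?S x) * (1 + t j (?z x)))))"
    proof (rule AE_I2)
      fix x assume "x \<in> space M"
      moreover have "0 \<le> post x * exp (max 0 (ln (t j (?z x))))"
        by (intro mult_nonneg_nonneg post_nonneg) simp
      ultimately show "norm (post x * exp (max 0 (ln (t j (?z x))))) \<le>
        norm (K * (k x * (exp (- (2 * e) * ?S x) * (1 + t j (?z x)))))"
        unfolding real_norm_def using le[of x] by linarith
    qed
  qed measurable
  have "integrable M (\<lambda>x. q x * max 0 (ln (t j (?z x))))"
    by (rule integrable_by_Young[OF q ac int _ _ exp]) auto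
  then have "integrable (law m t j) (\<lambda>w. max 0 (ln (t j w)))"
    by (subst (asm) integrable_factorizes_block[OF fac t j, of "\<lambda>w. max 0 (ln (t j w))"]) auto
  then have pos: "integrable (Rn m) (\<lambda>w. t j w * max 0 (ln (t j w)))"
    using nn_t by (subst (asm) integrable_real_density) auto
  have "integrable (law m t j) (\<lambda>w. \<Sum>a<m. (w a)\<^sup>2)" using sq by (intro Bochner_Integration.integrable_sum) auto
  then have "integrable (Rn m) (\<lambda>w. t j w * (\<Sum>a<m. (w a)\<^sup>2))"
    using nn_t by (subst (asm) integrable_real_density) auto
  then have "integrable (Rn m) (\<lambda>w. t j w * max 0 (ln (t j w)) + (e * (t j w * (\<Sum>a<m. (w a)\<^sup>2)) +
      exp (- e * (\<Sum>a<m. (w a)\<^sup>2))))"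
    using pos integrable_exp_neg_sq[OF e(1), of m "\<lambda>_. 0"]
    by (intro Bochner_Integration.integrable_add integrable_mult_right) auto
  then have "integrable (Rn m) (\<lambda>w. t j w * ln (t j w))"
  proof (rule Bochner_Integration.integrable_bound)
    show "AE w in Rn m. norm (t j w * ln (t j w)) \<le> norm (t j w * max 0 (ln (t j w)) +
        (e * (t j w * (\<Sum>a<m. (w a)\<^sup>2)) + exp (- e * (\<Sum>a<m. (w a)\<^sup>2))))"
    proof (rule AE_I2)
      fix w assume "w \<in> space (Rn m)"
      then have t0: "0 \<le> t j w" by (rule nn_t)
      let ?s = "\<Sum>a<m. (w a)\<^sup>2"
      have s0: "0 \<le> e * (t j w * ?s)" using t0 e by (intro mult_nonneg_nonneg sum_nonneg) auto
      \<comment> \<open>Young's inequality with b = - e |w|^2 controls - t ln t, whose integral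
        could otherwise diverge where t is small but spread out.\<close>
      have "t j w * (- e * ?s) \<le> t j w * ln (t j w) - t j w + exp (- e * ?s)"
        by (rule Gibbs_Young[OF t0])
      then have 1: "- (t j w * ln (t j w)) \<le> e * (t j w * ?s) + exp (- e * ?s)"
        using t0 by (simp add: algebra_simps)
      have 2: "0 \<le> t j w * max 0 (ln (t j w))" using t0 by simp
      have 3: "t j w * ln (t j w) \<le> t j w * max 0 (ln (t j w))" using t0 by (intro mult_left_mono) auto
      have 4: "0 < exp (- e * ?s)" by simp
      from 1 2 3 4 s0 show "norm (t j w * ln (t j w)) \<le> norm (t j w * max 0 (ln (t j w)) +
        (e * (t j w * ?s) + exp (- e * ?s)))"
        unfolding real_norm_def by linarith
    qed
  qed measurable
  then show "integrable (law m t j) (\<lambda>w. ln (t j w))"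
    using nn_t by (subst integrable_real_density) auto
qed

text \<open>The block densities are 1 on their support, so the logarithms \<open>lt\<close> can be
  taken to be 0. What remains is a constant and the quadratic form of G, integrable by second
  moments on the cube.\<close>

lemma finite_KL_cube: "KL M (cand (\<lambda>_ w. of_bool (positive_cube m w))) post \<noteq> \<infinity>"
proof -
  let ?t = "\<lambda>(_ :: nat) w. of_bool (positive_cube m w) :: real"
  have t: "prob_density (Rn m) (?t j)" for j :: nat by (rule prob_density_cube)
  have [measurable]: "?t j \<in> borel_measurable (Rn m)" for j :: nat by (rule prob_densityD(1)[OF t])
  have sq: "integrable (law m ?t j) (\<lambda>w. (w a)\<^sup>2)" if "a < m" for a and j :: nat
  proof -
    note [measurable] = coordinate_measurable[OF that]
    have le1: "(w a)\<^sup>2 \<le> 1" if "positive_cube m w" for w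
      using that \<open>a < m\<close> by (intro power_le_one) (auto simp: positive_cube_def less_imp_le)
    have "integrable (Rn m) (\<lambda>w. ?t j w * (w a)\<^sup>2)"
      by (rule Bochner_Integration.integrable_bound[OF prob_densityD(5)[OF t]])
         (use le1 in auto)
    then show ?thesis by (subst integrable_real_density) auto
  qed
  interpret P: prob_space "Pi\<^sub>M {..<n} (law m ?t)" by (intro prob_space_PiM prob_densityD(3)[OF t])
  have pair: "integrable (Pi\<^sub>M {..<n} (law m ?t)) (\<lambda>w. w i a * w j b)"
    if "i < n" "j < n" "a < m" "b < m" for i j a b
    using that by (intro integrable_PiM_pair[where m = m] prob_densityD(3)[OF t] sq) auto
  have "integrable (Pi\<^sub>M {..<n} (law m ?t)) (log_ratio (\<lambda>_ _. 0))"
    unfolding log_ratio_def quad_flatten mult.assoc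
    by (intro Bochner_Integration.integrable_add Bochner_Integration.integrable_diff
        Bochner_Integration.integrable_sum integrable_divide integrable_mult_right pair P.integrable_const) auto
  then have "KL M (cand ?t) post = ereal (\<integral>w. log_ratio (\<lambda>_ _. 0) w \<partial>Pi\<^sub>M {..<n} (law m ?t))"
    by (intro KL_cand t) (auto simp: positive_cube_def)
  then show ?thesis by simp
qed

lemma cand_mem_approx_class: "(\<And>j. prob_density (Rn m) (t j)) \<Longrightarrow> cand t \<in> approx_class n m d"
  unfolding approx_class_def by (intro CollectI exI[of _ t] factorizes_cand)

text \<open>The divergence of q is at most that of the cube candidate, hence finite, which leaves
  only the first branch of \<open>KL_factorizing\<close>.\<close>

lemma minimizer_finite_KL:
  assumes fac: "factorizes n m d q t"
    and minimal: "\<forall>q'\<in>approx_class n m d. KL M q post \<le> KL M q' post"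
  shows "AE x in M. post x = 0 \<longrightarrow> q x = 0" "integrable M (\<lambda>x. q x * ln (q x / post x))"
proof -
  have "KL M q post \<noteq> \<infinity>"
    using bspec[OF minimal cand_mem_approx_class[OF prob_density_cube]] finite_KL_cube by auto
  then show "AE x in M. post x = 0 \<longrightarrow> q x = 0" "integrable M (\<lambda>x. q x * ln (q x / post x))"
    by (auto simp: KL_factorizing[OF fac] split: if_splits)
qed

lemma minimizer_regular:
  assumes fac: "factorizes n m d q t" and t: "\<And>j. prob_density (Rn m) (t j)"
    and minimal: "\<forall>q'\<in>approx_class n m d. KL M q post \<le> KL M q' post"
    and j: "j < n"
  shows "a < m \<Longrightarrow> integrable (law m t j) (\<lambda>w. (w a)\<^sup>2)"
    and "AE w in Rn m. 0 < t j w \<longrightarrow> (\<forall>a<m. 0 < w a)"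
    and "integrable (law m t j) (\<lambda>w. ln (t j w))"
  using minimizer_finite_KL[OF fac minimal] j
  by (auto intro: finite_KL_moments[OF fac t] finite_KL_support[OF fac t])

text \<open>The hypothesis \<open>mean\<close> makes the linear term of ln \<tau> the negative of
  the expected linear term in z_i of half the quadratic form of G, which is the shape required by
  \<open>expectation_independent_of_block\<close>. Stating it as a linear system for \<mu> keeps the
  inverse matrix of the explicit formula out of the argument.\<close>

lemma coordinate_ascent_optimum:
  assumes fac: "factorizes n m d q t" and t: "\<And>j. prob_density (Rn m) (t j)"
    and minimal: "\<forall>q'\<in>approx_class n m d. KL M q post \<le> KL M q' post"
    and i: "i < n" and \<mu>: "\<mu> \<in> carrier_vec m"
    and mean: "\<And>a. a < m \<Longrightarrow> (\<Sum>b<m. G $$ (i * m + a, i * m + b) * \<mu> $ b) =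
      - (\<Sum>j\<in>{..<n} - {i}. \<Sum>b<m. G $$ (i * m + a, j * m + b) * (\<integral>v. v b \<partial>law m t j))"
  defines "\<tau> \<equiv> truncated_normal_dens m \<mu> (minv (block m G i i)) {w. \<forall>a<m. 0 \<le> w a}"
  shows "AE x in M. q x = cand (t(i := \<tau>)) x"
    and "AE w in Rn m. t i w = \<tau> w"
proof -
  have q: "prob_density M q" using fac by (simp add: factorizes_def)
  note ac = minimizer_finite_KL(1)[OF fac minimal] and int = minimizer_finite_KL(2)[OF fac minimal]
  then have KLq: "KL M q post = ereal (\<integral>x. q x * ln (q x / post x) \<partial>M)"
    by (simp add: KL_factorizing[OF fac])
  note sq = minimizer_regular(1)[OF fac t minimal] and supp = minimizer_regular(2)[OF fac t minimal]
    and logs = minimizer_regular(3)[OF fac t minimal]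

  define P where "P = block m G i i"
  have Ppd: "positive_definite m P" unfolding P_def by (rule positive_definite_block[OF G i])
  note W = positive_definite_minv[OF Ppd] and PW = minv_positive_definite(4)[OF Ppd, symmetric]
  note trunc = truncated_normal[OF W PW \<mu> refl, folded P_def, folded \<tau>_def[folded P_def]]
  obtain c where c: "\<And>w. (\<forall>a<m. 0 \<le> w a) \<Longrightarrow> \<tau> w > 0 \<and>
      ln (\<tau> w) = c - quad m P w / 2 + (\<Sum>r<m. w r * (\<Sum>b<m. P $$ (r, b) * \<mu> $ b))"
    using trunc(3) by blast
  define t' where "t' = t(i := \<tau>)"
  have t': "prob_density (Rn m) (t' j)" for j using t trunc(1) by (simp add: t'_def)
  note [measurable] = prob_densityD(1)[OF q] prob_densityD(1)[OF t] prob_densityD(1)[OF t']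
    prob_densityD(1)[OF prob_density_cand[OF t']] coordinate_measurable
  \<comment> \<open>For block i the polynomial replaces ln \<tau> on all of space, so that it is
    measurable and has expectations under the old and the new law of that block by second moments
    alone.\<close>
  define lt where "lt = (\<lambda>j w. if j = i then c - quad m P w / 2 + (\<Sum>r<m. w r * (\<Sum>b<m. P $$ (r, b) * \<mu> $ b))
      else ln (t j w))"
  have lt_meas: "lt j \<in> borel_measurable (Rn m)" for j
  proof (cases "j = i")
    case True then show ?thesis unfolding lt_def by (simp cong: if_cong) measurable
  next
    case False then show ?thesis unfolding lt_def by (simp cong: if_cong) measurable
  qed
  have supp': "AE w in Rn m. 0 < t' j w \<longrightarrow> (\<forall>a<m. 0 < w a) \<and> ln (t' j w) = lt j w" if j: "j < n" for j
  proof (cases "j = i")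
    case True
    have "AE w in Rn m. \<forall>a<m. w a \<noteq> 0" by (rule AE_Rn_coordinate_nonzero)
    then show ?thesis
    proof eventually_elim
      case (elim w)
      then show ?case using trunc(2)[of w] c[of w] by (auto simp: True t'_def lt_def less_le)
    qed
  next
    case False then show ?thesis using supp[OF j] by (simp add: t'_def lt_def)
  qed
  have sq': "integrable (law m t' j) (\<lambda>w. (w a)\<^sup>2)" if "j < n" "a < m" for j a
    using sq[OF that] trunc(4)[OF that(2)] by (simp add: t'_def)

  define g where "g = (\<lambda>j a k b. G $$ (j * m + a, k * m + b))"
  have log_ratio_eq: "log_ratio lt = (\<lambda>w. (\<Sum>j\<in>{..<n} - {i}. (\<lambda>w. ln (t j w)) (w j)) +
      ((c - ln K) - (\<Sum>a<m. \<Sum>b<m. g i a i b * w i a * w i b) / 2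
        - (\<Sum>a<m. w i a * (\<Sum>j\<in>{..<n} - {i}. \<Sum>b<m. g i a j b * (\<integral>v. v b \<partial>law m t j)))) +
      (\<Sum>j<n. \<Sum>k<n. \<Sum>a<m. \<Sum>b<m. g j a k b * w j a * w k b) / 2)"
    (is "_ = ?\<Phi>")
  proof
    fix w :: "nat \<Rightarrow> nat \<Rightarrow> real"
    have 1: "(\<Sum>j<n. lt j (w j)) = lt i (w i) + (\<Sum>j\<in>{..<n} - {i}. ln (t j (w j)))"
      using i by (subst sum.remove[of _ i]) (auto simp: lt_def intro!: sum.cong)
    have 2: "(\<Sum>r<m. w i r * (\<Sum>b<m. P $$ (r, b) * \<mu> $ b)) =
        - (\<Sum>a<m. w i a * (\<Sum>j\<in>{..<n} - {i}. \<Sum>b<m. g i a j b * (\<integral>v. v b \<partial>law m t j)))"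
      unfolding sum_negf[symmetric] using mean
      by (intro sum.cong refl) (simp add: P_def block_def g_def)
    have 3: "quad m P (w i) = (\<Sum>a<m. \<Sum>b<m. g i a i b * w i a * w i b)"
      by (simp add: quad_def P_def block_def g_def)
    show "log_ratio lt w = ?\<Phi> w"
      unfolding log_ratio_def quad_flatten 1 g_def[symmetric]
      by (simp add: lt_def 2 3 g_def)
  qed
  note block_indep = expectation_independent_of_block[where N = "law m t" and N' = "law m t'" and g = g
      and lq = "\<lambda>j w. ln (t j w)" and c = "c - ln K" and \<Phi> = "log_ratio lt", OF i prob_densityD(3)[OF t] prob_densityD(3)[OF t'] _ _ sq sq' _ _ logs log_ratio_eq]
  have sym: "g j a k b = g k b j a" if "j < n" "k < n" "a < m" "b < m" for j k a b
    unfolding g_def using that by (intro G_sym block_index_less)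
  have same: "law m t' j = law m t j" if "j \<noteq> i" for j using that by (simp add: t'_def)
  have F_t: "integrable (Pi\<^sub>M {..<n} (law m t)) (log_ratio lt)"
    and F_t': "integrable (Pi\<^sub>M {..<n} (law m t')) (log_ratio lt)"
    and F_eq: "(\<integral>w. log_ratio lt w \<partial>Pi\<^sub>M {..<n} (law m t)) = (\<integral>w. log_ratio lt w \<partial>Pi\<^sub>M {..<n} (law m t'))"
    by (rule block_indep; simp add: sym same)+
  have F_meas[measurable]: "log_ratio lt \<in> borel_measurable (Rblocks n m)"
    by (rule log_ratio_measurable[OF lt_meas])
  have KLr: "KL M (cand t') post = ereal (\<integral>w. log_ratio lt w \<partial>Pi\<^sub>M {..<n} (law m t'))"
    by (rule KL_cand[OF t' supp' lt_meas F_t'])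
  \<comment> \<open>Minimality enters here with the updated candidate as competitor.\<close>
  have KLle: "(\<integral>x. q x * ln (q x / post x) \<partial>M) \<le> (\<integral>w. log_ratio lt w \<partial>Pi\<^sub>M {..<n} (law m t'))"
    using bspec[OF minimal cand_mem_approx_class[where t = t', OF t']] unfolding KLq KLr by simp

  text \<open>The integral of \<open>gap\<close> is \<open>KL q post - KL r post\<close> for the candidate \<open>r\<close>, and \<open>gap\<close> is the integrand
    \<open>q ln (q / r) - q + r\<close> of \<open>KL q r\<close>.\<close>
  define gap where "gap = (\<lambda>x. q x * ln (q x / post x) - q x * log_ratio lt (blocks n m (snd x)) - q x + cand t' x)"
  note q_F = integral_factorizes[OF fac t F_meas]
  have q_F_int: "integrable M (\<lambda>x. q x * log_ratio lt (blocks n m (snd x)))" using q_F(1) F_t by simp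
  have q_int: "integrable M q" and r_int: "integrable M (cand t')"
    using prob_densityD(5)[OF q] prob_densityD(5)[OF prob_density_cand[OF t']] by auto
  have one: "(\<integral>x. f x \<partial>M) = 1" if "prob_density M f" for f
    using prob_densityD(1,2,4)[OF that] by (subst integral_eq_nn_integral) auto
  have gap_int: "integrable M gap"
    unfolding gap_def by (intro Bochner_Integration.integrable_add Bochner_Integration.integrable_diff int q_F_int q_int r_int)
  have "(\<integral>x. gap x \<partial>M) = (\<integral>x. q x * ln (q x / post x) \<partial>M) - (\<integral>w. log_ratio lt w \<partial>Pi\<^sub>M {..<n} (law m t)) - 1 + 1"
    unfolding gap_def using int q_F_int q_int r_int one[OF q] one[OF prob_density_cand[OF t']] q_F(2) by simp
  then have gap_le: "(\<integral>x. gap x \<partial>M) \<le> 0" using KLle F_eq by simp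
  have "AE x in M. x \<in> space M" by simp
  moreover have "AE x in M. q x \<noteq> 0 \<longrightarrow> (\<forall>j<n. 0 < t j (zblock m j (snd x)) \<and>
      ((\<forall>a<m. 0 < zblock m j (snd x) a)))"
    by (rule AE_factorizes[where P = "\<lambda>j w. \<forall>a<m. 0 < w a"]) (rule fac t supp; assumption?)+
  ultimately have gap: "AE x in M. 0 \<le> gap x \<and> (gap x = 0 \<longrightarrow> q x = cand t' x)"
  proof eventually_elim
    case (elim x)
    show ?case
    proof (cases "q x = 0")
      \<comment> \<open>Where q is 0 the gap is the candidate density itself.\<close>
      case True
      then show ?thesis using prob_densityD(2)[OF prob_density_cand[OF t'] elim(1)] by (simp add: gap_def)
    next
      case False
      \<comment> \<open>\<open>\<tau>\<close> is positive on the whole orthant, so the candidate is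
        positive almost everywhere that q is, and the quotient q / r makes sense.\<close>
      have all: "\<forall>j<n. 0 < t' j (zblock m j (snd x)) \<and> ((\<forall>a<m. 0 < zblock m j (snd x) a) \<and>
          ln (t' j (zblock m j (snd x))) = lt j (zblock m j (snd x)))"
        using elim(2) False c by (auto simp: t'_def lt_def less_imp_le)
      note r = log_ratio_cand[where t = t' and lt = lt, OF elim(1) all]
      have q0: "0 < q x" using prob_densityD(2)[OF q elim(1)] False by simp
      have "ln (q x / post x) - log_ratio lt (blocks n m (snd x)) = ln (q x / cand t' x)"
        unfolding r(3)[symmetric] using q0 r(1,2) by (simp add: ln_div)
      then have "gap x = q x * ln (q x / cand t' x) - q x + cand t' x"
        unfolding gap_def by (simp flip: right_diff_distrib)
      then show ?thesis using entropy_gap_nonneg[of "q x" "cand t' x"] q0 r(2) by simp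
    qed
  qed
  have "(\<integral>x. gap x \<partial>M) = 0" using gap_le gap by (intro antisym integral_nonneg_AE) auto
  then have "AE x in M. gap x = 0"
    using gap gap_int by (subst (asm) integral_nonneg_eq_0_iff_AE) auto
  with gap have q_r: "AE x in M. q x = cand t' x" by eventually_elim auto
  then show "AE x in M. q x = cand (t(i := \<tau>)) x" by (simp add: t'_def)

  \<comment> \<open>Equal joint densities give equal laws of the blocks, and projecting to block i
    compares t i with \<tau>.\<close>
  have "density M (\<lambda>x. ennreal (q x)) = density M (\<lambda>x. ennreal (cand t' x))"
    using q_r by (intro density_cong) auto
  then have "Pi\<^sub>M {..<n} (law m t) = Pi\<^sub>M {..<n} (law m t')"
    using distr_factorizes[OF fac t] distr_factorizes[OF factorizes_cand[OF t'] t'] by simp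
  moreover have "distr (Pi\<^sub>M {..<n} (law m s)) (Rn m) (\<lambda>w. w i) = law m s i" if s: "\<And>j. prob_density (Rn m) (s j)" for s
  proof -
    have "distr (Pi\<^sub>M {..<n} (law m s)) (law m s i) (\<lambda>w. w i) = law m s i"
      by (rule distr_PiM_component[OF prob_densityD(3)[OF s]]) (use i in auto)
    then show ?thesis by (simp cong: distr_cong)
  qed
  ultimately have "law m t i = law m t' i" using t t' by metis
  then have "AE w in Rn m. ennreal (t i w) = ennreal (t' i w)"
    by (subst (asm) sigma_finite_measure.density_unique_iff[OF sigma_finite_Rn]) auto
  moreover have "AE w in Rn m. w \<in> space (Rn m)" by simp
  ultimately show "AE w in Rn m. t i w = \<tau> w"
    by eventually_elim (use prob_densityD(2)[OF t] prob_densityD(2)[OF t'[of i]] in \<open>auto simp: t'_def\<close>)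
qed

end

section \<open>Means over the remaining blocks\<close>

lemma distr_prod_dens:
  assumes t: "\<And>j. prob_density (Rn m) (t j)"
  shows "distr (density (Rn (n * m)) (\<lambda>z. ennreal (\<Prod>i<n. t i (zblock m i z)))) (Rblocks n m)
      (blocks n m) = Pi\<^sub>M {..<n} (law m t)" (is "?D = ?P")
proof (rule measure_eqI)
  note [measurable] = prob_densityD(1)[OF prob_density_prod_dens[OF t, of n]]
  show sets: "sets ?D = sets ?P" by (simp cong: sets_PiM_cong)
  fix A assume "A \<in> sets ?D"
  then have [measurable]: "A \<in> sets (Rblocks n m)" by simp
  have "emeasure ?D A = (\<integral>\<^sup>+ w. indicator A w \<partial>?D)" by simp
  also have "\<dots> = (\<integral>\<^sup>+ z. ennreal (\<Prod>i<n. t i (zblock m i z)) * indicator A (blocks n m z) \<partial>Rn (n * m))"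
    by (subst nn_integral_distr) (simp_all add: nn_integral_density)
  also have "\<dots> = (\<integral>\<^sup>+ w. indicator A w \<partial>?P)" by (intro nn_integral_prod_dens[OF t]) simp
  also have "\<dots> = emeasure ?P A" using \<open>A \<in> sets ?D\<close> sets by (intro nn_integral_indicator) simp
  finally show "emeasure ?D A = emeasure ?P A" .
qed

text \<open>Applied to the n - 1 blocks other than i, this turns the entries of
  \<open>mean_minus\<close> into means of single blocks and shows that they exist.\<close>

lemma integral_coordinate_prod_dens:
  assumes t: "\<And>j. prob_density (Rn m) (t j)" and s: "s < n" and b: "b < m"
    and int: "integrable (law m t s) (\<lambda>v. v b)"
  shows "integrable (Rn (n * m)) (\<lambda>u. u (s * m + b) * (\<Prod>i<n. t i (zblock m i u)))"
    and "(\<integral>u. u (s * m + b) * (\<Prod>i<n. t i (zblock m i u)) \<partial>Rn (n * m)) = (\<integral>v. v b \<partial>law m t s)"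
proof -
  let ?T = "\<lambda>z. \<Prod>i<n. t i (zblock m i z)"
  let ?Q = "density (Rn (n * m)) (\<lambda>z. ennreal (?T z))"
  note T = prob_density_prod_dens[OF t, of n]
  note [measurable] = prob_densityD(1)[OF T]
  have coord[measurable]: "(\<lambda>u. u (s * m + b)) \<in> borel_measurable (Rn (n * m))"
    by (rule coordinate_measurable[OF block_index_less[OF s b]])
  have comp: "(\<lambda>v. v b) \<in> borel_measurable (law m t s)" using coordinate_measurable[OF b] by simp
  have f: "(\<lambda>w. w s b) \<in> borel_measurable (Rblocks n m)"
    using s by (intro measurable_compose[where f = "\<lambda>w. w s" and g = "\<lambda>v. v b",
        OF measurable_component_singleton[where M = "\<lambda>_. Rn m"] coordinate_measurable[OF b]]) simp
  have meas: "blocks n m \<in> ?Q \<rightarrow>\<^sub>M Rblocks n m" by simp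
  have eq: "blocks n m u s b = u (s * m + b)" for u using s b by (simp add: blocks_def zblock_def)
  have nn: "AE z in Rn (n * m). 0 \<le> ?T z" using prob_densityD(2)[OF T] by auto
  note C = integrable_PiM_component[of "{..<n}" "law m t" s "\<lambda>v. v b", OF prob_densityD(3)[OF t] _ comp]
  have "integrable (Pi\<^sub>M {..<n} (law m t)) (\<lambda>w. w s b)" using C(1) s int by simp
  then have "integrable ?Q (\<lambda>u. u (s * m + b))"
    unfolding distr_prod_dens[OF t, symmetric] integrable_distr_eq[OF meas f] eq .
  then have "integrable (Rn (n * m)) (\<lambda>u. ?T u * u (s * m + b))"
    using nn by (subst (asm) integrable_real_density) auto
  then show "integrable (Rn (n * m)) (\<lambda>u. u (s * m + b) * ?T u)" by (subst mult.commute)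
  have "(\<integral>v. v b \<partial>law m t s) = (\<integral>w. w s b \<partial>Pi\<^sub>M {..<n} (law m t))" using C(2) s by simp
  also have "\<dots> = (\<integral>u. u (s * m + b) \<partial>?Q)"
    unfolding distr_prod_dens[OF t, symmetric] integral_distr[OF meas f] eq ..
  also have "\<dots> = (\<integral>u. ?T u * u (s * m + b) \<partial>Rn (n * m))"
    using nn by (subst integral_real_density) auto
  also have "\<dots> = (\<integral>u. u (s * m + b) * ?T u \<partial>Rn (n * m))" by (subst mult.commute) (rule refl)
  finally show "(\<integral>u. u (s * m + b) * ?T u \<partial>Rn (n * m)) = (\<integral>v. v b \<partial>law m t s)" ..
qed

section \<open>The conditional density of \<beta>\<close>

context gaussian_posterior
begin

text \<open>For almost every z, q is k times a factor T' free of \<beta>. Integrating over \<beta>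
  identifies T' with the marginal density, which is positive under the marginal law, so it cancels
  in the conditional density.\<close>

lemma cond_beta_optimum:
  assumes fac: "factorizes n m d q t" and t: "\<And>j. prob_density (Rn m) (t j)"
    and t': "\<And>j. prob_density (Rn m) (t' j)"
    and supp: "\<And>j. j < n \<Longrightarrow> AE w in Rn m. 0 < t j w \<longrightarrow> (\<forall>a<m. 0 < w a)"
    and eq: "AE \<omega> in M. q \<omega> = cand t' \<omega>"
  shows "AE z in density (Rn (n * m)) (\<lambda>z. ennreal (\<Prod>i<n. t i (zblock m i z))).
    AE \<beta> in Rn d. cond_beta_dens d q \<beta> z = cond_beta_dens d post \<beta> z \<and> cond_beta_dens d post \<beta> z = k (\<beta>, z)"
proof -
  have q: "prob_density M q" using fac by (simp add: factorizes_def)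
  note [measurable] = prob_densityD(1)[OF q] prob_densityD(1)[OF prob_density_prod_dens[OF t, of n]]
  have "AE \<omega> in M. q \<omega> \<noteq> 0 \<longrightarrow> (\<forall>j<n. 0 < t j (zblock m j (snd \<omega>)) \<and> (\<forall>a<m. 0 < zblock m j (snd \<omega>) a))"
    by (rule AE_factorizes[where P = "\<lambda>j w. \<forall>a<m. 0 < w a"]) (rule fac t supp; assumption?)+
  note A2 = AE_pair_swap[OF sigma_finite_Rn sigma_finite_Rn this]
  note A1 = AE_pair_swap[OF sigma_finite_Rn sigma_finite_Rn eq]
  have "AE z in Rn (n * m). z \<in> space (Rn (n * m))" by simp
  with A1 A2 factorizes_marginal[OF fac t]
  have "AE z in Rn (n * m). 0 < (\<Prod>i<n. t i (zblock m i z)) \<longrightarrow>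
    (AE \<beta> in Rn d. cond_beta_dens d q \<beta> z = cond_beta_dens d post \<beta> z \<and> cond_beta_dens d post \<beta> z = k (\<beta>, z))"
  proof eventually_elim
    case (elim z)
    define T where "T = (\<Prod>i<n. t i (zblock m i z))"
    define T' where "T' = (\<Prod>i<n. t' i (zblock m i z))"
    have [measurable]: "(\<lambda>\<beta>. k (\<beta>, z)) \<in> borel_measurable (Rn d)" "(\<lambda>\<beta>. q (\<beta>, z)) \<in> borel_measurable (Rn d)"
      using elim(4) by measurable
    have T': "0 \<le> T'" unfolding T'_def by (rule prod_block_nonneg[OF t' elim(4)])
    show ?case
    proof
      assume "0 < (\<Prod>i<n. t i (zblock m i z))"
      then have T: "0 < T" by (simp add: T_def)
      have qT': "AE \<beta> in Rn d. q (\<beta>, z) = k (\<beta>, z) * T'" using elim(1) by (simp add: cand_def T'_def)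
      have "ennreal T = (\<integral>\<^sup>+ \<beta>. ennreal (q (\<beta>, z)) \<partial>Rn d)" using elim(3) by (simp add: T_def)
      also have "\<dots> = (\<integral>\<^sup>+ \<beta>. ennreal (k (\<beta>, z)) * ennreal T' \<partial>Rn d)"
        using qT' by (intro nn_integral_cong_AE) (auto elim!: eventually_mono simp: ennreal_mult T' k_pos less_imp_le)
      also have "\<dots> = ennreal T'" by (subst nn_integral_multc) (simp_all add: k_integral[OF elim(4)])
      finally have "T' = T" using T T' by simp
      then have T'pos: "0 < T'" using T by simp
      have "(\<integral>\<beta>. q (\<beta>, z) \<partial>Rn d) = (\<integral>\<beta>. k (\<beta>, z) * T' \<partial>Rn d)"
        using qT' by (intro integral_cong_AE) auto
      also have "\<dots> = T'" by (simp add: integral_k[OF elim(4)])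
      finally have int_q: "(\<integral>\<beta>. q (\<beta>, z) \<partial>Rn d) = T'" .
      \<comment> \<open>Off the open orthant \<open>post\<close> vanishes and its conditional
        density would be 0 / 0 = 0. If a coordinate of z were not positive, q would be 0 for almost
        every \<beta>, against its integral T' > 0.\<close>
      have zpos: "\<forall>r<n * m. 0 < z r"
      proof (rule ccontr)
        assume neg: "\<not> (\<forall>r<n * m. 0 < z r)"
        have nonpos: "\<not> (\<forall>j<n. 0 < t j (zblock m j z) \<and> (\<forall>a<m. 0 < zblock m j z a))"
        proof
          assume *: "\<forall>j<n. 0 < t j (zblock m j z) \<and> (\<forall>a<m. 0 < zblock m j z a)"
          obtain r where r: "r < n * m" "\<not> 0 < z r" using neg by blast
          then have "r div m < n" "r mod m < m" using block_index_div_mod by auto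
          then have "0 < zblock m (r div m) z (r mod m)" using * by blast
          with r \<open>r mod m < m\<close> show False by (simp add: zblock_def)
        qed
        have "AE \<beta> in Rn d. q (\<beta>, z) = 0"
          using elim(2) by (rule eventually_mono) (use nonpos in auto)
        then have "(\<integral>\<beta>. q (\<beta>, z) \<partial>Rn d) = (\<integral>\<beta>. 0 \<partial>Rn d)" by (intro integral_cong_AE) auto
        then show False using int_q T'pos by simp
      qed
      have post: "cond_beta_dens d post \<beta> z = k (\<beta>, z)" for \<beta>
        using zpos K by (simp add: cond_beta_dens_def post_eq integral_k[OF elim(4)])
      show "AE \<beta> in Rn d. cond_beta_dens d q \<beta> z = cond_beta_dens d post \<beta> z \<and> cond_beta_dens d post \<beta> z = k (\<beta>, z)"
        using qT'
      proof eventually_elim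
        case (elim \<beta>)
        then show ?case using T'pos by (simp add: post cond_beta_dens_def[of d q] int_q)
      qed
    qed
  qed
  then show ?thesis by (subst AE_density) auto
qed

end

subsection \<open>The posterior of the Gaussian model\<close>

lemma diag_block_mat_blocks:
  fixes F :: "nat \<Rightarrow> 'a :: zero mat"
  assumes "\<And>i. i < n \<Longrightarrow> F i \<in> carrier_mat m m"
  shows "diag_block_mat (map F [0..<n]) \<in> carrier_mat (n * m) (n * m)"
    and "r < n * m \<Longrightarrow> c < n * m \<Longrightarrow> diag_block_mat (map F [0..<n]) $$ (r, c) =
      (if r div m = c div m then F (r div m) $$ (r mod m, c mod m) else 0)"
proof -
  have *: "diag_block_mat (map F [0..<n]) \<in> carrier_mat (n * m) (n * m) \<and>
    (\<forall>r<n * m. \<forall>c<n * m. diag_block_mat (map F [0..<n]) $$ (r, c) =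
      (if r div m = c div m then F (r div m) $$ (r mod m, c mod m) else 0))"
    using assms
  proof (induction n)
    case (Suc n)
    let ?A = "diag_block_mat (map F [0..<n])"
    have IH: "?A \<in> carrier_mat (n * m) (n * m)"
      "\<And>r c. r < n * m \<Longrightarrow> c < n * m \<Longrightarrow> ?A $$ (r, c) =
      (if r div m = c div m then F (r div m) $$ (r mod m, c mod m) else 0)"
      using Suc by auto
    have Fn: "F n \<in> carrier_mat m m" using Suc.prems by simp
    have eq: "diag_block_mat (map F [0..<Suc n]) = four_block_mat ?A (0\<^sub>m (n * m) m) (0\<^sub>m m (n * m)) (F n)"
      using IH(1) Fn by (simp add: diag_block_mat_last Let_def)
    have last: "r div m = n" "r mod m = r - n * m" if "n * m \<le> r" "r < Suc n * m" for r
    proof -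
      have "r = n * m + (r - n * m)" "r - n * m < m" using that by auto
      then show "r div m = n" "r mod m = r - n * m"
        by (metis div_mult_self3 div_less add.right_neutral less_nat_zero_code not_gr_zero add.commute,
            metis mod_mult_self3 mod_less)
    qed
    show ?case
    proof (intro conjI allI impI)
      show "diag_block_mat (map F [0..<Suc n]) \<in> carrier_mat (Suc n * m) (Suc n * m)"
        unfolding eq using IH(1) Fn by (auto simp: add.commute)
      fix r c assume rc: "r < Suc n * m" "c < Suc n * m"
      have small: "x div m < n" if "x < n * m" for x using block_index_div_mod[OF that] by simp
      show "diag_block_mat (map F [0..<Suc n]) $$ (r, c) =
        (if r div m = c div m then F (r div m) $$ (r mod m, c mod m) else 0)"
        unfolding eq using IH Fn rc last small[of r] small[of c]
        by (cases "r < n * m"; cases "c < n * m") (auto simp: not_less)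
    qed
  qed simp
  then show "diag_block_mat (map F [0..<n]) \<in> carrier_mat (n * m) (n * m)" by blast
  show "diag_block_mat (map F [0..<n]) $$ (r, c) =
      (if r div m = c div m then F (r div m) $$ (r mod m, c mod m) else 0)" if "r < n * m" "c < n * m"
    using * that by blast
qed

lemma minv_diag_block_mat:
  assumes "\<And>i. i < n \<Longrightarrow> positive_definite m (B i)"
  shows "minv (diag_block_mat (map B [0..<n])) = diag_block_mat (map (\<lambda>i. minv (B i)) [0..<n])"
proof (rule minv_eqI)
  have B: "B i \<in> carrier_mat m m" "minv (B i) \<in> carrier_mat m m" "B i * minv (B i) = 1\<^sub>m m" if "i < n" for i
    using minv_positive_definite[OF assms[OF that]] assms[OF that] by (auto simp: positive_definite_def)
  show "diag_block_mat (map B [0..<n]) \<in> carrier_mat (n * m) (n * m)"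
    "diag_block_mat (map (\<lambda>i. minv (B i)) [0..<n]) \<in> carrier_mat (n * m) (n * m)"
    using B by (auto intro!: diag_block_mat_blocks(1))
  show "diag_block_mat (map B [0..<n]) * diag_block_mat (map (\<lambda>i. minv (B i)) [0..<n]) = 1\<^sub>m (n * m)"
    using B
  proof (induction n)
    case (Suc n)
    let ?A = "\<lambda>F :: nat \<Rightarrow> real mat. diag_block_mat (map F [0..<n])"
    have c: "?A B \<in> carrier_mat (n * m) (n * m)" "?A (\<lambda>i. minv (B i)) \<in> carrier_mat (n * m) (n * m)"
      using Suc.prems by (auto intro!: diag_block_mat_blocks(1))
    have n: "B n \<in> carrier_mat m m" "minv (B n) \<in> carrier_mat m m" "B n * minv (B n) = 1\<^sub>m m"
      using Suc.prems by auto
    have eq: "diag_block_mat (map F [0..<Suc n]) = four_block_mat (?A F) (0\<^sub>m (n * m) m) (0\<^sub>m m (n * m)) (F n)"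
      if "?A F \<in> carrier_mat (n * m) (n * m)" "F n \<in> carrier_mat m m" for F :: "nat \<Rightarrow> real mat"
      using that by (simp add: diag_block_mat_last Let_def)
    have "diag_block_mat (map B [0..<Suc n]) * diag_block_mat (map (\<lambda>i. minv (B i)) [0..<Suc n]) =
        four_block_mat (1\<^sub>m (n * m)) (0\<^sub>m (n * m) m) (0\<^sub>m m (n * m)) (1\<^sub>m m)"
      unfolding eq[OF c(1) n(1)] eq[OF c(2) n(2)] using Suc c n
      by (subst mult_four_block_mat[where ?nr1.0 = "n * m" and ?n1.0 = "n * m" and ?n2.0 = m and ?nr2.0 = m
            and ?nc1.0 = "n * m" and ?nc2.0 = m])
         (auto simp: left_mult_zero_mat[OF n(2)] right_mult_zero_mat[OF n(1)])
    also have "\<dots> = 1\<^sub>m (Suc n * m)" by (intro eq_matI) auto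
    finally show ?case .
  qed (auto intro!: eq_matI)
qed

text \<open>The off-diagonal blocks contribute nothing, so the form is a sum of block forms; one
  block on which u is not zero makes the sum positive.\<close>

lemma positive_definite_diag_block_mat:
  assumes B: "\<And>i. i < n \<Longrightarrow> positive_definite m (B i)"
  shows "positive_definite (n * m) (diag_block_mat (map B [0..<n]))"
    and "quad (n * m) (diag_block_mat (map B [0..<n])) u = (\<Sum>i<n. quad m (B i) (zblock m i u))"
proof -
  let ?D = "diag_block_mat (map B [0..<n])"
  have Bc: "B i \<in> carrier_mat m m" if "i < n" for i using B[OF that] by (simp add: positive_definite_def)
  note D = diag_block_mat_blocks[of n B m, OF Bc]
  show q: "quad (n * m) ?D u = (\<Sum>i<n. quad m (B i) (zblock m i u))" for u
  proof -
    have "quad (n * m) ?D u = (\<Sum>i<n. \<Sum>a<m. \<Sum>j<n. if j = i then \<Sum>b<m. B i $$ (a, b) * u (i * m + a) * u (i * m + b) else 0)"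
      unfolding quad_def sum_blocks by (intro sum.cong refl) (auto simp: D(2) block_index_less)
    also have "\<dots> = (\<Sum>i<n. \<Sum>a<m. \<Sum>b<m. B i $$ (a, b) * u (i * m + a) * u (i * m + b))"
      by (rule sum.cong[OF refl], rule sum.cong[OF refl]) (simp add: sum.delta)
    also have "\<dots> = (\<Sum>i<n. quad m (B i) (zblock m i u))"
      by (intro sum.cong refl) (simp add: quad_def zblock_def)
    finally show ?thesis .
  qed
  show "positive_definite (n * m) ?D"
    unfolding positive_definite_iff_quad
  proof (intro conjI allI impI)
    show "?D \<in> carrier_mat (n * m) (n * m)" by (rule D(1))
    show "?D $$ (r, c) = ?D $$ (c, r)" if "r < n * m" "c < n * m" for r c
    proof (cases "r div m = c div m")
      case True
      have "B (r div m) $$ (r mod m, c mod m) = B (r div m) $$ (c mod m, r mod m)"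
        using B[of "r div m"] block_index_div_mod[OF that(1)] block_index_div_mod[OF that(2)]
        unfolding positive_definite_iff_quad by blast
      then show ?thesis using that True by (simp add: D(2))
    qed (use that in \<open>simp add: D(2)\<close>)
    fix u :: "nat \<Rightarrow> real" assume "\<exists>r<n * m. u r \<noteq> 0"
    then obtain r where r: "r < n * m" "u r \<noteq> 0" by blast
    have i: "r div m < n" "r mod m < m" using block_index_div_mod[OF r(1)] by auto
    have nz: "zblock m (r div m) u (r mod m) \<noteq> 0" using r i by (simp add: zblock_def)
    have nonneg: "0 \<le> quad m (B i) v" if "i < n" for i v
    proof (cases "\<exists>a<m. v a \<noteq> 0")
      case True then show ?thesis using B[OF that] unfolding positive_definite_iff_quad by (simp add: less_imp_le)
    next
      case False then show ?thesis by (simp add: quad_def)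
    qed
    have "0 < quad m (B (r div m)) (zblock m (r div m) u)"
      using B[OF i(1)] nz i(2) unfolding positive_definite_iff_quad by blast
    also have "\<dots> \<le> (\<Sum>i<n. quad m (B i) (zblock m i u))"
      using i nonneg by (intro member_le_sum) auto
    finally show "0 < quad (n * m) ?D u" by (simp add: q)
  qed
qed

section \<open>Completing the square in a Gaussian regression\<close>

lemma scalar_prod_mult_mat_vec_adjoint:
  fixes A :: "real mat"
  assumes "A \<in> carrier_mat k l" "u \<in> carrier_vec k" "v \<in> carrier_vec l"
  shows "u \<bullet> (A *\<^sub>v v) = (A\<^sup>T *\<^sub>v u) \<bullet> v"
  using transpose_vec_mult_scalar[OF assms(1,3,2)] by simp

lemma congruence_symmetric:
  fixes S :: "'a :: comm_semiring_0 mat"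
  assumes W: "W \<in> carrier_mat r k" and S: "S \<in> carrier_mat k k" "S\<^sup>T = S"
  shows "(W * S * W\<^sup>T)\<^sup>T = W * S * W\<^sup>T"
proof -
  have "(W * S * W\<^sup>T)\<^sup>T = W * (W * S)\<^sup>T" using W S by (subst transpose_mult[of _ r k]) auto
  also have "(W * S)\<^sup>T = S * W\<^sup>T" using W S by (subst transpose_mult[of _ r k]) auto
  also have "W * (S * W\<^sup>T) = W * S * W\<^sup>T" using W S by (intro assoc_mult_mat[symmetric]) auto
  finally show ?thesis .
qed

text \<open>\<open>X\<close> is the design matrix, \<open>Li\<close> the precision matrix of \<open>z\<close> given \<open>\<beta>\<close>, and \<open>c\<close> the prior
  precision of \<open>\<beta>\<close>.\<close>
locale gaussian_regression =
  fixes N d :: nat and c :: real and X Li :: "real mat"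
  assumes c: "c > 0" and X: "X \<in> carrier_mat N d" and Li: "positive_definite N Li"
begin

text \<open>\<open>A\<close> and \<open>V\<close> are the precision and covariance of \<beta> given
  z, and \<open>C\<close> maps z to the conditional mean. By the Woodbury identity \<open>G\<close>
  is the inverse of the marginal covariance of z, which is the noise covariance plus X X^T /
  c.\<close>

definition "A = c \<cdot>\<^sub>m 1\<^sub>m d + X\<^sup>T * Li * X"
definition "V = minv A"
definition "C = V * X\<^sup>T * Li"
definition "G = Li - Li * X * V * X\<^sup>T * Li"

lemma Li_carrier: "Li \<in> carrier_mat N N" and Li_sym: "Li\<^sup>T = Li"
  using Li by (auto simp: positive_definite_def)

lemma X_vec[simp]: "X *\<^sub>v u \<in> carrier_vec N" and XT_vec[simp]: "X\<^sup>T *\<^sub>v u \<in> carrier_vec d"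
  and Li_vec[simp]: "Li *\<^sub>v u \<in> carrier_vec N"
  using X Li_carrier by (auto intro!: carrier_vecI)

lemma A_carrier: "A \<in> carrier_mat d d"
  using X Li_carrier by (simp add: A_def)

lemma A_mult_vec: "v \<in> carrier_vec d \<Longrightarrow> A *\<^sub>v v = c \<cdot>\<^sub>v v + X\<^sup>T *\<^sub>v (Li *\<^sub>v (X *\<^sub>v v))"
proof -
  assume v: "v \<in> carrier_vec d"
  have "X\<^sup>T * Li * X *\<^sub>v v = X\<^sup>T * Li *\<^sub>v (X *\<^sub>v v)"
    using X Li_carrier v by (intro assoc_mult_mat_vec[of _ d N _ d]) auto
  also have "\<dots> = X\<^sup>T *\<^sub>v (Li *\<^sub>v (X *\<^sub>v v))"
    using X Li_carrier by (intro assoc_mult_mat_vec[of _ d N _ N]) auto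
  finally have "X\<^sup>T * Li * X *\<^sub>v v = X\<^sup>T *\<^sub>v (Li *\<^sub>v (X *\<^sub>v v))" .
  moreover have "c \<cdot>\<^sub>m 1\<^sub>m d *\<^sub>v v = c \<cdot>\<^sub>v v"
  proof (intro eq_vecI)
    fix r assume r: "r < dim_vec (c \<cdot>\<^sub>v v)"
    then have "row (c \<cdot>\<^sub>m 1\<^sub>m d) r = c \<cdot>\<^sub>v unit_vec d r" using v by (intro eq_vecI) auto
    then show "(c \<cdot>\<^sub>m 1\<^sub>m d *\<^sub>v v) $ r = (c \<cdot>\<^sub>v v) $ r" using r v by simp
  qed (use v in simp)
  ultimately show ?thesis
    using X Li_carrier v unfolding A_def by (subst add_mult_distrib_mat_vec[of _ d d]) auto
qed

lemma A_sym: "A\<^sup>T = A"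
proof -
  have "(X\<^sup>T * Li * X)\<^sup>T = X\<^sup>T * Li * X"
    using congruence_symmetric[of "X\<^sup>T" d N Li] X Li_carrier Li_sym by simp
  moreover have "(c \<cdot>\<^sub>m 1\<^sub>m d :: real mat)\<^sup>T = c \<cdot>\<^sub>m 1\<^sub>m d" by (intro eq_matI) auto
  ultimately show ?thesis
    using X Li_carrier unfolding A_def by (subst transpose_add[of _ d d]) auto
qed

lemma A_form:
  assumes v: "v \<in> carrier_vec d"
  shows "v \<bullet> (A *\<^sub>v v) = c * (v \<bullet> v) + (X *\<^sub>v v) \<bullet> (Li *\<^sub>v (X *\<^sub>v v))"
proof -
  have "v \<bullet> (X\<^sup>T *\<^sub>v (Li *\<^sub>v (X *\<^sub>v v))) = (X *\<^sub>v v) \<bullet> (Li *\<^sub>v (X *\<^sub>v v))"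
    using X Li_carrier v by (subst scalar_prod_mult_mat_vec_adjoint[of _ d N]) auto
  then show ?thesis
    using X Li_carrier v by (simp add: A_mult_vec scalar_prod_add_distrib[of _ d])
qed

lemmas Li_nonneg = positive_definite_nonneg[OF Li]

lemma sq_norm_pos: "v \<in> carrier_vec d \<Longrightarrow> v \<noteq> 0\<^sub>v d \<Longrightarrow> 0 < v \<bullet> (v :: real vec)"
proof -
  assume v: "v \<in> carrier_vec d" "v \<noteq> 0\<^sub>v d"
  then obtain r where r: "r < d" "v $ r \<noteq> 0" by (metis carrier_vecD eq_vecI index_zero_vec)
  then have "0 < v $ r * v $ r" using not_real_square_gt_zero[of "v $ r"] by blast
  also have "\<dots> \<le> (\<Sum>i\<in>{0..<d}. v $ i * v $ i)" using r by (intro member_le_sum) auto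
  finally show ?thesis using v by (simp add: scalar_prod_def)
qed

lemma A: "positive_definite d A"
  unfolding positive_definite_def
proof (intro conjI ballI impI A_carrier A_sym)
  fix v :: "real vec" assume v: "v \<in> carrier_vec d" "v \<noteq> 0\<^sub>v d"
  have "0 < c * (v \<bullet> v)" using c sq_norm_pos[OF v] by simp
  moreover have "0 \<le> (X *\<^sub>v v) \<bullet> (Li *\<^sub>v (X *\<^sub>v v))" by (intro Li_nonneg) simp
  ultimately show "0 < v \<bullet> (A *\<^sub>v v)" by (simp add: A_form[OF v(1)])
qed

lemma V: "positive_definite d V"
  unfolding V_def by (rule positive_definite_minv[OF A])

lemma V_carrier: "V \<in> carrier_mat d d" and V_sym: "V\<^sup>T = V"
  using V by (auto simp: positive_definite_def)

lemma C_carrier: "C \<in> carrier_mat d N"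
  using V_carrier X Li_carrier by (simp add: C_def)

lemma C_vec[simp]: "C *\<^sub>v u \<in> carrier_vec d"
  using C_carrier by (auto intro!: carrier_vecI)

lemma G_carrier: "G \<in> carrier_mat N N"
  using Li_carrier by (intro carrier_matI) (auto simp: G_def)

lemma C_mult_vec: "z \<in> carrier_vec N \<Longrightarrow> C *\<^sub>v z = V *\<^sub>v (X\<^sup>T *\<^sub>v (Li *\<^sub>v z))"
proof -
  assume z: "z \<in> carrier_vec N"
  have "V * X\<^sup>T * Li *\<^sub>v z = V * X\<^sup>T *\<^sub>v (Li *\<^sub>v z)"
    using V_carrier X Li_carrier z by (intro assoc_mult_mat_vec[of _ d N _ N]) auto
  also have "\<dots> = V *\<^sub>v (X\<^sup>T *\<^sub>v (Li *\<^sub>v z))"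
    using V_carrier X by (intro assoc_mult_mat_vec[of _ d d _ N]) auto
  finally show ?thesis by (simp add: C_def)
qed

lemma G_mult_vec: "z \<in> carrier_vec N \<Longrightarrow> G *\<^sub>v z = Li *\<^sub>v z - Li *\<^sub>v (X *\<^sub>v (C *\<^sub>v z))"
proof -
  assume z: "z \<in> carrier_vec N"
  have "Li * X * V * X\<^sup>T * Li *\<^sub>v z = Li * X * V * X\<^sup>T *\<^sub>v (Li *\<^sub>v z)"
    using V_carrier X Li_carrier z by (intro assoc_mult_mat_vec[of _ N N]) auto
  also have "\<dots> = Li * X * V *\<^sub>v (X\<^sup>T *\<^sub>v (Li *\<^sub>v z))"
    using V_carrier X Li_carrier z by (intro assoc_mult_mat_vec[of _ N d]) auto
  also have "\<dots> = Li * X *\<^sub>v (V *\<^sub>v (X\<^sup>T *\<^sub>v (Li *\<^sub>v z)))"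
    using V_carrier X Li_carrier z by (intro assoc_mult_mat_vec[of _ N d]) auto
  also have "\<dots> = Li *\<^sub>v (X *\<^sub>v (V *\<^sub>v (X\<^sup>T *\<^sub>v (Li *\<^sub>v z))))"
    using V_carrier X Li_carrier z by (intro assoc_mult_mat_vec[of _ N N]) auto
  finally show ?thesis
    using V_carrier X Li_carrier z unfolding G_def
    by (subst minus_mult_distrib_mat_vec[of _ N N]) (auto simp: C_mult_vec)
qed

text \<open>With w = X^T Li z the normal equations A (C z) = w hold, and every cross term on either
  side is a scalar product with w.\<close>

lemma complete_square:
  assumes b: "b \<in> carrier_vec d" and z: "z \<in> carrier_vec N"
  shows "c * (b \<bullet> b) + (z - X *\<^sub>v b) \<bullet> (Li *\<^sub>v (z - X *\<^sub>v b)) =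
    (b - C *\<^sub>v z) \<bullet> (A *\<^sub>v (b - C *\<^sub>v z)) + z \<bullet> (G *\<^sub>v z)"
proof -
  define w where "w = X\<^sup>T *\<^sub>v (Li *\<^sub>v z)"
  define v where "v = C *\<^sub>v z"
  have w: "w \<in> carrier_vec d" by (simp add: w_def)
  have v: "v \<in> carrier_vec d" by (simp add: v_def)
  have Av: "A *\<^sub>v v = w"
  proof -
    have "A *\<^sub>v (V *\<^sub>v w) = A * V *\<^sub>v w" using A_carrier V_carrier w by (intro assoc_mult_mat_vec[symmetric]) auto
    then show ?thesis using minv_positive_definite(2)[OF A] w z by (simp add: v_def C_mult_vec w_def V_def)
  qed
  have Xb: "X *\<^sub>v b \<in> carrier_vec N" and Xv: "X *\<^sub>v v \<in> carrier_vec N" by auto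
  have Lz: "Li *\<^sub>v z \<in> carrier_vec N" and LXb: "Li *\<^sub>v (X *\<^sub>v b) \<in> carrier_vec N"
    and LXv: "Li *\<^sub>v (X *\<^sub>v v) \<in> carrier_vec N" by auto
  have 1: "(X *\<^sub>v u) \<bullet> (Li *\<^sub>v z) = w \<bullet> u" if "u \<in> carrier_vec d" for u
    using X Lz that scalar_prod_mult_mat_vec_adjoint[of X N d "Li *\<^sub>v z" u]
    by (simp add: w_def comm_scalar_prod[of _ N])
  have 2: "z \<bullet> (Li *\<^sub>v (X *\<^sub>v u)) = w \<bullet> u" if "u \<in> carrier_vec d" for u
    using X z Li_carrier that Li_sym scalar_prod_mult_mat_vec_adjoint[of Li N N z "X *\<^sub>v u"] 1[OF that]
    by (simp add: comm_scalar_prod[of _ N])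
  have "(z - X *\<^sub>v b) \<bullet> (Li *\<^sub>v (z - X *\<^sub>v b)) =
      z \<bullet> (Li *\<^sub>v z) - 2 * (w \<bullet> b) + (X *\<^sub>v b) \<bullet> (Li *\<^sub>v (X *\<^sub>v b))"
    using z Xb Lz LXb Li_carrier 1[OF b] 2[OF b]
    by (simp add: mult_minus_distrib_mat_vec[of _ N N] minus_scalar_prod_distrib[of _ N] scalar_prod_minus_distrib[of _ N])
  moreover have "z \<bullet> (G *\<^sub>v z) = z \<bullet> (Li *\<^sub>v z) - w \<bullet> v"
    using z Lz LXv 2[OF v] by (simp add: G_mult_vec scalar_prod_minus_distrib[of _ N] v_def[symmetric])
  moreover have "(b - v) \<bullet> (A *\<^sub>v (b - v)) = b \<bullet> (A *\<^sub>v b) - 2 * (w \<bullet> b) + w \<bullet> v"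
  proof -
    have "v \<bullet> (A *\<^sub>v b) = w \<bullet> b"
      using scalar_prod_mult_mat_vec_adjoint[OF A_carrier v b] by (simp add: A_sym Av)
    moreover have "A *\<^sub>v b \<in> carrier_vec d" using A_carrier b by simp
    ultimately show ?thesis
      using b v w A_carrier
      by (simp add: mult_minus_distrib_mat_vec[of _ d d] minus_scalar_prod_distrib[of _ d]
          scalar_prod_minus_distrib[of _ d] Av comm_scalar_prod[of _ d w])
  qed
  ultimately show ?thesis using A_form[OF b] by (simp add: v_def[symmetric])
qed

text \<open>\<open>complete_square\<close> at b = C z removes the form of A and leaves a sum of two
  nonnegative terms. If C z is not 0 the prior term is positive; otherwise the other term is the
  form of Li at z.\<close>

lemma G: "positive_definite N G"
  unfolding positive_definite_def
proof (intro conjI ballI impI G_carrier)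
  have "Li * X * V * X\<^sup>T * Li = Li * X * V * (Li * X)\<^sup>T"
    using V_carrier X Li_carrier
    by (simp add: transpose_mult[of Li N N X d] Li_sym assoc_mult_mat[of _ N d _ N _ N])
  then have "(Li * X * V * X\<^sup>T * Li)\<^sup>T = Li * X * V * X\<^sup>T * Li"
    using congruence_symmetric[of "Li * X" N d V] V_carrier V_sym X Li_carrier by simp
  then show "G\<^sup>T = G"
    using V_carrier X Li_carrier Li_sym unfolding G_def by (subst transpose_minus[of _ N N]) auto
  fix z :: "real vec" assume z: "z \<in> carrier_vec N" "z \<noteq> 0\<^sub>v N"
  define v where "v = C *\<^sub>v z"
  have v: "v \<in> carrier_vec d" by (simp add: v_def)
  have Xv: "X *\<^sub>v v \<in> carrier_vec N" by simp
  have "z \<bullet> (G *\<^sub>v z) = c * (v \<bullet> v) + (z - X *\<^sub>v v) \<bullet> (Li *\<^sub>v (z - X *\<^sub>v v))"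
    using complete_square[OF v z(1)] v A_carrier by (simp add: v_def[symmetric])
  also have "0 < \<dots>"
  proof (cases "v = 0\<^sub>v d")
    case True
    then have "z - X *\<^sub>v v = z" using X z by auto
    then show ?thesis using Li z True unfolding positive_definite_def by simp
  next
    case False
    have "0 < c * (v \<bullet> v)" using c sq_norm_pos[OF v False] by simp
    moreover have "0 \<le> (z - X *\<^sub>v v) \<bullet> (Li *\<^sub>v (z - X *\<^sub>v v))" using z Xv by (intro Li_nonneg) auto
    ultimately show ?thesis by simp
  qed
  finally show "0 < z \<bullet> (G *\<^sub>v z)" .
qed

end

lemma smult_one_mult_vec: "v \<in> carrier_vec d \<Longrightarrow> c \<cdot>\<^sub>m 1\<^sub>m d *\<^sub>v v = c \<cdot>\<^sub>v (v :: real vec)"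
proof (intro eq_vecI)
  fix r assume v: "v \<in> carrier_vec d" and r: "r < dim_vec (c \<cdot>\<^sub>v v)"
  then have "row (c \<cdot>\<^sub>m 1\<^sub>m d) r = c \<cdot>\<^sub>v unit_vec d r" by (intro eq_vecI) auto
  then show "(c \<cdot>\<^sub>m 1\<^sub>m d *\<^sub>v v) $ r = (c \<cdot>\<^sub>v v) $ r" using r v by simp
qed simp

text \<open>The transpose of \<open>V_minus\<close> is injective: entry
  \<open>insert_index l r\<close> of its product with v is v r, because row r alone has a nonzero
  entry in that column. The column l, shared by all rows, is never read.\<close>

lemma positive_definite_V_minus:
  assumes S: "positive_definite L S" and l: "l < L"
  shows "positive_definite (L - 1) (V_minus L l * S * (V_minus L l)\<^sup>T)"
proof -
  let ?V = "V_minus L l"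
  have Sc: "S \<in> carrier_mat L L" and Ssym: "S\<^sup>T = S" using S by (auto simp: positive_definite_def)
  have V: "?V \<in> carrier_mat (L - 1) L" by (simp add: V_minus_def)
  have ins: "insert_index l r < L" "insert_index l r \<noteq> l" if "r < L - 1" for r
    using that l by (auto simp: insert_index_def)
  have inj: "insert_index l r = insert_index l r' \<longleftrightarrow> r = r'" for r r'
    by (metis delete_insert_index)
  show ?thesis
    unfolding positive_definite_def
  proof (intro conjI ballI impI)
    show "?V * S * ?V\<^sup>T \<in> carrier_mat (L - 1) (L - 1)" using V Sc by auto
    show "(?V * S * ?V\<^sup>T)\<^sup>T = ?V * S * ?V\<^sup>T" by (rule congruence_symmetric[OF V Sc Ssym])
    fix v :: "real vec" assume v: "v \<in> carrier_vec (L - 1)" "v \<noteq> 0\<^sub>v (L - 1)"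
    define u where "u = ?V\<^sup>T *\<^sub>v v"
    have u: "u \<in> carrier_vec L" using V by (auto simp: u_def intro!: carrier_vecI)
    obtain r where r: "r < L - 1" "v $ r \<noteq> 0" using v by (metis carrier_vecD eq_vecI index_zero_vec)
    have "u $ insert_index l r = (\<Sum>r'\<in>{0..<L - 1}. ?V $$ (r', insert_index l r) * v $ r')"
      using V v(1) ins[OF r(1)] by (simp add: u_def scalar_prod_def)
    also have "\<dots> = (\<Sum>r'\<in>{0..<L - 1}. if r' = r then v $ r' else 0)"
      using ins[OF r(1)] ins l by (intro sum.cong refl) (auto simp: V_minus_def inj)
    also have "\<dots> = v $ r" using r(1) by simp
    finally have "u \<noteq> 0\<^sub>v L" using r ins[OF r(1)] by auto
    then have "0 < u \<bullet> (S *\<^sub>v u)" using S u unfolding positive_definite_def by blast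
    also have "u \<bullet> (S *\<^sub>v u) = v \<bullet> (?V *\<^sub>v (S *\<^sub>v u))"
      using V Sc v(1) u by (subst scalar_prod_mult_mat_vec_adjoint[of ?V "L - 1" L]) (auto simp: u_def)
    also have "?V *\<^sub>v (S *\<^sub>v u) = ?V * S *\<^sub>v u" using V Sc u by (intro assoc_mult_mat_vec[symmetric]) auto
    also have "\<dots> = ?V * S * ?V\<^sup>T *\<^sub>v v"
      unfolding u_def using V Sc v(1) by (intro assoc_mult_mat_vec[symmetric]) auto
    finally show "0 < v \<bullet> (?V * S * ?V\<^sup>T *\<^sub>v v)" .
  qed
qed

lemma block_diag_block_mat:
  assumes "\<And>i. i < n \<Longrightarrow> F i \<in> carrier_mat m m" "i < n" "j < n" "a < m" "b < m"
  shows "diag_block_mat (map F [0..<n]) $$ (i * m + a, j * m + b) = (if i = j then F i $$ (a, b) else 0)"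
  using assms(2-) by (subst diag_block_mat_blocks(2)[OF assms(1)]) (auto simp: block_index_less)

text \<open>Abstracts from the multinomial construction: B i is the covariance of block i given
  \<beta>, and the prior precision 1 / \<nu>^2 becomes the constant c of
  \<open>gaussian_regression\<close>.\<close>

locale probit_model =
  fixes n m d :: nat and \<nu> :: real and X :: "real mat" and B :: "nat \<Rightarrow> real mat"
  assumes \<nu>: "\<nu> > 0" and X_carrier: "X \<in> carrier_mat (n * m) d"
    and B: "\<And>i. i < n \<Longrightarrow> positive_definite m (B i)"
begin

definition "Lam = diag_block_mat (map B [0..<n])"

lemma B_carrier: "i < n \<Longrightarrow> B i \<in> carrier_mat m m" and minv_B_carrier: "i < n \<Longrightarrow> minv (B i) \<in> carrier_mat m m"
  using B minv_positive_definite(1)[OF B] by (auto simp: positive_definite_def)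

lemma minv_Lam: "minv Lam = diag_block_mat (map (\<lambda>i. minv (B i)) [0..<n])"
  unfolding Lam_def by (rule minv_diag_block_mat[OF B])

lemma block_Lam:
  assumes "i < n" shows "block m Lam i i = B i"
proof -
  have "block m Lam i i $$ (a, b) = B i $$ (a, b)" if "a < m" "b < m" for a b
    using block_diag_block_mat[of n B m, OF B_carrier] assms that by (simp add: block_def Lam_def)
  then show ?thesis using B_carrier[OF assms] by (intro eq_matI) (auto simp: block_def)
qed

sublocale gaussian_regression "n * m" d "1 / \<nu>\<^sup>2" X "minv Lam"
proof
  show "positive_definite (n * m) (minv Lam)"
    unfolding minv_Lam by (rule positive_definite_diag_block_mat(1)) (rule positive_definite_minv[OF B])
qed (use \<nu> X_carrier in auto)

definition k :: "(nat \<Rightarrow> real) \<times> (nat \<Rightarrow> real) \<Rightarrow> real" where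
  "k = (\<lambda>(\<beta>, z). normal_dens V (vec d \<beta> - C *\<^sub>v vec (n * m) z))"

lemma minv_V: "minv V = A"
  unfolding V_def by (rule minv_positive_definite(4)[OF A])

lemma det_V: "0 < (2 * pi) ^ d * det V"
  using det_positive_definite_pos[OF V] by simp

lemma k_eq_quad: "k (\<beta>, z) =
  exp (- quad d A (\<lambda>r. \<beta> r - (\<Sum>c<n * m. C $$ (r, c) * z c)) / 2) / sqrt ((2 * pi) ^ d * det V)"
proof -
  have "C *\<^sub>v vec (n * m) z = vec d (\<lambda>r. \<Sum>c<n * m. C $$ (r, c) * z c)"
    using C_carrier by (intro eq_vecI) (auto simp: scalar_prod_def atLeast0LessThan)
  then show ?thesis
    using normal_dens_eq_quad[of V d] A_carrier by (simp add: k_def minv_V)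
qed

lemma k_measurable: "k \<in> borel_measurable (Rn d \<Otimes>\<^sub>M Rn (n * m))"
proof -
  have "k = (\<lambda>x. exp (- quad d A (\<lambda>r. fst x r - (\<Sum>c<n * m. C $$ (r, c) * snd x c)) / 2) / sqrt ((2 * pi) ^ d * det V))"
    by (rule ext) (simp add: k_eq_quad split_paired_all)
  then show ?thesis by (simp only: quad_def) measurable
qed

lemma k_pos: "0 < k x"
  using det_V by (cases x) (simp add: k_eq_quad)

lemma k_integral: "(\<integral>\<^sup>+ \<beta>. ennreal (k (\<beta>, z)) \<partial>Rn d) = 1"
  using nn_integral_normal_dens[OF V C_vec] by (simp add: k_def)

text \<open>The exponents agree by \<open>complete_square\<close>. K is a ratio of normalizing
  constants: that of \<open>k\<close> over those of the prior and of the n likelihood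
  factors.\<close>

lemma joint_dens_eq:
  obtains K where "K > 0" "\<And>\<beta> z. joint_dens n m d \<nu> X Lam (\<beta>, z) = k (\<beta>, z) * (K * exp (- quad (n * m) G z / 2))"
proof -
  define D0 where "D0 = sqrt ((2 * pi) ^ d * det (\<nu>\<^sup>2 \<cdot>\<^sub>m 1\<^sub>m d :: real mat))"
  define D where "D = (\<lambda>i. sqrt ((2 * pi) ^ m * det (B i)))"
  define DV where "DV = sqrt ((2 * pi) ^ d * det V)"
  have D0: "D0 > 0" using \<nu> by (simp add: D0_def)
  have D: "D i > 0" if "i < n" for i using det_positive_definite_pos[OF B[OF that]] by (simp add: D_def)
  have DV: "DV > 0" using det_V by (simp add: DV_def)
  have prior_inv: "minv (\<nu>\<^sup>2 \<cdot>\<^sub>m 1\<^sub>m d) = (1 / \<nu>\<^sup>2) \<cdot>\<^sub>m 1\<^sub>m d"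
  proof (rule minv_eqI)
    show "\<nu>\<^sup>2 \<cdot>\<^sub>m 1\<^sub>m d * ((1 / \<nu>\<^sup>2) \<cdot>\<^sub>m 1\<^sub>m d) = (1\<^sub>m d :: real mat)"
      using \<nu> by (subst mult_smult_assoc_mat[of _ d d]) (auto intro!: eq_matI)
  qed auto
  have "joint_dens n m d \<nu> X Lam (\<beta>, z) = k (\<beta>, z) * (DV / (D0 * (\<Prod>i<n. D i)) * exp (- quad (n * m) G z / 2))" for \<beta> z
  proof -
    define b where "b = vec d \<beta>"
    define zz where "zz = vec (n * m) z"
    \<comment> \<open>The residual of the stacked vector. Its block i is the argument of likelihood
      factor i, and the block forms add up to the form of the inverse of Lam.\<close>
    define u where "u = (\<lambda>r. z r - (X *\<^sub>v b) $ r)"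
    have b: "b \<in> carrier_vec d" and zz: "zz \<in> carrier_vec (n * m)" by (auto simp: b_def zz_def)
    have prior: "normal_dens (\<nu>\<^sup>2 \<cdot>\<^sub>m 1\<^sub>m d) b = exp (- (1 / \<nu>\<^sup>2 * (b \<bullet> b)) / 2) / D0"
      using b by (simp add: normal_dens_def prior_inv smult_one_mult_vec D0_def b_def)
    have "normal_dens (block m Lam i i) (vec m (zblock m i z) - row_block m X i *\<^sub>v b) =
        exp (- quad m (minv (B i)) (zblock m i u) / 2) / D i" if i: "i < n" for i
    proof -
      have "vec m (zblock m i z) - row_block m X i *\<^sub>v b = vec m (zblock m i u)"
        using X_carrier b i
        by (intro eq_vecI) (auto simp: row_block_def zblock_def u_def scalar_prod_def block_index_less)
      then show ?thesis by (simp add: block_Lam[OF i] normal_dens_vec[OF minv_B_carrier[OF i]] D_def)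
    qed
    then have "(\<Prod>i<n. normal_dens (block m Lam i i) (vec m (zblock m i z) - row_block m X i *\<^sub>v b)) =
        (\<Prod>i<n. exp (- quad m (minv (B i)) (zblock m i u) / 2) / D i)" by (intro prod.cong) auto
    also have "\<dots> = exp (- (\<Sum>i<n. quad m (minv (B i)) (zblock m i u)) / 2) / (\<Prod>i<n. D i)"
      by (simp add: prod_dividef exp_sum[symmetric] sum_negf sum_divide_distrib)
    also have "(\<Sum>i<n. quad m (minv (B i)) (zblock m i u)) = quad (n * m) (minv Lam) u"
      unfolding minv_Lam by (rule positive_definite_diag_block_mat(2)[OF positive_definite_minv[OF B], symmetric])
    also have "quad (n * m) (minv Lam) u = (zz - X *\<^sub>v b) \<bullet> (minv Lam *\<^sub>v (zz - X *\<^sub>v b))"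
      using X_carrier by (subst quad_eq_scalar_prod[OF Li_carrier]) (auto simp: zz_def u_def intro!: quad_cong minus_carrier_vec)
    finally have lik: "(\<Prod>i<n. normal_dens (block m Lam i i) (vec m (zblock m i z) - row_block m X i *\<^sub>v b)) =
      exp (- ((zz - X *\<^sub>v b) \<bullet> (minv Lam *\<^sub>v (zz - X *\<^sub>v b))) / 2) / (\<Prod>i<n. D i)" .
    have kk: "k (\<beta>, z) = exp (- ((b - C *\<^sub>v zz) \<bullet> (A *\<^sub>v (b - C *\<^sub>v zz))) / 2) / DV"
      using carrier_matD[OF C_carrier] by (simp add: k_def normal_dens_def minv_V DV_def b_def zz_def)
    have Gq: "zz \<bullet> (G *\<^sub>v zz) = quad (n * m) G z"
      by (subst quad_eq_scalar_prod[OF G_carrier zz]) (auto simp: zz_def intro: quad_cong)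
    have "joint_dens n m d \<nu> X Lam (\<beta>, z) =
        exp (- (1 / \<nu>\<^sup>2 * (b \<bullet> b)) / 2) / D0 * (exp (- ((zz - X *\<^sub>v b) \<bullet> (minv Lam *\<^sub>v (zz - X *\<^sub>v b))) / 2) / (\<Prod>i<n. D i))"
      unfolding joint_dens_def prod.case b_def[symmetric] prior lik ..
    also have "\<dots> = exp (- (1 / \<nu>\<^sup>2 * (b \<bullet> b) + (zz - X *\<^sub>v b) \<bullet> (minv Lam *\<^sub>v (zz - X *\<^sub>v b))) / 2) / (D0 * (\<Prod>i<n. D i))"
      by (simp add: exp_add[symmetric] add_divide_distrib)
    also have "\<dots> = exp (- ((b - C *\<^sub>v zz) \<bullet> (A *\<^sub>v (b - C *\<^sub>v zz)) + quad (n * m) G z) / 2) / (D0 * (\<Prod>i<n. D i))"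
      unfolding complete_square[OF b zz] Gq ..
    also have "\<dots> = k (\<beta>, z) * (DV / (D0 * (\<Prod>i<n. D i)) * exp (- quad (n * m) G z / 2))"
      using DV by (simp add: kk exp_add[symmetric] add_divide_distrib)
    finally show ?thesis .
  qed
  moreover have "DV / (D0 * (\<Prod>i<n. D i)) > 0" using D0 D DV by (auto intro!: divide_pos_pos mult_pos_pos prod_pos)
  ultimately show ?thesis using that by blast
qed

text \<open>The all-ones response is the event that every coordinate is strictly positive. The
  normalizing integral Z is finite by the Gaussian integral of G and positive because of the cube,
  so the constant of the locale is K0 / Z.\<close>

lemma gaussian_posterior_posterior_dens:
  defines "post \<equiv> posterior_dens n m d \<nu> X Lam (\<lambda>i. vec m (\<lambda>a. 1))"
  shows "\<exists>K. gaussian_posterior n m d k G K post"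
proof -
  obtain K0 where K0: "K0 > 0"
    and joint: "\<And>\<beta> z. joint_dens n m d \<nu> X Lam (\<beta>, z) = k (\<beta>, z) * (K0 * exp (- quad (n * m) G z / 2))"
    by (rule joint_dens_eq) blast
  let ?M = "Rn d \<Otimes>\<^sub>M Rn (n * m)"
  note [measurable] = k_measurable
  define g where "g = (\<lambda>z. K0 * of_bool (\<forall>r<n * m. 0 < z r) * exp (- quad (n * m) G z / 2))"
  have [measurable]: "g \<in> borel_measurable (Rn (n * m))" unfolding g_def by measurable
  have g_nn: "0 \<le> g z" for z using K0 by (simp add: g_def)
  define f where "f = (\<lambda>x. k x * g (snd x))"
  have [measurable]: "f \<in> borel_measurable ?M" unfolding f_def by measurable
  have f_nn: "0 \<le> f x" for x using k_pos[of x] g_nn by (simp add: f_def)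
  have resp: "(\<forall>i<n. response m (zblock m i z) = vec m (\<lambda>a. 1)) \<longleftrightarrow> (\<forall>r<n * m. 0 < z r)" for z
  proof -
    have "response m (zblock m i z) = vec m (\<lambda>a. 1) \<longleftrightarrow> (\<forall>a<m. 0 < z (i * m + a))" for i
      by (auto simp: response_def zblock_def vec_eq_iff split: if_splits)
    moreover have "(\<forall>i<n. \<forall>a<m. 0 < z (i * m + a)) \<longleftrightarrow> (\<forall>r<n * m. 0 < z r)"
    proof safe
      fix r assume *: "\<forall>i<n. \<forall>a<m. 0 < z (i * m + a)" "r < n * m"
      then have "0 < z (r div m * m + r mod m)" using block_index_div_mod by blast
      then show "0 < z r" by simp
    qed (simp add: block_index_less)
    ultimately show ?thesis by simp
  qed
  have post: "post = (\<lambda>x. f x / (\<integral>x'. f x' \<partial>?M))"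
  proof -
    have "(\<lambda>(\<beta>, z). joint_dens n m d \<nu> X Lam (\<beta>, z) * of_bool (\<forall>i<n. response m (zblock m i z) = vec m (\<lambda>a. 1))) = f"
    proof (rule ext, clarify)
      fix \<beta> z
      show "joint_dens n m d \<nu> X Lam (\<beta>, z) * of_bool (\<forall>i<n. response m (zblock m i z) = vec m (\<lambda>a. 1)) = f (\<beta>, z)"
        unfolding joint resp f_def g_def by simp
    qed
    then show ?thesis by (simp only: post_def posterior_dens_def Let_def)
  qed
  have f_int: "(\<integral>\<^sup>+ x. ennreal (f x) \<partial>?M) = (\<integral>\<^sup>+ z. ennreal (g z) \<partial>Rn (n * m))"
  proof -
    have "(\<integral>\<^sup>+ x. ennreal (f x) \<partial>?M) = (\<integral>\<^sup>+ z. \<integral>\<^sup>+ \<beta>. ennreal (k (\<beta>, z)) * ennreal (g z) \<partial>Rn d \<partial>Rn (n * m))"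
      by (subst Rn_pair.nn_integral_snd[symmetric]) (auto simp: f_def ennreal_mult k_pos g_nn less_imp_le)
    also have "\<dots> = (\<integral>\<^sup>+ z. ennreal (g z) \<partial>Rn (n * m))"
      by (intro nn_integral_cong) (subst nn_integral_multc, simp_all add: k_integral)
    finally show ?thesis .
  qed
  have "(\<integral>\<^sup>+ z. ennreal (g z) \<partial>Rn (n * m)) \<le> (\<integral>\<^sup>+ z. ennreal K0 * ennreal (exp (- quad (n * m) G (\<lambda>r. z r - 0) / 2)) \<partial>Rn (n * m))"
    using K0 by (intro nn_integral_mono) (auto simp: g_def ennreal_mult[symmetric])
  also have "\<dots> = ennreal K0 * ennreal (sqrt ((2 * pi) ^ (n * m) / det G))"
    using nn_integral_gaussian[OF G, of "\<lambda>_. 0"] by (subst nn_integral_cmult) simp_all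
  also have "\<dots> < \<infinity>" by (simp add: ennreal_mult_less_top)
  finally have g_fin: "(\<integral>\<^sup>+ z. ennreal (g z) \<partial>Rn (n * m)) < \<infinity>" .
  have g_nz: "(\<integral>\<^sup>+ z. ennreal (g z) \<partial>Rn (n * m)) \<noteq> 0"
  proof
    assume "(\<integral>\<^sup>+ z. ennreal (g z) \<partial>Rn (n * m)) = 0"
    then have "AE z in Rn (n * m). ennreal (g z) = 0" by (subst (asm) nn_integral_0_iff_AE) auto
    then have "AE z in Rn (n * m). ennreal (of_bool (positive_cube (n * m) z)) = 0"
    proof eventually_elim
      case (elim z)
      show ?case
      proof (cases "positive_cube (n * m) z")
        case True
        then have "g z > 0" using K0 by (simp add: g_def positive_cube_def)
        with elim show ?thesis by (simp add: ennreal_eq_0_iff)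
      qed simp
    qed
    then have "(\<integral>\<^sup>+ z. ennreal (of_bool (positive_cube (n * m) z)) \<partial>Rn (n * m)) = 0"
      by (subst nn_integral_0_iff_AE) (use prob_densityD(1)[OF prob_density_cube] in auto)
    then show False using prob_densityD(4)[OF prob_density_cube, of "n * m"] by simp
  qed
  define Z where "Z = (\<integral>x'. f x' \<partial>?M)"
  have "integrable ?M f" using g_fin f_nn by (intro integrableI_nonneg) (auto simp: f_int)
  then have Z: "(\<integral>\<^sup>+ x. ennreal (f x) \<partial>?M) = ennreal Z"
    unfolding Z_def using f_nn by (intro nn_integral_eq_integral) auto
  have Zpos: "Z > 0" using g_nz Z f_int by (metis ennreal_eq_0_iff not_le)
  have pd: "prob_density ?M post"
  proof (rule prob_densityI)
    show "post \<in> borel_measurable ?M" unfolding post by measurable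
    show "0 \<le> post x" for x using f_nn Zpos by (simp add: post Z_def[symmetric])
    have "(\<integral>\<^sup>+ x. ennreal (post x) \<partial>?M) = (\<integral>\<^sup>+ x. ennreal (f x) * ennreal (1 / Z) \<partial>?M)"
      using f_nn Zpos by (intro nn_integral_cong) (simp add: post Z_def[symmetric] ennreal_mult[symmetric])
    also have "\<dots> = ennreal Z * ennreal (1 / Z)" by (subst nn_integral_multc) (simp_all add: Z)
    also have "\<dots> = ennreal (Z * (1 / Z))" by (rule ennreal_mult[symmetric]) (use Zpos in auto)
    finally show "(\<integral>\<^sup>+ x. ennreal (post x) \<partial>?M) = 1" using Zpos by simp
  qed
  have "gaussian_posterior n m d k G (K0 / Z) post"
  proof
    show "post = (\<lambda>(\<beta>, z). k (\<beta>, z) * (K0 / Z * of_bool (\<forall>r<n * m. 0 < z r) * exp (- quad (n * m) G z / 2)))"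
      unfolding post Z_def[symmetric] by (rule ext) (simp add: f_def g_def split_paired_all)
  qed (use k_measurable k_pos k_integral G K0 Zpos pd in auto)
  then show ?thesis by blast
qed

end

section \<open>The block notation of the theorem\<close>

lemma bij_betw_insert_index: "i < n \<Longrightarrow> bij_betw (insert_index i) {..<n - 1} ({..<n} - {i})"
  by (rule bij_betw_byWitness[of _ "delete_index i"])
     (auto simp: insert_index_def delete_index_def)

text \<open>In (i) the null sets in z are those of the marginal law under \<open>qstar\<close>,
  since a conditional density carries no information where the marginal vanishes. Integrability is
  part of (ii), so that \<open>mean_minus\<close> is a genuine expectation and not the default value
  of a divergent integral.\<close>

theorem mainTheorem2:
  fixes n p L :: nat and \<nu> :: real
    and x :: "nat \<Rightarrow> real vec" and y :: "nat \<Rightarrow> nat" and S X Lam V H :: "real mat"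
    and post qstar :: "(nat \<Rightarrow> real) \<times> (nat \<Rightarrow> real) \<Rightarrow> real"
    and qz :: "nat \<Rightarrow> (nat \<Rightarrow> real) \<Rightarrow> real"
  assumes "n \<ge> 1" and "p \<ge> 1" and "L \<ge> 2" and "\<nu> > 0"
    and "\<forall>i<n. x i \<in> carrier_vec p"
    and "\<forall>i<n. y i < L"
    and "positive_definite L S"
    and X: "X = Xbar n p L x y"
    and Lam: "Lam = Lambda n L S y"
    and V: "V = minv ((1 / \<nu>\<^sup>2) \<cdot>\<^sub>m 1\<^sub>m (p * (L - 1)) + X\<^sup>T * minv Lam * X)"
    and H: "H = minv Lam * X * V * X\<^sup>T * minv Lam"
    and post: "post = posterior_dens n (L - 1) (p * (L - 1)) \<nu> X Lam (\<lambda>i. vec (L - 1) (\<lambda>a. 1))"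
    and factorization: "factorizes n (L - 1) (p * (L - 1)) qstar qz"
    and minimal: "\<forall>q \<in> approx_class n (L - 1) (p * (L - 1)).
      KL (Rn (p * (L - 1)) \<Otimes>\<^sub>M Rn (n * (L - 1))) qstar post
        \<le> KL (Rn (p * (L - 1)) \<Otimes>\<^sub>M Rn (n * (L - 1))) q post"
  shows "(AE z in density (Rn (n * (L - 1))) (\<lambda>z. ennreal (\<Prod>i<n. qz i (zblock (L - 1) i z))).
           AE \<beta> in Rn (p * (L - 1)).
             cond_beta_dens (p * (L - 1)) qstar \<beta> z = cond_beta_dens (p * (L - 1)) post \<beta> z \<and>
             cond_beta_dens (p * (L - 1)) post \<beta> z
               = normal_dens V (vec (p * (L - 1)) \<beta> - (V * X\<^sup>T * minv Lam) *\<^sub>v vec (n * (L - 1)) z)) \<and>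
         (\<forall>i<n.
           let S_i = minv (minv (block (L - 1) Lam i i) - block (L - 1) H i i);
               mu_i = (S_i * block_row_minus n (L - 1) H i) *\<^sub>v mean_minus n (L - 1) qz i
           in (\<forall>r < (n - 1) * (L - 1). integrable (Rn ((n - 1) * (L - 1)))
                 (\<lambda>u. u r * dens_minus n (L - 1) qz i u)) \<and>
              (AE w in Rn (L - 1).
                 qz i w = truncated_normal_dens (L - 1) mu_i S_i {w. \<forall>a < L - 1. w a \<ge> 0} w))"
proof -
  define m where "m = L - 1"
  define d where "d = p * m"
  define B where "B = (\<lambda>i. V_minus L (y i) * S * (V_minus L (y i))\<^sup>T)"
  interpret R: probit_model n m d \<nu> X B
  proof
    show "X \<in> carrier_mat (n * m) d" by (simp add: X Xbar_def m_def d_def)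
    show "positive_definite m (B i)" if "i < n" for i
      unfolding B_def m_def using positive_definite_V_minus assms(6,7) that by blast
  qed (rule assms(4))
  have Lam_eq: "Lam = R.Lam" by (simp only: Lam Lambda_def R.Lam_def) (simp only: B_def)
  have V_eq: "V = R.V" by (simp only: V Lam_eq R.V_def R.A_def) (simp only: d_def m_def)
  have C_eq: "V * X\<^sup>T * minv Lam = R.C" by (simp only: V_eq Lam_eq R.C_def)
  have G_eq: "R.G = minv R.Lam - H" by (simp only: H V_eq Lam_eq R.G_def)
  have H_carrier: "H \<in> carrier_mat (n * m) (n * m)"
    using R.Li_carrier by (intro carrier_matI) (auto simp: H Lam_eq)
  obtain K where "gaussian_posterior n m d R.k R.G K post"
    using R.gaussian_posterior_posterior_dens by (auto simp: post Lam_eq m_def d_def)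
  then interpret P: gaussian_posterior n m d R.k R.G K post .

  text \<open>Densities outside the index range are irrelevant, but the product measures need some.\<close>
  define t where "t = (\<lambda>j. if j < n then qz j else (\<lambda>w. of_bool (positive_cube m w)))"
  have t_eq: "t j = qz j" if "j < n" for j using that by (simp add: t_def)
  have prod_t: "(\<Prod>i<n. t i (zblock m i z)) = (\<Prod>i<n. qz i (zblock m i z))" for z
    by (intro prod.cong) (auto simp: t_eq)
  have fac0: "factorizes n m d qstar qz" using factorization by (simp only: m_def d_def)
  have t: "prob_density (Rn m) (t j)" for j
    using fac0 by (simp add: t_def factorizes_def prob_density_cube)
  have fac: "factorizes n m d qstar t"
    using fac0 t by (simp add: factorizes_def prod_t)
  have min: "\<forall>q\<in>approx_class n m d.
      KL (Rn d \<Otimes>\<^sub>M Rn (n * m)) qstar post \<le> KL (Rn d \<Otimes>\<^sub>M Rn (n * m)) q post"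
    using minimal by (simp only: m_def d_def)

  define S' where "S' = (\<lambda>i. minv (minv (block m Lam i i) - block m H i i))"
  define mu where "mu = (\<lambda>i. (S' i * block_row_minus n m H i) *\<^sub>v mean_minus n m qz i)"
  define \<tau> where "\<tau> = (\<lambda>i. truncated_normal_dens m (mu i) (minv (block m R.G i i)) {w. \<forall>a<m. 0 \<le> w a})"
  have minv_Lam_index: "minv R.Lam $$ (i * m + a, j * m + b) = (if i = j then minv (B i) $$ (a, b) else 0)"
    if "i < n" "j < n" "a < m" "b < m" for i j a b
    unfolding R.minv_Lam using block_diag_block_mat[of n "\<lambda>i. minv (B i)" m, OF R.minv_B_carrier] that by simp
  \<comment> \<open>Lam is block diagonal, so off the diagonal blocks G is - H; this explains the
    positive sign of H in mu_i.\<close>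
  have G_index: "R.G $$ (i * m + a, j * m + b) =
      (if i = j then minv (B i) $$ (a, b) else 0) - H $$ (i * m + a, j * m + b)"
    if "i < n" "j < n" "a < m" "b < m" for i j a b
    using that H_carrier R.Li_carrier by (simp add: G_eq minv_Lam_index block_index_less)
  \<comment> \<open>The claimed covariance is the inverse of a diagonal block of the joint
    precision, that is, the conditional covariance of block i given the others in the untruncated
    law.\<close>
  have S'_eq: "S' i = minv (block m R.G i i)" if i: "i < n" for i
  proof -
    have "minv (B i) - block m H i i = block m R.G i i"
      using R.minv_B_carrier[OF i] i by (intro eq_matI) (auto simp: block_def G_index)
    then show ?thesis by (simp add: S'_def Lam_eq R.block_Lam[OF i])
  qed
  have S'_carrier: "S' i \<in> carrier_mat m m" and G_S': "block m R.G i i * S' i = 1\<^sub>m m" if "i < n" for i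
    using minv_positive_definite(1,2)[OF positive_definite_block[OF R.G that]] by (simp_all add: S'_eq[OF that])
  have mu: "mu i \<in> carrier_vec m" if "i < n" for i
    using S'_carrier[OF that] by (auto simp: mu_def intro!: carrier_vecI)

  have results: "(AE w in Rn m. qz i w = \<tau> i w) \<and>
      (AE \<omega> in Rn d \<Otimes>\<^sub>M Rn (n * m). qstar \<omega> = P.cand (t(i := \<tau> i)) \<omega>) \<and>
      (\<forall>r<(n - 1) * m. integrable (Rn ((n - 1) * m)) (\<lambda>u. u r * dens_minus n m qz i u))"
    if sq: "\<And>j a. j < n \<Longrightarrow> a < m \<Longrightarrow> integrable (law m t j) (\<lambda>w. (w a)\<^sup>2)" and i: "i < n" for i
  proof -
    let ?t = "\<lambda>s. t (insert_index i s)"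
    have ins: "insert_index i s < n" if "s < n - 1" for s using that i by (auto simp: insert_index_def)
    have lin: "integrable (law m t j) (\<lambda>w. w a)" if "j < n" "a < m" for j a
      using prob_space.integrable_if_sq[OF prob_densityD(3)[OF t] sq[OF that]] coordinate_measurable[OF that(2)] by simp
    have dens: "dens_minus n m qz i u = (\<Prod>s<n - 1. ?t s (zblock m s u))" for u
      unfolding dens_minus_def using ins by (intro prod.cong) (auto simp: t_eq)
    have coord: "integrable (Rn ((n - 1) * m)) (\<lambda>u. u (s * m + b) * dens_minus n m qz i u)"
      "(\<integral>u. u (s * m + b) * dens_minus n m qz i u \<partial>Rn ((n - 1) * m)) = (\<integral>v. v b \<partial>law m t (insert_index i s))"
      if "s < n - 1" "b < m" for s b
      unfolding dens using integral_coordinate_prod_dens[of m ?t, OF t that] lin[OF ins that(2)] that(1) by auto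
    have int: "\<forall>r<(n - 1) * m. integrable (Rn ((n - 1) * m)) (\<lambda>u. u r * dens_minus n m qz i u)"
    proof (intro allI impI)
      fix r assume "r < (n - 1) * m"
      then have "r div m < n - 1" "r mod m < m" using block_index_div_mod by auto
      from coord(1)[OF this] show "integrable (Rn ((n - 1) * m)) (\<lambda>u. u r * dens_minus n m qz i u)" by simp
    qed
    let ?R = "block_row_minus n m H i" and ?e = "mean_minus n m qz i"
    have R: "?R \<in> carrier_mat m ((n - 1) * m)" and e: "?e \<in> carrier_vec ((n - 1) * m)"
      by (auto simp: block_row_minus_def mean_minus_def)
    \<comment> \<open>Multiplication by G_ii undoes the inverse in mu_i and yields the linear system
      that \<open>coordinate_ascent_optimum\<close> expects.\<close>
    have "block m R.G i i *\<^sub>v mu i = ?R *\<^sub>v ?e"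
    proof -
      have Gi: "block m R.G i i \<in> carrier_mat m m" by (simp add: block_def)
      have "mu i = S' i *\<^sub>v (?R *\<^sub>v ?e)"
        unfolding mu_def using S'_carrier[OF i] R e by (intro assoc_mult_mat_vec) auto
      then have "block m R.G i i *\<^sub>v mu i = block m R.G i i * S' i *\<^sub>v (?R *\<^sub>v ?e)"
        using Gi S'_carrier[OF i] R e by (simp add: assoc_mult_mat_vec[of _ m m _ m])
      then show ?thesis using R e by (simp add: G_S'[OF i])
    qed
    then have "(\<Sum>b<m. R.G $$ (i * m + a, i * m + b) * mu i $ b) = (?R *\<^sub>v ?e) $ a" if "a < m" for a
    proof -
      have "(block m R.G i i *\<^sub>v mu i) $ a = (\<Sum>b<m. R.G $$ (i * m + a, i * m + b) * mu i $ b)"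
        using that mu[OF i] by (simp add: block_def scalar_prod_def atLeast0LessThan)
      then show ?thesis using \<open>block m R.G i i *\<^sub>v mu i = ?R *\<^sub>v ?e\<close> by simp
    qed
    moreover have "(?R *\<^sub>v ?e) $ a = - (\<Sum>j\<in>{..<n} - {i}. \<Sum>b<m. R.G $$ (i * m + a, j * m + b) * (\<integral>v. v b \<partial>law m t j))"
      if a: "a < m" for a
    proof -
      have "(?R *\<^sub>v ?e) $ a = (\<Sum>c<(n - 1) * m. ?R $$ (a, c) * ?e $ c)"
        using a R e by (simp add: scalar_prod_def atLeast0LessThan)
      \<comment> \<open>Position c among the stacked remaining blocks is entry b of block s, and
        block s is the original block \<open>insert_index i s\<close>.\<close>
      also have "\<dots> = (\<Sum>s<n - 1. \<Sum>b<m. H $$ (i * m + a, insert_index i s * m + b) * (\<integral>v. v b \<partial>law m t (insert_index i s)))"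
        unfolding sum_blocks using a
        by (intro sum.cong refl) (simp add: block_row_minus_def mean_minus_def block_def block_index_less coord(2)[unfolded One_nat_def])
      also have "\<dots> = (\<Sum>j\<in>{..<n} - {i}. \<Sum>b<m. H $$ (i * m + a, j * m + b) * (\<integral>v. v b \<partial>law m t j))"
        by (rule sum.reindex_bij_betw[OF bij_betw_insert_index[OF i]])
      also have "\<dots> = - (\<Sum>j\<in>{..<n} - {i}. \<Sum>b<m. R.G $$ (i * m + a, j * m + b) * (\<integral>v. v b \<partial>law m t j))"
        unfolding sum_negf[symmetric] using a i by (intro sum.cong refl) (auto simp: G_index)
      finally show ?thesis .
    qed
    ultimately have mean: "(\<Sum>b<m. R.G $$ (i * m + a, i * m + b) * mu i $ b) =
        - (\<Sum>j\<in>{..<n} - {i}. \<Sum>b<m. R.G $$ (i * m + a, j * m + b) * (\<integral>v. v b \<partial>law m t j))" if "a < m" for a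
      using that by simp
    note opt = P.coordinate_ascent_optimum[OF fac t min i mu[OF i] mean]
    show ?thesis using opt(1,2) int by (simp add: \<tau>_def t_eq[OF i])
  qed
  note fin = P.minimizer_regular[OF fac t min]
  have part_ii: "(\<forall>r<(n - 1) * m. integrable (Rn ((n - 1) * m)) (\<lambda>u. u r * dens_minus n m qz i u)) \<and>
      (AE w in Rn m. qz i w = truncated_normal_dens m (mu i) (S' i) {w. \<forall>a<m. 0 \<le> w a} w)" if "i < n" for i
    using results[OF fin(1) that] by (simp add: \<tau>_def S'_eq[OF that])
  \<comment> \<open>One updated block is enough for (i), since the candidate has \<open>k\<close> as
    its conditional whichever block is replaced; block 0 exists because n is at least 1.\<close>
  have "0 < n" using assms(1) by simp
  have \<tau>: "prob_density (Rn m) ((t(0 := \<tau> 0)) j)" for j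
    using t truncated_normal(1)[OF positive_definite_minv[OF positive_definite_block[OF R.G \<open>0 < n\<close>]] refl mu[OF \<open>0 < n\<close>] refl]
    by (simp add: \<tau>_def)
  have "AE z in density (Rn (n * m)) (\<lambda>z. ennreal (\<Prod>i<n. t i (zblock m i z))).
    AE \<beta> in Rn d. cond_beta_dens d qstar \<beta> z = cond_beta_dens d post \<beta> z \<and> cond_beta_dens d post \<beta> z = R.k (\<beta>, z)"
  proof (rule P.cond_beta_optimum[where t' = "t(0 := \<tau> 0)", OF fac t])
    show "prob_density (Rn m) ((t(0 := \<tau> 0)) j)" for j by (rule \<tau>)
    show "AE w in Rn m. 0 < t j w \<longrightarrow> (\<forall>a<m. 0 < w a)" if "j < n" for j by (rule fin(2)[OF that])
    show "AE \<omega> in Rn d \<Otimes>\<^sub>M Rn (n * m). qstar \<omega> = P.cand (t(0 := \<tau> 0)) \<omega>"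
      using results[OF fin(1) \<open>0 < n\<close>] by blast
  qed
  then have part_i: "AE z in density (Rn (n * m)) (\<lambda>z. ennreal (\<Prod>i<n. qz i (zblock m i z))).
    AE \<beta> in Rn d. cond_beta_dens d qstar \<beta> z = cond_beta_dens d post \<beta> z \<and>
      cond_beta_dens d post \<beta> z = normal_dens V (vec d \<beta> - (V * X\<^sup>T * minv Lam) *\<^sub>v vec (n * m) z)"
    by (simp only: prod_t R.k_def prod.case C_eq V_eq[symmetric])
  show ?thesis
    using part_i part_ii
    unfolding Let_def m_def[symmetric] d_def[symmetric] mu_def S'_def by blast
qed

end
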